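(* For both problems HM-Saddle and $\nu$-Saddle, the algorithm Saddle-SVC (with domains $(\mathcal S_1,\mathcal S_2)=(\Delta_{n_1},\Delta_{n_2})$, respectively $(\mathcal S_1,\mathcal S_2)=(\mathcal D_{n_1},\mathcal D_{n_2})$) computes a $(1-\epsilon)$-approximate solution within $\tilde O\big(d+\sqrt{d/(\epsilon\beta)}\big)$ iterations. Moreover, each iteration takes $O(n)$ time.
   Context: **Data.** $n$ points $x_i\in\mathbb R^d$ with labels $\pm1$; $n_1$ points have label $+1$ and form the columns of $A\in\mathbb R^{d\times n_1}$; $n_2$ points have label $-1$ and form the columns of $B\in\mathbb R^{d\times n_2}$; $n=n_1+n_2$. The points are scaled so that $\|x_i\|^2\le 1$. $\beta$ denotes the ratio of the minimum distance to the maximum distance among the points. $\|\cdot\|$ is the Euclidean norm. $\nu\in(0,1]$ is regarded as a constant. $\tilde O$ hides logarithmic factors such as $\log n$, $\log\beta$, $\log(1/\epsilon)$. **Domains.** $\Delta_m=\{u\in\mathbb R^m: u\ge 0,\ \sum_i u_i=1\}$ and $\mathcal D_m=\{u\in\Delta_m: u_i\le\nu\ \forall i\}$. In HM-Saddle the two classes are linearly separable. **Problems.** Let $H(u)=\sum_i u_i\log u_i$ and $\gamma=\epsilon\beta/(2\log n)$. The regularized saddle point problem is $$\max_{w\in\mathbb R^d}\ \min_{\eta\in\mathcal S_1,\ \xi\in\mathcal S_2}\ w^{T}A\eta-w^{T}B\xi+\gamma H(\eta)+\gamma H(\xi)-\tfrac12\|w\|^2 .$$ It is called HM-Saddle when $(\mathcal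 S_1,\mathcal S_2)=(\Delta_{n_1},\Delta_{n_2})$ and $\nu$-Saddle when $(\mathcal S_1,\mathcal S_2)=(\mathcal D_{n_1},\mathcal D_{n_2})$. Let $(w^\circ,\eta^\circ,\xi^\circ)$ be its optimal solution. **Approximation.** Let $g(w)=\min_{\eta\in\mathcal S_1,\xi\in\mathcal S_2} w^{T}A\eta-w^{T}B\xi-\frac12\|w\|^2$ and $\mathsf{OPT}=\max_w g(w)$. The (random) output $w[T]$ after $T$ iterations is a $(1-\epsilon)$-approximate solution if $\mathbb E[g(w^\circ)-g(w[T])]\le\epsilon\,\mathsf{OPT}$. **Algorithm Saddle-SVC.** *Pre-processing:* let $W$ be the $d\times d$ Walsh–Hadamard matrix (normalized to be orthogonal) and $D$ a $d\times d$ diagonal matrix with i.i.d. uniform $\pm1$ diagonal entries; set $X^+=WDA$, $X^-=WDB$ (with high probability all entries are $O(\sqrt{\log n/d})$ in absolute value; since $WD$ is orthogonal, replacing $A,B$ by $X^+,X^-$ only rotates/reflects the problem, and the iterates $w[t]$ live in the transformed coordinates). Set $q=O(\sqrt{\log n})$, $\tau=\frac1{2q}\sqrt{d/\gamma}$, $\sigma=\frac1{2q}\sqrt{d\gamma}$, $\theta=1-\frac{1}{d+q\sqrt d/\sqrt\gamma}$, $w[0]=0$, $\eta[-1]=\eta[0]=\mathbf 1/n_1$, $\xi[-1]=\xi[0]=\mathbf 1/n_2$. *Iteration $t$ ($t=0,1,2,\dots$):* pick $i^*\in\{1,\dots,d\}$ uniformly at random. With $X^\pm_{i^*}$ the $i^*$-th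 row, set $\delta^+=\langle X^+_{i^*},\eta[t]+\theta(\eta[t]-\eta[t-1])\rangle$ and $\delta^-=\langle X^-_{i^*},\xi[t]+\theta(\xi[t]-\xi[t-1])\rangle$. Set $w_{i^*}[t+1]=(w_{i^*}[t]+\sigma(\delta^+-\delta^-))/(\sigma+1)$ and $w_i[t+1]=w_i[t]$ for $i\ne i^*$. With $v=w[t]+d(w[t+1]-w[t])$ and $V_x(y)=H(y)-\langle\nabla H(x),y-x\rangle-H(x)$, set $$\eta[t+1]=\arg\min_{\eta\in\mathcal S_1}\Big\{\tfrac1d v^{T}X^+\eta+\tfrac\gamma d H(\eta)+\tfrac1\tau V_{\eta[t]}(\eta)\Big\},\qquad \xi[t+1]=\arg\min_{\xi\in\mathcal S_2}\Big\{-\tfrac1d v^{T}X^-\xi+\tfrac\gamma d H(\xi)+\tfrac1\tau V_{\xi[t]}(\xi)\Big\}.$$ *Implementation of the argmin steps:* over $\Delta_{n_1}$, $\eta_i[t+1]$ is proportional to $\exp\{(\gamma+d\tau^{-1})^{-1}(d\tau^{-1}\log\eta_i[t]-\langle v,X^+_{\cdot i}\rangle)\}$, normalized to sum to 1 (for $\xi$: the same with $X^-$ and a plus sign before the inner product). Over $\mathcal D_{n_1}$ one starts from this normalized vector and, while $\varsigma:=\sum_{\eta_i>\nu}(\eta_i-\nu)\neq0$, lets $\Omega=\sum_{\eta_i<\nu}\eta_i$, replaces every $\eta_i\ge\nu$ by $\nu$ and every $\eta_i<\nu$ by $\eta_i(1+\varsigma/\Omega)$; similarly for $\xi$.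
   Formalization: The hidden logarithms include log d and log(1+1/OPT), without which the bound fails; d is a power of 2; the expectation is over coordinates, for random signs D giving entries O(√(log n/d)), of probability at least 1-d/n^c; if OPT=0 only some T within the bound is claimed. *)

theory Defs
  imports
    "HOL-Probability.Probability"
    "HOL-Library.While_Combinator"
    "Jordan_Normal_Form.Matrix"
begin

unbundle no vec_syntax and no inner_syntax
hide_const (open) Finite_Cartesian_Product.vec Finite_Cartesian_Product.mat
  Finite_Cartesian_Product.row Finite_Cartesian_Product.column
hide_type (open) Finite_Cartesian_Product.vec

text \<open>
  The numbers \<open>d\<close>, \<open>n\<^sub>1\<close>, \<open>n\<^sub>2\<close> vary under the constants hidden in \<open>O(\<dots>)\<close>, so vectors and
  matrices carry their dimensions as values. The columns of \<open>A\<close> are the points with label \<open>+1\<close>,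
  those of \<open>B\<close> the points with label \<open>-1\<close>.
\<close>

section \<open>The saddle point problems\<close>

datatype saddle_problem = HM_Saddle | Nu_Saddle real

definition prob_simplex :: "nat \<Rightarrow> real Matrix.vec set" where
  "prob_simplex m = {u \<in> carrier_vec m. (\<forall>i<m. 0 \<le> u $ i) \<and> (\<Sum>i<m. u $ i) = 1}"

definition capped_simplex :: "real \<Rightarrow> nat \<Rightarrow> real Matrix.vec set" where
  "capped_simplex \<nu> m = {u \<in> prob_simplex m. \<forall>i<m. u $ i \<le> \<nu>}"

fun feasible :: "saddle_problem \<Rightarrow> nat \<Rightarrow> real Matrix.vec set" where
  "feasible HM_Saddle m = prob_simplex m"
| "feasible (Nu_Saddle \<nu>) m = capped_simplex \<nu> m"

definition points :: "real Matrix.mat \<Rightarrow> real Matrix.mat \<Rightarrow> real Matrix.vec set" where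
  "points A B = set (cols A) \<union> set (cols B)"

definition pairwise_distances :: "real Matrix.mat \<Rightarrow> real Matrix.mat \<Rightarrow> real set" where
  "pairwise_distances A B =
     {sqrt ((x - y) \<bullet> (x - y)) | x y. x \<in> points A B \<and> y \<in> points A B \<and> x \<noteq> y}"

text \<open>Repeated points count once; for pairwise distinct columns this is the minimum and maximum
  over all pairs of indices.\<close>

definition distance_ratio :: "real Matrix.mat \<Rightarrow> real Matrix.mat \<Rightarrow> real" where
  "distance_ratio A B = Min (pairwise_distances A B) / Max (pairwise_distances A B)"

definition linearly_separable :: "real Matrix.mat \<Rightarrow> real Matrix.mat \<Rightarrow> bool" where
  "linearly_separable A B \<longleftrightarrow>
     (\<exists>w \<in> carrier_vec (dim_row A). \<exists>b. (\<forall>x \<in> set (cols A). b < w \<bullet> x) \<and> (\<forall>y \<in> set (cols B). w \<bullet> y < b))"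

text \<open>The \<open>\<nu>\<close>-problem presupposes \<open>\<nu> \<ge> 1/n\<^sub>1\<close> and \<open>\<nu> \<ge> 1/n\<^sub>2\<close>, as otherwise its domain is empty;
  \<open>\<beta>\<close> presupposes two distinct points.\<close>

fun admissible :: "saddle_problem \<Rightarrow> real Matrix.mat \<Rightarrow> real Matrix.mat \<Rightarrow> bool" where
  "admissible HM_Saddle A B \<longleftrightarrow> linearly_separable A B"
| "admissible (Nu_Saddle \<nu>) A B \<longleftrightarrow> 1 \<le> \<nu> * real (dim_col A) \<and> 1 \<le> \<nu> * real (dim_col B)"

definition svm_instance ::
  "saddle_problem \<Rightarrow> nat \<Rightarrow> nat \<Rightarrow> nat \<Rightarrow> real Matrix.mat \<Rightarrow> real Matrix.mat \<Rightarrow> bool" where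
  "svm_instance P d n\<^sub>1 n\<^sub>2 A B \<longleftrightarrow>
     A \<in> carrier_mat d n\<^sub>1 \<and> B \<in> carrier_mat d n\<^sub>2 \<and> 1 \<le> n\<^sub>1 \<and> 1 \<le> n\<^sub>2 \<and>
     (\<forall>x \<in> points A B. x \<bullet> x \<le> 1) \<and> (\<exists>x \<in> points A B. \<exists>y \<in> points A B. x \<noteq> y) \<and>
     admissible P A B"

definition entropy :: "real Matrix.vec \<Rightarrow> real" where
  "entropy u = (\<Sum>i<dim_vec u. u $ i * ln (u $ i))"

text \<open>\<open>\<nabla>H(x)\<close> has the components \<open>ln x\<^sub>i + 1\<close>.\<close>

definition entropy_bregman :: "real Matrix.vec \<Rightarrow> real Matrix.vec \<Rightarrow> real" where
  "entropy_bregman x y =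
     entropy y - (\<Sum>i<dim_vec x. (ln (x $ i) + 1) * (y $ i - x $ i)) - entropy x"

definition payoff ::
  "real Matrix.mat \<Rightarrow> real Matrix.mat \<Rightarrow> real Matrix.vec \<Rightarrow> real Matrix.vec \<Rightarrow> real Matrix.vec \<Rightarrow> real" where
  "payoff A B w \<eta> \<xi> = w \<bullet> (A *\<^sub>v \<eta>) - w \<bullet> (B *\<^sub>v \<xi>) - (w \<bullet> w) / 2"

definition reg_payoff ::
  "real Matrix.mat \<Rightarrow> real Matrix.mat \<Rightarrow> real \<Rightarrow> real Matrix.vec \<Rightarrow> real Matrix.vec \<Rightarrow> real Matrix.vec \<Rightarrow> real" where
  "reg_payoff A B \<gamma> w \<eta> \<xi> =
     w \<bullet> (A *\<^sub>v \<eta>) - w \<bullet> (B *\<^sub>v \<xi>) + \<gamma> * entropy \<eta> + \<gamma> * entropy \<xi> - (w \<bullet> w) / 2"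

definition optimal_solution ::
  "saddle_problem \<Rightarrow> real Matrix.mat \<Rightarrow> real Matrix.mat \<Rightarrow> real \<Rightarrow>
   real Matrix.vec \<Rightarrow> real Matrix.vec \<Rightarrow> real Matrix.vec \<Rightarrow> bool" where
  "optimal_solution P A B \<gamma> w \<eta> \<xi> \<longleftrightarrow>
     w \<in> carrier_vec (dim_row A) \<and> \<eta> \<in> feasible P (dim_col A) \<and> \<xi> \<in> feasible P (dim_col B) \<and>
     (\<forall>\<eta>' \<in> feasible P (dim_col A). \<forall>\<xi>' \<in> feasible P (dim_col B).
        reg_payoff A B \<gamma> w \<eta> \<xi> \<le> reg_payoff A B \<gamma> w \<eta>' \<xi>') \<and>
     (\<forall>w' \<in> carrier_vec (dim_row A).
        (INF (\<eta>', \<xi>') \<in> feasible P (dim_col A) \<times> feasible P (dim_col B). reg_payoff A B \<gamma> w' \<eta>' \<xi>')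
          \<le> reg_payoff A B \<gamma> w \<eta> \<xi>)"

definition saddle_value ::
  "saddle_problem \<Rightarrow> real Matrix.mat \<Rightarrow> real Matrix.mat \<Rightarrow> real Matrix.vec \<Rightarrow> real" where
  "saddle_value P A B w =
     (INF (\<eta>, \<xi>) \<in> feasible P (dim_col A) \<times> feasible P (dim_col B). payoff A B w \<eta> \<xi>)"

definition OPT :: "saddle_problem \<Rightarrow> real Matrix.mat \<Rightarrow> real Matrix.mat \<Rightarrow> real" where
  "OPT P A B = (SUP w \<in> carrier_vec (dim_row A). saddle_value P A B w)"

section \<open>Saddle-SVC\<close>

text \<open>The orthogonal Walsh--Hadamard matrix, which exists only for dimensions \<open>d = 2\<^sup>m\<close>.\<close>

fun walsh_hadamard :: "nat \<Rightarrow> real Matrix.mat" where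
  "walsh_hadamard 0 = 1\<^sub>m 1"
| "walsh_hadamard (Suc m) =
     (1 / sqrt 2) \<cdot>\<^sub>m four_block_mat (walsh_hadamard m) (walsh_hadamard m)
                                 (walsh_hadamard m) (- walsh_hadamard m)"

definition random_signs :: "nat \<Rightarrow> (nat \<Rightarrow> real) pmf" where
  "random_signs d = Pi_pmf {..<d} 0 (\<lambda>_. pmf_of_set {1, -1})"

definition rotation :: "nat \<Rightarrow> (nat \<Rightarrow> real) \<Rightarrow> real Matrix.mat" where
  "rotation m s = walsh_hadamard m * mat_diag (2 ^ m) s"

definition step_tau :: "real \<Rightarrow> real \<Rightarrow> real \<Rightarrow> real" where
  "step_tau d \<gamma> q = 1 / (2 * q) * sqrt (d / \<gamma>)"

definition step_sigma :: "real \<Rightarrow> real \<Rightarrow> real \<Rightarrow> real" where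
  "step_sigma d \<gamma> q = 1 / (2 * q) * sqrt (d * \<gamma>)"

definition step_theta :: "real \<Rightarrow> real \<Rightarrow> real \<Rightarrow> real" where
  "step_theta d \<gamma> q = 1 - 1 / (d + q * sqrt d / sqrt \<gamma>)"

record iterate =
  it_w :: "real Matrix.vec"
  it_eta :: "real Matrix.vec"
  it_eta_prev :: "real Matrix.vec"
  it_xi :: "real Matrix.vec"
  it_xi_prev :: "real Matrix.vec"

definition svc_init :: "real Matrix.mat \<Rightarrow> real Matrix.mat \<Rightarrow> iterate" where
  "svc_init X Y =
     (let \<eta> = Matrix.vec (dim_col X) (\<lambda>_. 1 / real (dim_col X));
          \<xi> = Matrix.vec (dim_col Y) (\<lambda>_. 1 / real (dim_col Y))
      in \<lparr>it_w = 0\<^sub>v (dim_row X), it_eta = \<eta>, it_eta_prev = \<eta>, it_xi = \<xi>, it_xi_prev = \<xi>\<rparr>)"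

definition svc_step ::
  "saddle_problem \<Rightarrow> real Matrix.mat \<Rightarrow> real Matrix.mat \<Rightarrow> real \<Rightarrow> real \<Rightarrow> nat \<Rightarrow> iterate \<Rightarrow> iterate" where
  "svc_step P X Y \<gamma> q i st =
     (let d = real (dim_row X);
          \<tau> = step_tau d \<gamma> q; \<sigma> = step_sigma d \<gamma> q; \<theta> = step_theta d \<gamma> q;
          w = it_w st; \<eta> = it_eta st; \<xi> = it_xi st;
          \<delta>\<^sub>1 = Matrix.row X i \<bullet> (\<eta> + \<theta> \<cdot>\<^sub>v (\<eta> - it_eta_prev st));
          \<delta>\<^sub>2 = Matrix.row Y i \<bullet> (\<xi> + \<theta> \<cdot>\<^sub>v (\<xi> - it_xi_prev st));
          w' = update_vec w i ((w $ i + \<sigma> * (\<delta>\<^sub>1 - \<delta>\<^sub>2)) / (\<sigma> + 1));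
          v = w + d \<cdot>\<^sub>v (w' - w)
      in \<lparr>it_w = w',
          it_eta = arg_min_on (\<lambda>u. 1 / d * (v \<bullet> (X *\<^sub>v u)) + \<gamma> / d * entropy u
                                   + 1 / \<tau> * entropy_bregman \<eta> u) (feasible P (dim_col X)),
          it_eta_prev = \<eta>,
          it_xi = arg_min_on (\<lambda>u. - (1 / d * (v \<bullet> (Y *\<^sub>v u))) + \<gamma> / d * entropy u
                                  + 1 / \<tau> * entropy_bregman \<xi> u) (feasible P (dim_col Y)),
          it_xi_prev = \<xi>\<rparr>)"

primrec svc_run ::
  "saddle_problem \<Rightarrow> real Matrix.mat \<Rightarrow> real Matrix.mat \<Rightarrow> real \<Rightarrow> real \<Rightarrow> nat \<Rightarrow> iterate pmf" where
  "svc_run P X Y \<gamma> q 0 = return_pmf (svc_init X Y)"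
| "svc_run P X Y \<gamma> q (Suc t) =
     bind_pmf (svc_run P X Y \<gamma> q t)
       (\<lambda>st. map_pmf (\<lambda>i. svc_step P X Y \<gamma> q i st) (pmf_of_set {..<dim_row X}))"

text \<open>The loss \<open>E[g(w\<degree>) - g(w[T])]\<close> over the random choice of coordinates, for the signs \<open>s\<close> in the
  pre-processing; \<open>w[T]\<close> is rotated back to the coordinates of \<open>A\<close> and \<open>B\<close>.\<close>

definition expected_loss ::
  "saddle_problem \<Rightarrow> nat \<Rightarrow> real Matrix.mat \<Rightarrow> real Matrix.mat \<Rightarrow> real \<Rightarrow> real \<Rightarrow> real Matrix.vec \<Rightarrow>
   (nat \<Rightarrow> real) \<Rightarrow> nat \<Rightarrow> real" where
  "expected_loss P m A B \<gamma> q w\<^sub>0 s T =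
     measure_pmf.expectation (svc_run P (rotation m s * A) (rotation m s * B) \<gamma> q T)
       (\<lambda>st. saddle_value P A B w\<^sub>0 - saddle_value P A B (transpose_mat (rotation m s) *\<^sub>v it_w st))"

definition entries_bounded :: "real \<Rightarrow> real Matrix.mat \<Rightarrow> bool" where
  "entries_bounded r X \<longleftrightarrow> (\<forall>i<dim_row X. \<forall>j<dim_col X. \<bar>X $$ (i, j)\<bar> \<le> r)"

text \<open>The sum of the logarithms hidden by \<open>\<O>\<close>-tilde. A loss of \<open>\<epsilon> OPT\<close> is a relative error, so
  a linearly convergent method also pays for the logarithm of \<open>1/OPT\<close>, which is not bounded in
  terms of the other parameters.\<close>

definition log_factor :: "nat \<Rightarrow> nat \<Rightarrow> real \<Rightarrow> real \<Rightarrow> real \<Rightarrow> real" where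
  "log_factor d n \<epsilon> \<beta> opt =
     1 + ln (real d) + ln (real n) + ln (1 / \<epsilon>) + ln (1 / \<beta>) + ln (1 + 1 / opt)"

section \<open>Running time of an iteration\<close>

text \<open>
  The cost model is a real random access machine: a value of type \<open>'a timed\<close> is a result with
  the number of elementary steps spent on it. Each arithmetic operation, comparison, \<open>exp\<close>, \<open>ln\<close>,
  array access and loop pass costs one step; scalars held in local variables are free.
\<close>

type_synonym 'a timed = "'a \<times> nat"

definition val :: "'a \<Rightarrow> 'a timed" where
  "val x = (x, 0)"

definition op1 :: "('a \<Rightarrow> 'b) \<Rightarrow> 'a timed \<Rightarrow> 'b timed" where
  "op1 f a = (f (fst a), snd a + 1)"

definition op2 :: "('a \<Rightarrow> 'b \<Rightarrow> 'c) \<Rightarrow> 'a timed \<Rightarrow> 'b timed \<Rightarrow> 'c timed" where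
  "op2 f a b = (f (fst a) (fst b), snd a + snd b + 1)"

abbreviation t_add :: "real timed \<Rightarrow> real timed \<Rightarrow> real timed" (infixl "+\<^sub>t" 65) where
  "a +\<^sub>t b \<equiv> op2 (+) a b"
abbreviation t_sub :: "real timed \<Rightarrow> real timed \<Rightarrow> real timed" (infixl "-\<^sub>t" 65) where
  "a -\<^sub>t b \<equiv> op2 (-) a b"
abbreviation t_mul :: "real timed \<Rightarrow> real timed \<Rightarrow> real timed" (infixl "*\<^sub>t" 70) where
  "a *\<^sub>t b \<equiv> op2 (*) a b"
abbreviation t_div :: "real timed \<Rightarrow> real timed \<Rightarrow> real timed" (infixl "'/\<^sub>t" 70) where
  "a /\<^sub>t b \<equiv> op2 (/) a b"
abbreviation t_less :: "real timed \<Rightarrow> real timed \<Rightarrow> bool timed" (infix "<\<^sub>t" 50) where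
  "a <\<^sub>t b \<equiv> op2 (<) a b"
abbreviation t_exp :: "real timed \<Rightarrow> real timed" where
  "t_exp a \<equiv> op1 exp a"
abbreviation t_ln :: "real timed \<Rightarrow> real timed" where
  "t_ln a \<equiv> op1 ln a"
abbreviation t_neg :: "real timed \<Rightarrow> real timed" where
  "t_neg a \<equiv> op1 uminus a"

definition t_if :: "bool timed \<Rightarrow> 'a timed \<Rightarrow> 'a timed \<Rightarrow> 'a timed" where
  "t_if b x y = (if fst b then (fst x, snd b + snd x) else (fst y, snd b + snd y))"

definition read_vec :: "real Matrix.vec \<Rightarrow> nat \<Rightarrow> real timed" where
  "read_vec u j = (u $ j, 1)"

definition read_mat :: "real Matrix.mat \<Rightarrow> nat \<Rightarrow> nat \<Rightarrow> real timed" where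
  "read_mat X i j = (X $$ (i, j), 1)"

definition write_vec :: "real Matrix.vec \<Rightarrow> nat \<Rightarrow> real \<Rightarrow> real Matrix.vec timed" where
  "write_vec u j x = (update_vec u j x, 1)"

definition t_sum :: "nat \<Rightarrow> (nat \<Rightarrow> real timed) \<Rightarrow> real timed" where
  "t_sum n f = ((\<Sum>j<n. fst (f j)), (\<Sum>j<n. snd (f j) + 2) + 1)"

definition t_vec :: "nat \<Rightarrow> (nat \<Rightarrow> real timed) \<Rightarrow> real Matrix.vec timed" where
  "t_vec n f = (Matrix.vec n (\<lambda>j. fst (f j)), (\<Sum>j<n. snd (f j) + 2) + 1)"

text \<open>A computation that may fail to terminate has type \<open>'a timed option\<close>.\<close>

definition t_bind :: "'a timed option \<Rightarrow> ('a \<Rightarrow> 'b timed option) \<Rightarrow> 'b timed option"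
    (infixr "\<then>" 54) where
  "m \<then> f = (case m of None \<Rightarrow> None | Some (x, k) \<Rightarrow> map_option (\<lambda>(y, k'). (y, k + k')) (f x))"

definition cap_excess :: "real \<Rightarrow> real Matrix.vec \<Rightarrow> real timed" where
  "cap_excess \<nu> u =
     t_sum (dim_vec u) (\<lambda>j. t_if (val \<nu> <\<^sub>t read_vec u j) (read_vec u j -\<^sub>t val \<nu>) (val 0))"

definition cap_free_mass :: "real \<Rightarrow> real Matrix.vec \<Rightarrow> real timed" where
  "cap_free_mass \<nu> u =
     t_sum (dim_vec u) (\<lambda>j. t_if (read_vec u j <\<^sub>t val \<nu>) (read_vec u j) (val 0))"

definition cap_rescale :: "real \<Rightarrow> real \<Rightarrow> real \<Rightarrow> real Matrix.vec \<Rightarrow> real Matrix.vec timed" where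
  "cap_rescale \<nu> \<zeta> \<Omega> u =
     t_vec (dim_vec u) (\<lambda>j. t_if (read_vec u j <\<^sub>t val \<nu>)
       (read_vec u j *\<^sub>t (val 1 +\<^sub>t val \<zeta> /\<^sub>t val \<Omega>)) (val \<nu>))"

text \<open>The loop state holds the vector, its current excess \<open>\<zeta>\<close> over the cap, and the steps so far.\<close>

definition cap_loop :: "real \<Rightarrow> real Matrix.vec \<Rightarrow> real Matrix.vec timed option" where
  "cap_loop \<nu> u =
     map_option (\<lambda>(u', \<zeta>, k). (u', k))
       (while_option (\<lambda>(u', \<zeta>, k). \<zeta> \<noteq> 0)
          (\<lambda>(u', \<zeta>, k).
             let (\<Omega>, k\<^sub>1) = cap_free_mass \<nu> u';
                 (u'', k\<^sub>2) = cap_rescale \<nu> \<zeta> \<Omega> u';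
                 (\<zeta>', k\<^sub>3) = cap_excess \<nu> u''
             in (u'', \<zeta>', k + k\<^sub>1 + k\<^sub>2 + k\<^sub>3 + 1))
          (u, fst (cap_excess \<nu> u), snd (cap_excess \<nu> u) + 1))"

fun cap_impl :: "saddle_problem \<Rightarrow> real Matrix.vec \<Rightarrow> real Matrix.vec timed option" where
  "cap_impl HM_Saddle u = Some (val u)"
| "cap_impl (Nu_Saddle \<nu>) u = cap_loop \<nu> u"

text \<open>The argmin step from \<open>u\<close>, where \<open>\<kappa> = d/\<tau>\<close> and \<open>g\<close> computes the entries of the linear term.\<close>

definition argmin_impl ::
  "saddle_problem \<Rightarrow> real \<Rightarrow> real \<Rightarrow> (nat \<Rightarrow> real timed) \<Rightarrow> real Matrix.vec \<Rightarrow> real Matrix.vec timed option" where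
  "argmin_impl P \<gamma> \<kappa> g u =
     (let n = dim_vec u in
      Some (t_vec n (\<lambda>j. t_exp ((val \<kappa> *\<^sub>t t_ln (read_vec u j) -\<^sub>t g j) /\<^sub>t (val \<gamma> +\<^sub>t val \<kappa>)))) \<then> (\<lambda>a.
      Some (t_sum n (\<lambda>j. read_vec a j)) \<then> (\<lambda>z.
      Some (t_vec n (\<lambda>j. read_vec a j /\<^sub>t val z)) \<then> cap_impl P)))"

text \<open>
  The inner products \<open>\<langle>w[t], X\<^sub>\<cdot>\<^sub>j\<rangle>\<close> are kept in memory and updated incrementally: since \<open>w\<close> changes
  in one coordinate by \<open>\<Delta>\<close>, one has \<open>\<langle>v, X\<^sub>\<cdot>\<^sub>j\<rangle> = \<langle>w[t], X\<^sub>\<cdot>\<^sub>j\<rangle> + d \<Delta> X\<^sub>i\<^sub>j\<close>.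
\<close>

definition with_products ::
  "real Matrix.mat \<Rightarrow> real Matrix.mat \<Rightarrow> iterate \<Rightarrow> iterate \<times> real Matrix.vec \<times> real Matrix.vec" where
  "with_products X Y st = (st, transpose_mat X *\<^sub>v it_w st, transpose_mat Y *\<^sub>v it_w st)"

fun svc_step_impl ::
  "saddle_problem \<Rightarrow> real Matrix.mat \<Rightarrow> real Matrix.mat \<Rightarrow> real \<Rightarrow> real \<Rightarrow> nat \<Rightarrow>
   iterate \<times> real Matrix.vec \<times> real Matrix.vec \<Rightarrow>
   (iterate \<times> real Matrix.vec \<times> real Matrix.vec) timed option" where
  "svc_step_impl P X Y \<gamma> q i (st, p, r) =
     (let d = real (dim_row X); n\<^sub>1 = dim_col X; n\<^sub>2 = dim_col Y;
          \<kappa> = d / step_tau d \<gamma> q; \<sigma> = step_sigma d \<gamma> q; \<theta> = step_theta d \<gamma> q;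
          w = it_w st; \<eta> = it_eta st; \<eta>\<^sub>0 = it_eta_prev st; \<xi> = it_xi st; \<xi>\<^sub>0 = it_xi_prev st
      in
      Some (t_sum n\<^sub>1 (\<lambda>j. read_mat X i j *\<^sub>t
        (read_vec \<eta> j +\<^sub>t val \<theta> *\<^sub>t (read_vec \<eta> j -\<^sub>t read_vec \<eta>\<^sub>0 j)))) \<then> (\<lambda>\<delta>\<^sub>1.
      Some (t_sum n\<^sub>2 (\<lambda>j. read_mat Y i j *\<^sub>t
        (read_vec \<xi> j +\<^sub>t val \<theta> *\<^sub>t (read_vec \<xi> j -\<^sub>t read_vec \<xi>\<^sub>0 j)))) \<then> (\<lambda>\<delta>\<^sub>2.
      Some ((read_vec w i +\<^sub>t val \<sigma> *\<^sub>t (val \<delta>\<^sub>1 -\<^sub>t val \<delta>\<^sub>2)) /\<^sub>t (val \<sigma> +\<^sub>t val 1)) \<then> (\<lambda>x.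
      Some (val x -\<^sub>t read_vec w i) \<then> (\<lambda>\<Delta>.
      Some (write_vec w i x) \<then> (\<lambda>w'.
      argmin_impl P \<gamma> \<kappa>
        (\<lambda>j. read_vec p j +\<^sub>t val d *\<^sub>t val \<Delta> *\<^sub>t read_mat X i j) \<eta> \<then> (\<lambda>\<eta>'.
      argmin_impl P \<gamma> \<kappa>
        (\<lambda>j. t_neg (read_vec r j +\<^sub>t val d *\<^sub>t val \<Delta> *\<^sub>t read_mat Y i j)) \<xi> \<then> (\<lambda>\<xi>'.
      Some (t_vec n\<^sub>1 (\<lambda>j. read_vec p j +\<^sub>t val \<Delta> *\<^sub>t read_mat X i j)) \<then> (\<lambda>p'.
      Some (t_vec n\<^sub>2 (\<lambda>j. read_vec r j +\<^sub>t val \<Delta> *\<^sub>t read_mat Y i j)) \<then> (\<lambda>r'.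
      Some (val (\<lparr>it_w = w', it_eta = \<eta>', it_eta_prev = \<eta>, it_xi = \<xi>', it_xi_prev = \<xi>\<rparr>,
                 p', r'))))))))))))"

text \<open>Every iteration, from every state reached by some choice of coordinates, is carried out by
  the implementation in at most \<open>K\<close> steps, counting one step for drawing the coordinate \<open>i\<close>.\<close>

definition iterations_within ::
  "nat \<Rightarrow> saddle_problem \<Rightarrow> real Matrix.mat \<Rightarrow> real Matrix.mat \<Rightarrow> real \<Rightarrow> real \<Rightarrow> real \<Rightarrow> bool" where
  "iterations_within d P X Y \<gamma> q K \<longleftrightarrow>
     (\<forall>is i. set is \<subseteq> {..<d} \<longrightarrow> i < d \<longrightarrow>
        (let st = fold (svc_step P X Y \<gamma> q) is (svc_init X Y)
         in \<exists>k. svc_step_impl P X Y \<gamma> q i (with_products X Y st)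
                  = Some (with_products X Y (svc_step P X Y \<gamma> q i st), k) \<and> real (k + 1) \<le> K))"

end

theory Submission
  imports Defs
begin

text \<open>
  Write \<open>x = (\<eta>, \<xi>)\<close>, \<open>K = (X, -Y)\<close>, \<open>D\<close> for the Bregman divergence of the entropy and
  \<open>(w\<^sup>*, x\<^sup>*)\<close> for the optimal solution; then \<open>w\<^sup>* = K x\<^sup>*\<close>, because the inner minimum is
  strongly convex and hence differentiable in \<open>w\<close>. The argmin steps are exact entropic proximal
  steps, so they satisfy a three-point inequality, and \<open>\<parallel>u - v\<parallel>\<^sub>1\<^sup>2 \<le> 4 D(v, u)\<close> on the simplex.
  When the rotated entries are at most \<open>R = O(q / \<surd>d)\<close>, the potential
  \<open>(1/(2\<sigma>) + 1) \<parallel>w - w\<^sup>*\<parallel>\<^sup>2 + (1/\<tau> + \<gamma>/d) D(x, x\<^sup>*) + 15/(16\<tau>) D(x\<^sup>-, x) + \<langle>w - w\<^sup>*, K (x - x\<^sup>-)\<rangle> / d\<close>,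
  with \<open>x\<^sup>-\<close> the previous point, contracts in expectation by \<open>\<rho> = 1 - 1/(2G)\<close> where
  \<open>G = d + q \<surd>(d/\<gamma>)\<close>, and it dominates \<open>\<parallel>w - w\<^sup>*\<parallel>\<^sup>2 / 2\<close>. The loss is at most
  \<open>\<kappa> + O(1/\<kappa>) \<parallel>w - w\<^sup>*\<parallel>\<^sup>2\<close> for every small \<open>\<kappa> > 0\<close>, up to factors \<open>ln n\<close>, so that
  \<open>G\<close> times a logarithm many iterations suffice. If \<open>OPT = 0\<close>, the start \<open>w = 0\<close> is already optimal.
  The entries are bounded by Hoeffding's inequality for the random signs. In the capping loop the
  set of coordinates at or above \<open>\<nu>\<close> grows strictly and never exceeds \<open>1/\<nu>\<close> elements, which
  gives \<open>O(n)\<close> time per iteration.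
\<close>

section \<open>Entropic divergences and the potential\<close>

text \<open>The random coordinate is the obstacle. An iteration sees one entry of
  \<open>K x\<close>, so the bilinear terms of the two players do not cancel within it; they cancel
  on average, because \<open>v = w[t] + d (w[t+1] - w[t])\<close> gives the change of the drawn
  coordinate the weight \<open>d\<close>. What remains is the error of extrapolating
  \<open>x\<close> instead of using the next point. By Young's inequality it costs the squared
  change of \<open>w\<close> and a sixteenth of each of two consecutive divergences. Hence the
  potential keeps only 15/16 of the divergence from the previous point, and the step sizes must
  satisfy \<open>\<sigma> * (8 * R\<^sup>2) * \<tau> \<le> 1 / 16\<close>. The exponent
  \<open>c\<close> of the failure probability fixes \<open>ce\<close>, the constant of the entry
  bound, and \<open>cq = 8 * ce\<close> then meets this condition. The argmin is not obtained by
  compactness: the implementation constructs a point with the optimality conditions, and these make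
  it the unique minimiser. The saddle point may lie on the boundary of the domain, where the entropy
  has no finite gradient; its properties are therefore derived by comparison with midpoints.\<close>

lemma hellinger_le:
  fixes x y :: real
  assumes "0 \<le> x" "0 \<le> y" "y = 0 \<longrightarrow> x = 0"
  shows "(sqrt x - sqrt y)\<^sup>2 \<le> x * ln x - x * ln y - x + y"
proof (cases "x = 0")
  case True
  then show ?thesis using assms by simp
next
  case False
  then have x: "x > 0" and y: "y > 0" using assms by auto
  define a where "a = sqrt x"
  define b where "b = sqrt y"
  have a: "a > 0" and b: "b > 0" and xa: "x = a\<^sup>2" and yb: "y = b\<^sup>2"
    using x y by (auto simp: a_def b_def)
  \<comment> \<open>The tangent bound is applied to the ratio of the square roots, because
    multiplying it by \<open>2 * a\<^sup>2\<close> leaves exactly the square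
    \<open>(a - b)\<^sup>2\<close>.\<close>
  have "ln (b / a) \<le> b / a - 1"
    using a b by (intro ln_le_minus_one) auto
  then have "ln b - ln a \<le> b / a - 1"
    using a b by (simp add: ln_div)
  then have "2 * a\<^sup>2 * (ln b - ln a) \<le> 2 * a\<^sup>2 * (b / a - 1)"
    by (intro mult_left_mono) auto
  also have "\<dots> = 2 * a * b - 2 * a\<^sup>2"
    using a by (simp add: field_simps power2_eq_square)
  finally have "(a - b)\<^sup>2 \<le> a\<^sup>2 * (2 * ln a) - a\<^sup>2 * (2 * ln b) - a\<^sup>2 + b\<^sup>2"
    by (simp add: algebra_simps power2_eq_square)
  moreover have "ln x = 2 * ln a" "ln y = 2 * ln b"
    using a b by (simp_all add: xa yb ln_realpow)
  ultimately show ?thesis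
    by (simp add: xa yb a b less_imp_le)
qed

lemma entropy_bregman_eq:
  assumes "dim_vec x = m" "dim_vec y = m"
  shows "entropy_bregman x y
    = (\<Sum>i<m. y $ i * ln (y $ i) - y $ i * ln (x $ i) - y $ i + x $ i)"
  using assms
  by (simp add: entropy_bregman_def entropy_def sum_subtractf[symmetric] algebra_simps)

definition l1_dist :: "real Matrix.vec \<Rightarrow> real Matrix.vec \<Rightarrow> real" where
  "l1_dist u v = (\<Sum>i<dim_vec u. \<bar>u $ i - v $ i\<bar>)"

lemma l1_dist_nonneg: "0 \<le> l1_dist u v"
  by (simp add: l1_dist_def sum_nonneg)

lemma prob_simplexD:
  assumes "u \<in> prob_simplex m"
  shows "u \<in> carrier_vec m" "dim_vec u = m" "\<And>i. i < m \<Longrightarrow> 0 \<le> u $ i" "(\<Sum>i<m. u $ i) = 1"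
  using assms by (auto simp: prob_simplex_def)

text \<open>Pinsker's inequality with 4 in place of the optimal 2. A difference of entries factors
  into the difference and the sum of their roots; by Cauchy-Schwarz the first gives the Hellinger
  distance, the second a square sum of at most 2 + 2. Assumption \<open>z\<close> is absolute
  continuity: the convention \<open>ln 0 = 0\<close> would otherwise hide an infinite
  divergence.\<close>

lemma l1_dist_le_entropy_bregman:
  assumes u: "u \<in> prob_simplex m" and v: "v \<in> prob_simplex m"
    and z: "\<And>i. i < m \<Longrightarrow> v $ i = 0 \<Longrightarrow> u $ i = 0"
  shows "(l1_dist u v)\<^sup>2 \<le> 4 * entropy_bregman v u"
proof -
  note U = prob_simplexD[OF u] and V = prob_simplexD[OF v]
  have "l1_dist u v = (\<Sum>i<m. \<bar>sqrt (u $ i) - sqrt (v $ i)\<bar> * (sqrt (u $ i) + sqrt (v $ i)))"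
    unfolding l1_dist_def U(2)
  proof (intro sum.cong refl)
    fix i assume "i \<in> {..<m}"
    then have "0 \<le> u $ i" "0 \<le> v $ i" using U V by auto
    moreover have "u $ i - v $ i = (sqrt (u $ i) - sqrt (v $ i)) * (sqrt (u $ i) + sqrt (v $ i))"
      using calculation by (simp add: algebra_simps)
    ultimately show "\<bar>u $ i - v $ i\<bar> = \<bar>sqrt (u $ i) - sqrt (v $ i)\<bar> * (sqrt (u $ i) + sqrt (v $ i))"
      by (simp add: abs_mult)
  qed
  then have "(l1_dist u v)\<^sup>2 \<le> (\<Sum>i<m. \<bar>sqrt (u $ i) - sqrt (v $ i)\<bar>\<^sup>2)
      * (\<Sum>i<m. (sqrt (u $ i) + sqrt (v $ i))\<^sup>2)"
    using Cauchy_Schwarz_ineq_sum by metis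
  also have "\<dots> \<le> entropy_bregman v u * 4"
  proof (intro mult_mono)
    show "(\<Sum>i<m. \<bar>sqrt (u $ i) - sqrt (v $ i)\<bar>\<^sup>2) \<le> entropy_bregman v u"
      unfolding entropy_bregman_eq[OF V(2) U(2)]
      using U V z by (intro sum_mono) (auto intro!: hellinger_le)
    then show "0 \<le> entropy_bregman v u"
      using sum_nonneg[of "{..<m}" "\<lambda>i. \<bar>sqrt (u $ i) - sqrt (v $ i)\<bar>\<^sup>2"] by force
    have "(\<Sum>i<m. (sqrt (u $ i) + sqrt (v $ i))\<^sup>2) \<le> (\<Sum>i<m. 2 * (u $ i) + 2 * (v $ i))"
    proof (intro sum_mono)
      fix i assume "i \<in> {..<m}"
      then have "0 \<le> u $ i" "0 \<le> v $ i" using U V by auto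
      moreover have "0 \<le> (sqrt (u $ i) - sqrt (v $ i))\<^sup>2" by simp
      ultimately show "(sqrt (u $ i) + sqrt (v $ i))\<^sup>2 \<le> 2 * (u $ i) + 2 * (v $ i)"
        by (simp add: power2_eq_square algebra_simps)
    qed
    also have "\<dots> = 4"
      using U V by (simp add: sum.distrib sum_distrib_left[symmetric])
    finally show "(\<Sum>i<m. (sqrt (u $ i) + sqrt (v $ i))\<^sup>2) \<le> 4" .
  qed (simp add: sum_nonneg)
  finally show ?thesis by simp
qed

lemma entropy_bregman_nonneg:
  assumes u: "u \<in> prob_simplex m" and v: "v \<in> prob_simplex m"
    and z: "\<And>i. i < m \<Longrightarrow> v $ i = 0 \<Longrightarrow> u $ i = 0"
  shows "0 \<le> entropy_bregman v u"
proof -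
  have "0 \<le> (l1_dist u v)\<^sup>2" by simp
  also note l1_dist_le_entropy_bregman[OF u v z]
  finally show ?thesis by simp
qed

text \<open>Young's inequality with weight \<open>s\<close>, shaped for its uses:
  \<open>b\<^sup>2\<close> is known only through a bound \<open>B\<close>, and \<open>s * B\<close>
  only through a bound \<open>Q\<close>.\<close>

lemma mult_le_weighted_squares:
  fixes a b s B Q :: real
  assumes "s > 0" "b\<^sup>2 \<le> B"  "s * B \<le> Q"
  shows "a * b \<le> a\<^sup>2 / (4 * s) + Q"
proof -
  have "0 \<le> (a - 2 * s * b)\<^sup>2 / (4 * s)" using assms by simp
  also have "\<dots> = a\<^sup>2 / (4 * s) - a * b + s * b\<^sup>2"
    using assms by (simp add: field_simps power2_eq_square)
  finally have "a * b \<le> a\<^sup>2 / (4 * s) + s * b\<^sup>2" by simp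
  moreover have "s * b\<^sup>2 \<le> s * B" using assms by simp
  ultimately show ?thesis using assms by linarith
qed

text \<open>One iteration in expectation, in terms of \<open>y = w\<close> and \<open>k j = \<langle>K\<^sub>j, x\<rangle>\<close>, where \<open>x = (\<eta>, \<xi>)\<close> and
  \<open>K = (X, -Y)\<close>: \<open>kp\<close>, \<open>kn i\<close> and \<open>ys\<close> belong to the previous point, the next point when
  coordinate \<open>i\<close> is drawn and the saddle point, \<open>yn i\<close> is the updated coordinate.
  The divergences are \<open>Dc = V\<^sub>x(x\<^sup>*)\<close>, \<open>Dp\<close> from the previous to the current point, \<open>Dn i\<close> from the
  current to the next, and \<open>Ds i\<close> from the next to the saddle point.\<close>

lemma expected_potential_step:
  fixes d :: nat and y ys k kp yn :: "nat \<Rightarrow> real" and kn :: "nat \<Rightarrow> nat \<Rightarrow> real"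
    and \<tau> \<sigma> \<theta> \<rho> l Dc Dp B :: real and Dn Ds :: "nat \<Rightarrow> real"
  assumes d: "1 \<le> d" and pos: "\<tau> > 0" "\<sigma> > 0" "0 \<le> \<theta>" "\<theta> \<le> \<rho>" "l > 0"
    and \<theta>: "1 / (2 * \<sigma>) + 1 - 1 / d \<le> \<theta> * (1 / (2 * \<sigma>) + 1)"
    and \<rho>: "1 / \<tau> \<le> \<rho> * (1 / \<tau> + l)"
    and \<theta>1: "\<theta> \<le> 1"
    and yn: "\<And>i. i < d \<Longrightarrow> yn i = (y i + \<sigma> * (k i + \<theta> * (k i - kp i))) / (\<sigma> + 1)"
    and three: "\<And>i. i < d \<Longrightarrow> (1 / \<tau> + l) * Ds i + 1 / \<tau> * Dn i
        + 1 / d * (\<Sum>j<d. (y j + (if j = i then d * (yn i - y i) else 0) - ys j) * (kn i j - ys j))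
        \<le> 1 / \<tau> * Dc"
    and kp: "\<And>j. j < d \<Longrightarrow> (k j - kp j)\<^sup>2 \<le> B * Dp"
    and kn: "\<And>i j. i < d \<Longrightarrow> j < d \<Longrightarrow> (kn i j - k j)\<^sup>2 \<le> B * Dn i"
    and B: "0 < B" "\<sigma> * B * \<tau> \<le> 1 / 16"
    and Dc: "0 \<le> Dc" and Dp: "0 \<le> Dp" and Dn: "\<And>i. i < d \<Longrightarrow> 0 \<le> Dn i"
  defines "\<Phi> \<equiv> (1 / (2 * \<sigma>) + 1) * (\<Sum>j<d. (y j - ys j)\<^sup>2) + (1 / \<tau> + l) * Dc
      + 15 / (16 * \<tau>) * Dp + 1 / d * (\<Sum>j<d. (y j - ys j) * (k j - kp j))"
    and "\<Phi>n \<equiv> \<lambda>i. (1 / (2 * \<sigma>) + 1) * (\<Sum>j<d. ((if j = i then yn i else y j) - ys j)\<^sup>2)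
      + (1 / \<tau> + l) * Ds i + 15 / (16 * \<tau>) * Dn i
      + 1 / d * (\<Sum>j<d. ((if j = i then yn i else y j) - ys j) * (kn i j - k j))"
  shows "(\<Sum>i<d. \<Phi>n i) / d \<le> \<rho> * \<Phi>"
    and "(\<Sum>j<d. (y j - ys j)\<^sup>2) / 2 \<le> \<Phi>"
proof -
  define a where "a = (\<lambda>j. y j - ys j)"
  define S where "S = (\<Sum>j<d. (a j)\<^sup>2)"
  define c where "c = 1 / d * (\<Sum>j<d. a j * (k j - kp j))"
  define s where "s = 1 / (2 * \<sigma>)"
  define r where "r = 1 / \<tau>"
  have d0: "real d > 0" using d by simp
  have S0: "0 \<le> S" by (simp add: S_def sum_nonneg)
  have s0: "s > 0" "r > 0" using pos by (auto simp: s_def r_def)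
  have \<Phi>: "\<Phi> = (s + 1) * S + (r + l) * Dc + 15/16 * (r * Dp) + c"
    using d0 pos unfolding \<Phi>_def s_def r_def S_def a_def c_def by simp
  \<comment> \<open>The step size condition enters here. Young's inequality with weight
    \<open>\<sigma>\<close> then pairs \<open>s / 2\<close>, which is
    \<open>1 / (4 * \<sigma>)\<close>, with a sixteenth of a divergence.\<close>
  have B16: "\<sigma> * (B * x) \<le> r / 16 * x" if "0 \<le> x" for x
  proof -
    have "\<sigma> * B \<le> r / 16" using B pos by (simp add: r_def field_simps)
    then have "\<sigma> * B * x \<le> r / 16 * x" using that by (intro mult_right_mono)
    then show ?thesis by (simp add: mult.assoc)
  qed
  have young: "a' * b' \<le> s / 2 * a'\<^sup>2 + r / 16 * x" if "b'\<^sup>2 \<le> B * x" "0 \<le> x" for a' b' x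
    using mult_le_weighted_squares[OF pos(2) that(1) B16[OF that(2)], of a'] pos by (simp add: s_def)
  \<comment> \<open>The coordinatewise estimate produces \<open>d\<close> copies of the divergence,
    and the factor \<open>1 / d\<close> of the cross term turns them back into one. The cross term
    has no definite sign, but this is all it can take away.\<close>
  have c_low: "- (s / 2 * S + r / 16 * Dp) \<le> c"
  proof -
    have "(\<Sum>j<d. - (s / 2 * (a j)\<^sup>2 + r / 16 * Dp)) \<le> (\<Sum>j<d. a j * (k j - kp j))"
    proof (intro sum_mono)
      fix j assume "j \<in> {..<d}"
      then have "(- a j) * (k j - kp j) \<le> s / 2 * (- a j)\<^sup>2 + r / 16 * Dp"
        using kp Dp by (intro young) auto
      then show "- (s / 2 * (a j)\<^sup>2 + r / 16 * Dp) \<le> a j * (k j - kp j)" by simp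
    qed
    then have "- (s / 2 * S) - d * (r / 16 * Dp) \<le> d * c"
      using d0 by (simp add: sum_negf sum_subtractf S_def sum_distrib_left c_def sum_divide_distrib)
    moreover have "s / 2 * S \<le> d * (s / 2 * S)"
      using d S0 s0 mult_right_mono[of 1 "real d" "s / 2 * S"] by simp
    ultimately have "d * (- (s / 2 * S) - r / 16 * Dp) \<le> d * c"
      by (simp add: algebra_simps)
    then show ?thesis using d0 by (simp add: mult_le_cancel_left)
  qed
  have rD: "0 \<le> r * Dp" "0 \<le> (r + l) * Dc" using s0 Dp Dc pos by auto
  show "(\<Sum>j<d. (y j - ys j)\<^sup>2) / 2 \<le> \<Phi>"
  proof -
    have "0 \<le> s * S" using s0 S0 by simp
    then have "S / 2 \<le> (s + 1) * S + (r + l) * Dc + 15/16 * (r * Dp) + c"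
      using c_low rD S0 by (simp add: algebra_simps)
    then show ?thesis by (simp add: \<Phi> S_def a_def)
  qed
  have step: "\<Phi>n i \<le> (s + 1) * S - (a i)\<^sup>2 + a i * (k i + \<theta> * (k i - kp i) - ys i) + r * Dc
      + \<theta> * r / 16 * Dp - 1 / d * (\<Sum>j<d. a j * (k j - ys j))" if i: "i < d" for i
  proof -
    define e where "e = yn i - y i"
    define kb where "kb = k i + \<theta> * (k i - kp i)"
    have upd: "(\<Sum>j<d. f (if j = i then yn i else y j) j) = (\<Sum>j<d. f (y j) j) - f (y i) i + f (yn i) i"
      for f :: "real \<Rightarrow> nat \<Rightarrow> real"
    proof -
      have "(\<Sum>j<d. f (if j = i then yn i else y j) j)
          = (\<Sum>j<d. f (y j) j + (if j = i then f (yn i) i - f (y i) i else 0))"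
        by (intro sum.cong) auto
      then show ?thesis using i by (simp add: sum.distrib)
    qed
    have \<Phi>ni: "\<Phi>n i = (s + 1) * (S - (a i)\<^sup>2 + (a i + e)\<^sup>2) + (r + l) * Ds i + 15/16 * r * Dn i
        + 1 / d * (\<Sum>j<d. a j * (kn i j - k j)) + 1 / d * e * (kn i i - k i)"
      unfolding \<Phi>n_def s_def r_def S_def a_def e_def
        upd[of "\<lambda>x j. (x - ys j)\<^sup>2"] upd[of "\<lambda>x j. (x - ys j) * (kn i j - k j)"]
      using d0 pos by (simp add: field_simps)
    \<comment> \<open>The overshoot has weight \<open>d\<close> in the drawn coordinate, which
      cancels the factor \<open>1 / d\<close>; so the last summand carries the whole change
      \<open>e\<close>.\<close>
    have t: "(r + l) * Ds i + r * Dn i + 1 / d * (\<Sum>j<d. a j * (kn i j - ys j)) + e * (kn i i - ys i)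
        \<le> r * Dc"
    proof -
      have "(\<Sum>j<d. (y j + (if j = i then d * (yn i - y i) else 0) - ys j) * (kn i j - ys j))
          = (\<Sum>j<d. a j * (kn i j - ys j) + (if j = i then d * e * (kn i i - ys i) else 0))"
        by (intro sum.cong) (auto simp: a_def e_def algebra_simps)
      also have "\<dots> = (\<Sum>j<d. a j * (kn i j - ys j)) + d * e * (kn i i - ys i)"
        using i by (simp add: sum.distrib)
      finally show ?thesis
        using three[OF i] d0 unfolding r_def by (simp add: field_simps)
    qed
    have eq: "(\<Sum>j<d. a j * (kn i j - k j)) = (\<Sum>j<d. a j * (kn i j - ys j)) - (\<Sum>j<d. a j * (k j - ys j))"
      by (simp add: sum_subtractf[symmetric] algebra_simps)
    have e1: "e = \<sigma> * (kb - (y i + e))"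
      using yn[OF i] pos unfolding e_def kb_def by (simp add: field_simps)
    have yi: "y i + e = ys i + (a i + e)" by (simp add: a_def)
    \<comment> \<open>The three-point identity of the update of \<open>w\<close>: \<open>e1\<close>
      is its stationarity condition, multiplied here by the new error \<open>a i + e\<close>. It is
      an equality because the \<open>w\<close> part is quadratic.\<close>
    have idt: "(s + 1) * (a i + e)\<^sup>2 + s * e\<^sup>2 = s * (a i)\<^sup>2 + (kb - ys i) * (a i + e)"
    proof -
      have "2 * s * e = kb - (ys i + (a i + e))"
        using e1 pos unfolding yi s_def by (simp add: field_simps)
      then have "2 * s * e * (a i + e) = (kb - (ys i + (a i + e))) * (a i + e)" by simp
      then show ?thesis by (simp add: algebra_simps power2_eq_square)
    qed
    \<comment> \<open>The term \<open>s * e\<^sup>2\<close> of \<open>idt\<close> is spent in two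
      halves: here on the extrapolation error, and in \<open>y2\<close> on the move to the next
      point. The sixteenth of \<open>Dn i\<close> used in \<open>y2\<close> is the gap between its
      coefficient in \<open>t\<close> and the 15/16 kept in the potential.\<close>
    have y1: "e * (k i - kp i) \<le> s / 2 * e\<^sup>2 + r / 16 * Dp"
      using kp[OF i] Dp by (intro young)
    have y1': "\<theta> * (e * (k i - kp i)) \<le> s / 2 * e\<^sup>2 + \<theta> * (r / 16 * Dp)"
    proof -
      have "\<theta> * (e * (k i - kp i)) \<le> \<theta> * (s / 2 * e\<^sup>2 + r / 16 * Dp)"
        using y1 pos by (intro mult_left_mono)
      also have "\<dots> \<le> 1 * (s / 2 * e\<^sup>2) + \<theta> * (r / 16 * Dp)"
        unfolding distrib_left using \<theta>1 s0 rD by (intro add_mono mult_right_mono) auto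
      finally show ?thesis by simp
    qed
    have y2: "(- e) * (kn i i - k i) \<le> s / 2 * (- e)\<^sup>2 + r / 16 * Dn i"
      using kn[OF i i] Dn[OF i] by (intro young)
    have y2': "(1 - 1 / d) * ((- e) * (kn i i - k i)) \<le> s / 2 * e\<^sup>2 + r / 16 * Dn i"
    proof -
      have "(1 - 1 / d) * ((- e) * (kn i i - k i)) \<le> (1 - 1 / d) * (s / 2 * (- e)\<^sup>2 + r / 16 * Dn i)"
        using y2 d by (intro mult_left_mono) auto
      also have "\<dots> \<le> 1 * (s / 2 * (- e)\<^sup>2 + r / 16 * Dn i)"
        using s0 Dn[OF i] d by (intro mult_right_mono) auto
      finally show ?thesis by simp
    qed
    have "\<Phi>n i \<le> (s + 1) * S - (s + 1) * (a i)\<^sup>2 + ((s + 1) * (a i + e)\<^sup>2)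
        + r * Dc - r / 16 * Dn i - 1 / d * (\<Sum>j<d. a j * (k j - ys j))
        - e * (kn i i - ys i) + 1 / d * e * (kn i i - k i)"
      using t unfolding \<Phi>ni eq by (simp add: algebra_simps)
    also have "(s + 1) * (a i + e)\<^sup>2 = s * (a i)\<^sup>2 + (kb - ys i) * (a i + e) - s * e\<^sup>2"
      using idt by simp
    finally have "\<Phi>n i \<le> (s + 1) * S - (a i)\<^sup>2 + (kb - ys i) * a i + r * Dc - r / 16 * Dn i
        - 1 / d * (\<Sum>j<d. a j * (k j - ys j)) - s * e\<^sup>2
        + \<theta> * (e * (k i - kp i)) + (1 - 1 / d) * ((- e) * (kn i i - k i))"
      by (simp add: kb_def algebra_simps)
    then show ?thesis
      using y1' y2' by (simp add: kb_def algebra_simps)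
  qed
  \<comment> \<open>Averaging pays off here: over all draws the terms
    \<open>a i * (k i - ys i)\<close> add up to the sum that each draw subtracts with factor
    \<open>1 / d\<close>.\<close>
  have "(\<Sum>i<d. \<Phi>n i) \<le> (\<Sum>i<d. (s + 1) * S - (a i)\<^sup>2 + a i * (k i + \<theta> * (k i - kp i) - ys i) + r * Dc
      + \<theta> * r / 16 * Dp - 1 / d * (\<Sum>j<d. a j * (k j - ys j)))"
    using step by (intro sum_mono) auto
  also have "\<dots> = d * ((s + 1) * S) - S + (\<Sum>i<d. a i * (k i - ys i)) + \<theta> * (\<Sum>i<d. a i * (k i - kp i))
      + d * (r * Dc) + d * (\<theta> * r / 16 * Dp) - (\<Sum>j<d. a j * (k j - ys j))"
  proof -
    have "(\<Sum>i<d. a i * (k i + \<theta> * (k i - kp i) - ys i))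
       = (\<Sum>i<d. a i * (k i - ys i)) + \<theta> * (\<Sum>i<d. a i * (k i - kp i))"
      by (simp add: sum_distrib_left sum.distrib[symmetric] algebra_simps)
    then show ?thesis
      using d0 by (simp add: sum_subtractf sum.distrib S_def)
  qed
  finally have sum_le: "(\<Sum>i<d. \<Phi>n i) \<le> d * ((s + 1) * S) - S + (\<Sum>i<d. a i * (k i - ys i))
      + \<theta> * (\<Sum>i<d. a i * (k i - kp i)) + d * (r * Dc) + d * (\<theta> * r / 16 * Dp) - (\<Sum>j<d. a j * (k j - ys j))" .
  have le: "(\<Sum>i<d. \<Phi>n i) / d \<le> (s + 1 - 1 / d) * S + \<theta> * c + r * Dc + \<theta> * r / 16 * Dp"
  proof -
    have "(\<Sum>i<d. a i * (k i - kp i)) = d * c" using d0 by (simp add: c_def)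
    with sum_le have "(\<Sum>i<d. \<Phi>n i) \<le> ((s + 1 - 1 / d) * S + \<theta> * c + r * Dc + \<theta> * r / 16 * Dp) * d"
      using d0 by (simp add: algebra_simps)
    then show ?thesis using d0 by (simp add: pos_divide_le_eq)
  qed
  have "(s + 1 - 1 / d) * S \<le> \<theta> * (s + 1) * S"
    using \<theta> S0 by (intro mult_right_mono) (auto simp: s_def)
  moreover have "r * Dc \<le> \<rho> * (r + l) * Dc"
    using \<rho> Dc by (intro mult_right_mono) (auto simp: r_def)
  \<comment> \<open>The squares and the cross term contract by \<open>\<theta>\<close>, the term in
    \<open>Dc\<close> only by \<open>\<rho>\<close>. As the cross term may be negative,
    \<open>\<theta>\<close> can be raised to \<open>\<rho>\<close> only after adding enough of
    \<open>S\<close> and \<open>Dp\<close> to make the sum nonnegative.\<close>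
  moreover have "0 \<le> (\<rho> - \<theta>) * ((s + 1) * S + r * Dp / 16 + c)"
  proof (intro mult_nonneg_nonneg)
    have "0 \<le> s * S" using s0 S0 by simp
    then show "0 \<le> (s + 1) * S + r * Dp / 16 + c"
      using c_low S0 by (simp add: algebra_simps)
  qed (use pos in auto)
  moreover have "(\<rho> - \<theta>) * ((s + 1) * S + r * Dp / 16 + c) = \<rho> * (s + 1) * S - \<theta> * (s + 1) * S
      + \<rho> * (r * Dp) / 16 - \<theta> * (r * Dp) / 16 + \<rho> * c - \<theta> * c"
    by (simp add: algebra_simps diff_divide_distrib)
  moreover have "0 \<le> \<rho> * (r * Dp)"
    using pos rD by simp
  moreover have "\<rho> * \<Phi> = \<rho> * (s + 1) * S + \<rho> * (r + l) * Dc + 15/16 * (\<rho> * (r * Dp)) + \<rho> * c"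
    by (simp add: \<Phi> algebra_simps)
  moreover have "\<theta> * r / 16 * Dp = \<theta> * (r * Dp) / 16" by simp
  ultimately show "(\<Sum>i<d. \<Phi>n i) / d \<le> \<rho> * \<Phi>"
    using le by linarith
qed

section \<open>The argmin step and its implementation\<close>

lemma feasible_prob_simplex: "u \<in> feasible P m \<Longrightarrow> u \<in> prob_simplex m"
  by (cases P) (auto simp: capped_simplex_def)

lemma feasible_le_cap: "u \<in> feasible (Nu_Saddle \<nu>) m \<Longrightarrow> j < m \<Longrightarrow> u $ j \<le> \<nu>"
  by (auto simp: capped_simplex_def)

text \<open>The optimality conditions of the argmin step: \<open>u\<close> is proportional to \<open>g\<close> except where the
  cap is active, and there the proportional value would be too large.\<close>

definition capped_proportional ::
  "saddle_problem \<Rightarrow> nat \<Rightarrow> (nat \<Rightarrow> real) \<Rightarrow> real Matrix.vec \<Rightarrow> bool" where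
  "capped_proportional P m g u \<longleftrightarrow> u \<in> feasible P m \<and> (\<forall>j<m. 0 < u $ j) \<and>
     (\<exists>c>0. \<forall>j<m. u $ j = c * g j \<or> (\<exists>\<nu>. P = Nu_Saddle \<nu> \<and> u $ j = \<nu> \<and> \<nu> \<le> c * g j))"

text \<open>The objective is linear plus \<open>a + b\<close> times the entropy, so after
  subtracting the divergence from \<open>u\<close> the gap is linear in \<open>v - u\<close>. Its
  coefficients are \<open>a + b\<close> times \<open>ln (u $ j) - ln (c * g j)\<close>; the factor
  \<open>c\<close> may be inserted because \<open>u\<close> and \<open>v\<close> have equal sums.
  They vanish off the cap, and at the cap both they and \<open>v $ j - u $ j\<close> are at most
  0.\<close>

lemma entropic_three_point:
  fixes a b :: real and l :: "nat \<Rightarrow> real" and x :: "real Matrix.vec"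
  assumes x: "x \<in> prob_simplex m" and ab: "0 < a + b"
    and u: "capped_proportional P m (\<lambda>j. exp ((b * ln (x $ j) - l j) / (a + b))) u"
    and v: "v \<in> feasible P m"
  shows "(\<Sum>j<m. l j * u $ j) + a * entropy u + b * entropy_bregman x u
      + (a + b) * entropy_bregman u v
    \<le> (\<Sum>j<m. l j * v $ j) + a * entropy v + b * entropy_bregman x v"
proof -
  define g where "g = (\<lambda>j. exp ((b * ln (x $ j) - l j) / (a + b)))"
  obtain c where c: "c > 0"
    and form: "\<And>j. j < m \<Longrightarrow> u $ j = c * g j \<or> (\<exists>\<nu>. P = Nu_Saddle \<nu> \<and> u $ j = \<nu> \<and> \<nu> \<le> c * g j)"
    using u unfolding capped_proportional_def g_def by blast
  have uf: "u \<in> feasible P m" and up: "\<And>j. j < m \<Longrightarrow> 0 < u $ j"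
    using u unfolding capped_proportional_def by auto
  note U = prob_simplexD[OF feasible_prob_simplex[OF uf]]
    and V = prob_simplexD[OF feasible_prob_simplex[OF v]] and X = prob_simplexD[OF x]
  have "(\<Sum>j<m. l j * v $ j) + a * entropy v + b * entropy_bregman x v
      - ((\<Sum>j<m. l j * u $ j) + a * entropy u + b * entropy_bregman x u
      + (a + b) * entropy_bregman u v)
    = (\<Sum>j<m. (l j - b * ln (x $ j) + (a + b) * ln (u $ j)) * (v $ j - u $ j)
        + a * v $ j - a * u $ j)"
    unfolding entropy_bregman_eq[OF X(2) V(2)] entropy_bregman_eq[OF X(2) U(2)]
      entropy_bregman_eq[OF U(2) V(2)] entropy_def U(2) V(2)
    by (simp add: sum_distrib_left sum.distrib[symmetric] sum_subtractf[symmetric] algebra_simps)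
  also have "\<dots> = (\<Sum>j<m. (l j - b * ln (x $ j) + (a + b) * ln (u $ j)) * (v $ j - u $ j))"
    using U(4) V(4) by (simp add: sum.distrib sum_subtractf sum_distrib_left[symmetric])
  also have "\<dots> = (\<Sum>j<m. (a + b) * (ln (u $ j) - ln (g j)) * (v $ j - u $ j))"
  proof (intro sum.cong refl)
    fix j
    have "(a + b) * ln (g j) = b * ln (x $ j) - l j"
      using ab by (simp add: g_def)
    then have lj: "l j = b * ln (x $ j) - (a + b) * ln (g j)" by simp
    show "(l j - b * ln (x $ j) + (a + b) * ln (u $ j)) * (v $ j - u $ j)
        = (a + b) * (ln (u $ j) - ln (g j)) * (v $ j - u $ j)"
      unfolding lj by (simp add: algebra_simps)
  qed
  also have "\<dots> = (\<Sum>j<m. (a + b) * (ln (u $ j) - ln (c * g j)) * (v $ j - u $ j))"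
  proof -
    have "(\<Sum>j<m. (a + b) * (ln (u $ j) - ln (c * g j)) * (v $ j - u $ j))
      = (\<Sum>j<m. (a + b) * (ln (u $ j) - ln (g j)) * (v $ j - u $ j) - (a + b) * ln c * (v $ j - u $ j))"
      using c by (intro sum.cong refl) (auto simp: ln_mult g_def algebra_simps)
    moreover have "(\<Sum>j<m. (a + b) * ln c * (v $ j - u $ j)) = 0"
      using U(4) V(4) by (simp add: sum_distrib_left[symmetric] sum_subtractf)
    ultimately show ?thesis by (simp add: sum_subtractf)
  qed
  also have "\<dots> \<ge> 0"
  proof (intro sum_nonneg)
    fix j assume "j \<in> {..<m}"
    then have j: "j < m" by simp
    consider "u $ j = c * g j" | \<nu> where "P = Nu_Saddle \<nu>" "u $ j = \<nu>" "\<nu> \<le> c * g j"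
      using form[OF j] by blast
    then show "0 \<le> (a + b) * (ln (u $ j) - ln (c * g j)) * (v $ j - u $ j)"
    proof cases
      case 2
      have "v $ j \<le> \<nu>" using v j feasible_le_cap 2 by simp
      moreover have "ln (u $ j) \<le> ln (c * g j)" using up[OF j] 2 by simp
      ultimately show ?thesis using ab 2
        by (intro mult_nonpos_nonpos mult_nonneg_nonpos) auto
    qed simp
  qed
  finally show ?thesis by simp
qed

lemma entropy_bregman_pos:
  assumes u: "u \<in> prob_simplex m" and v: "v \<in> prob_simplex m" and "\<And>i. i < m \<Longrightarrow> 0 < v $ i"
    and ne: "u \<noteq> v"
  shows "0 < entropy_bregman v u"
proof -
  note U = prob_simplexD[OF u] and V = prob_simplexD[OF v]
  obtain i where i: "i < m" "u $ i \<noteq> v $ i"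
    using ne U(2) V(2) by (metis eq_vecI)
  have "0 < \<bar>u $ i - v $ i\<bar>" using i by simp
  also have "\<dots> \<le> l1_dist u v"
    unfolding l1_dist_def U(2) using i by (intro member_le_sum) auto
  finally have "0 < (l1_dist u v)\<^sup>2" by simp
  also have "\<dots> \<le> 4 * entropy_bregman v u"
    using assms by (intro l1_dist_le_entropy_bregman[OF u v]) force
  finally show ?thesis by simp
qed

text \<open>\<open>arg_min_on\<close> is a Hilbert choice, so its value can be identified only for a
  strict minimiser; positivity of the divergence will supply strictness.\<close>

lemma arg_min_on_eqI:
  fixes f :: "'a \<Rightarrow> 'b :: linorder"
  assumes "x \<in> S" "\<And>y. y \<in> S \<Longrightarrow> y \<noteq> x \<Longrightarrow> f x < f y"
  shows "arg_min_on f S = x"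
  unfolding arg_min_on_def arg_min_def is_arg_min_def
  using assms by (intro some_equality) (auto dest: less_asym)

lemma arg_min_on_entropic:
  fixes a b :: real and l :: "nat \<Rightarrow> real" and x :: "real Matrix.vec"
  assumes x: "x \<in> prob_simplex m" and ab: "0 < a + b"
    and u: "capped_proportional P m (\<lambda>j. exp ((b * ln (x $ j) - l j) / (a + b))) u"
    and f: "\<And>v. v \<in> feasible P m \<Longrightarrow>
      f v = (\<Sum>j<m. l j * v $ j) + a * entropy v + b * entropy_bregman x v"
  shows "arg_min_on f (feasible P m) = u"
proof (rule arg_min_on_eqI)
  show uf: "u \<in> feasible P m" using u by (simp add: capped_proportional_def)
  fix v assume v: "v \<in> feasible P m" "v \<noteq> u"
  have "0 < entropy_bregman u v"
    using u v uf by (intro entropy_bregman_pos[of v m]) (auto simp: capped_proportional_def feasible_prob_simplex)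
  then have "0 < (a + b) * entropy_bregman u v" using ab by simp
  then show "f u < f v"
    using entropic_three_point[OF x ab u v(1)] v(1) by (simp add: f[OF uf] f)
qed

text \<open>The invariant of the capping loop: the conditions of \<open>capped_proportional\<close>
  for the weights \<open>a\<close>, except that proportional entries may still exceed
  \<open>\<nu>\<close>.\<close>

definition cap_inv :: "real \<Rightarrow> nat \<Rightarrow> (nat \<Rightarrow> real) \<Rightarrow> real Matrix.vec \<Rightarrow> bool" where
  "cap_inv \<nu> n a u \<longleftrightarrow> dim_vec u = n \<and> (\<Sum>j<n. u $ j) = 1 \<and> (\<forall>j<n. 0 < u $ j) \<and>
     (\<exists>c>0. \<forall>j<n. u $ j = c * a j \<or> (u $ j = \<nu> \<and> \<nu> \<le> c * a j))"

lemmas timed_defs = t_if_def op1_def op2_def val_def read_vec_def read_mat_def t_sum_def t_vec_def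

lemma fst_cap_excess:
  "fst (cap_excess \<nu> u) = (\<Sum>j<dim_vec u. if \<nu> < u $ j then u $ j - \<nu> else 0)"
  by (simp add: cap_excess_def timed_defs cong: if_cong)
     (intro sum.cong, auto)

lemma fst_cap_free_mass:
  "fst (cap_free_mass \<nu> u) = (\<Sum>j<dim_vec u. if u $ j < \<nu> then u $ j else 0)"
  by (simp add: cap_free_mass_def timed_defs) (intro sum.cong, auto)

lemma fst_cap_rescale:
  "fst (cap_rescale \<nu> \<zeta> \<Omega> u) = Matrix.vec (dim_vec u) (\<lambda>j. if u $ j < \<nu> then u $ j * (1 + \<zeta> / \<Omega>) else \<nu>)"
  by (rule eq_vecI) (auto simp: cap_rescale_def timed_defs)

lemma sum_le_const_mult:
  assumes "\<And>j. j < n \<Longrightarrow> f j \<le> (c::nat)"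
  shows "(\<Sum>j<n. f j) \<le> c * n"
  using sum_bounded_above[of "{..<n}" f c] assms by (simp add: mult.commute)

lemma snd_t_sum_le: "(\<And>j. j < n \<Longrightarrow> snd (f j) \<le> c) \<Longrightarrow> snd (t_sum n f) \<le> (c + 2) * n + 1"
  using sum_le_const_mult[of n "\<lambda>j. snd (f j) + 2" "c + 2"] by (simp add: t_sum_def)

lemma snd_t_vec_le: "(\<And>j. j < n \<Longrightarrow> snd (f j) \<le> c) \<Longrightarrow> snd (t_vec n f) \<le> (c + 2) * n + 1"
  using sum_le_const_mult[of n "\<lambda>j. snd (f j) + 2" "c + 2"] by (simp add: t_vec_def)

lemma snd_cap_excess: "snd (cap_excess \<nu> u) \<le> 6 * dim_vec u + 1"
  unfolding cap_excess_def by (rule order.trans[OF snd_t_sum_le[where c = 4]]) (auto simp: timed_defs)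

lemma snd_cap_free_mass: "snd (cap_free_mass \<nu> u) \<le> 6 * dim_vec u + 1"
  unfolding cap_free_mass_def by (rule order.trans[OF snd_t_sum_le[where c = 4]]) (auto simp: timed_defs)

lemma snd_cap_rescale: "snd (cap_rescale \<nu> \<zeta> \<Omega> u) \<le> 8 * dim_vec u + 1"
  unfolding cap_rescale_def by (rule order.trans[OF snd_t_vec_le[where c = 6]]) (auto simp: timed_defs)

definition capped_indices :: "real \<Rightarrow> real Matrix.vec \<Rightarrow> nat set" where
  "capped_indices \<nu> u = {j. j < dim_vec u \<and> \<nu> \<le> u $ j}"

lemma finite_capped_indices [simp]: "finite (capped_indices \<nu> u)"
  by (simp add: capped_indices_def)

lemma card_capped_indices_le:
  assumes "0 < \<nu>" "cap_inv \<nu> n a u"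
  shows "card (capped_indices \<nu> u) \<le> nat \<lfloor>1 / \<nu>\<rfloor>"
proof -
  have u: "dim_vec u = n" "(\<Sum>j<n. u $ j) = 1" "\<And>j. j < n \<Longrightarrow> 0 < u $ j"
    using assms by (auto simp: cap_inv_def)
  have "card (capped_indices \<nu> u) * \<nu> = (\<Sum>j\<in>capped_indices \<nu> u. \<nu>)" by simp
  also have "\<dots> \<le> (\<Sum>j\<in>capped_indices \<nu> u. u $ j)"
    by (intro sum_mono) (auto simp: capped_indices_def)
  also have "\<dots> \<le> (\<Sum>j<n. u $ j)"
    using u by (intro sum_mono2) (auto simp: capped_indices_def less_imp_le)
  finally have "real (card (capped_indices \<nu> u)) \<le> 1 / \<nu>"
    using u assms by (simp add: field_simps)
  then show ?thesis by linarith
qed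

text \<open>All entries below \<open>\<nu>\<close> are scaled by one factor, so they stay
  proportional with a larger \<open>c\<close>. The factor exceeds 1, so the proportional value at a
  capped index stays at least \<open>\<nu>\<close>. An entry above \<open>\<nu>\<close> after the
  pass was below it before; this index is new among the capped ones.\<close>

lemma cap_step:
  assumes \<nu>: "0 < \<nu>" "1 \<le> \<nu> * real n" and inv: "cap_inv \<nu> n a u" and a: "\<And>j. j < n \<Longrightarrow> 0 < a j"
    and ex: "fst (cap_excess \<nu> u) \<noteq> 0"
  defines "u' \<equiv> fst (cap_rescale \<nu> (fst (cap_excess \<nu> u)) (fst (cap_free_mass \<nu> u)) u)"
  shows "cap_inv \<nu> n a u'"
    and "fst (cap_excess \<nu> u') \<noteq> 0 \<Longrightarrow> card (capped_indices \<nu> u) < card (capped_indices \<nu> u')"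
proof -
  obtain c where u: "dim_vec u = n" "(\<Sum>j<n. u $ j) = 1" "\<And>j. j < n \<Longrightarrow> 0 < u $ j"
    and c: "c > 0" "\<And>j. j < n \<Longrightarrow> u $ j = c * a j \<or> (u $ j = \<nu> \<and> \<nu> \<le> c * a j)"
    using inv by (auto simp: cap_inv_def)
  define \<zeta> where "\<zeta> = (\<Sum>j<n. if \<nu> < u $ j then u $ j - \<nu> else 0)"
  define \<Omega> where "\<Omega> = (\<Sum>j<n. if u $ j < \<nu> then u $ j else 0)"
  define K where "K = (\<Sum>j<n. if u $ j < \<nu> then 0 else \<nu>)"
  have u': "u' = Matrix.vec n (\<lambda>j. if u $ j < \<nu> then u $ j * (1 + \<zeta> / \<Omega>) else \<nu>)"
    unfolding u'_def fst_cap_rescale fst_cap_excess fst_cap_free_mass u(1) \<zeta>_def \<Omega>_def ..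
  have "\<zeta> \<ge> 0" unfolding \<zeta>_def by (intro sum_nonneg) auto
  then have \<zeta>: "\<zeta> > 0" using ex by (simp add: fst_cap_excess u(1) \<zeta>_def)
  have total: "\<Omega> + \<zeta> + K = 1"
  proof -
    have "\<Omega> + \<zeta> + K = (\<Sum>j<n. u $ j)"
      unfolding \<Omega>_def \<zeta>_def K_def sum.distrib[symmetric] by (intro sum.cong) auto
    then show ?thesis using u by simp
  qed
  \<comment> \<open>Without free mass every entry would be at least \<open>\<nu>\<close>, and
    \<open>1 \<le> \<nu> * real n\<close> would leave no room for a positive excess.\<close>
  have \<Omega>: "\<Omega> > 0"
  proof (rule ccontr)
    assume neg: "\<not> \<Omega> > 0"
    have nn: "\<And>j. j \<in> {..<n} \<Longrightarrow> 0 \<le> (if u $ j < \<nu> then u $ j else 0)" using u(3) by (auto simp: less_imp_le)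
    then have "\<Omega> \<ge> 0" unfolding \<Omega>_def by (rule sum_nonneg)
    then have "\<Omega> = 0" using neg by simp
    then have "\<forall>j<n. (if u $ j < \<nu> then u $ j else 0) = 0"
      unfolding \<Omega>_def using nn by (subst (asm) sum_nonneg_eq_0_iff) auto
    then have "\<forall>j<n. \<not> u $ j < \<nu>" using u(3) by force
    then have "K = (\<Sum>j<n. \<nu>)" unfolding K_def by (intro sum.cong) auto
    then show False using total \<nu> \<zeta> \<open>\<Omega> \<ge> 0\<close> by (simp add: mult.commute)
  qed
  have f1: "1 + \<zeta> / \<Omega> > 1" using \<zeta> \<Omega> by simp
  show inv': "cap_inv \<nu> n a u'"
    unfolding cap_inv_def
  proof (intro conjI exI[of _ "c * (1 + \<zeta> / \<Omega>)"] allI impI)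
    show "dim_vec u' = n" by (simp add: u')
    have "(\<Sum>j<n. u' $ j) = (\<Sum>j<n. (if u $ j < \<nu> then u $ j else 0) * (1 + \<zeta> / \<Omega>)
        + (if u $ j < \<nu> then 0 else \<nu>))"
      by (intro sum.cong) (auto simp: u')
    also have "\<dots> = \<Omega> * (1 + \<zeta> / \<Omega>) + K"
      by (simp add: sum.distrib sum_distrib_right[symmetric] \<Omega>_def K_def)
    also have "\<dots> = 1" using \<Omega> total by (simp add: distrib_left)
    finally show "(\<Sum>j<n. u' $ j) = 1" .
    show "0 < c * (1 + \<zeta> / \<Omega>)" using c f1 by simp
    fix j assume j: "j < n"
    show "0 < u' $ j" using j u(3) f1 \<nu> by (simp add: u')
    show "u' $ j = c * (1 + \<zeta> / \<Omega>) * a j \<or> (u' $ j = \<nu> \<and> \<nu> \<le> c * (1 + \<zeta> / \<Omega>) * a j)"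
    proof (cases "u $ j < \<nu>")
      case True
      then show ?thesis using c(2)[OF j] j by (auto simp: u')
    next
      case False
      have "\<nu> \<le> c * a j" using c(2)[OF j] False by auto
      also have "\<dots> \<le> (c * a j) * (1 + \<zeta> / \<Omega>)"
        using c a[OF j] f1 mult_left_mono[of 1 "1 + \<zeta> / \<Omega>" "c * a j"] by simp
      finally show ?thesis using False j by (simp add: u' mult_ac)
    qed
  qed
  assume "fst (cap_excess \<nu> u') \<noteq> 0"
  then obtain j where j: "j < n" "\<nu> < u' $ j"
    unfolding fst_cap_excess by (auto simp: u' elim!: sum.not_neutral_contains_not_neutral split: if_splits)
  have "capped_indices \<nu> u \<subseteq> capped_indices \<nu> u'"
    by (auto simp: capped_indices_def u' u(1))
  moreover have "j \<in> capped_indices \<nu> u'" "j \<notin> capped_indices \<nu> u"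
    using j by (auto simp: capped_indices_def u' u(1) split: if_splits)
  ultimately show "card (capped_indices \<nu> u) < card (capped_indices \<nu> u')"
    by (intro psubset_card_mono) auto
qed

definition cap_body ::
  "real \<Rightarrow> real Matrix.vec \<times> real \<times> nat \<Rightarrow> real Matrix.vec \<times> real \<times> nat" where
  "cap_body \<nu> = (\<lambda>(u', \<zeta>, k).
     let (\<Omega>, k\<^sub>1) = cap_free_mass \<nu> u';
         (u'', k\<^sub>2) = cap_rescale \<nu> \<zeta> \<Omega> u';
         (\<zeta>', k\<^sub>3) = cap_excess \<nu> u''
     in (u'', \<zeta>', k + k\<^sub>1 + k\<^sub>2 + k\<^sub>3 + 1))"

text \<open>The step counter is only bounded from above, because its exact value depends on the
  branches taken at the entries.\<close>

lemma cap_body_eq: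
  obtains k' where "cap_body \<nu> (u, \<zeta>, k) = (fst (cap_rescale \<nu> \<zeta> (fst (cap_free_mass \<nu> u)) u),
      fst (cap_excess \<nu> (fst (cap_rescale \<nu> \<zeta> (fst (cap_free_mass \<nu> u)) u))), k')"
    "k' \<le> k + (20 * dim_vec u + 4)"
proof -
  define u' where "u' = fst (cap_rescale \<nu> \<zeta> (fst (cap_free_mass \<nu> u)) u)"
  have "dim_vec u' = dim_vec u" by (simp add: u'_def fst_cap_rescale)
  then have "snd (cap_excess \<nu> u') \<le> 6 * dim_vec u + 1" using snd_cap_excess[of \<nu> u'] by simp
  then have "k + snd (cap_free_mass \<nu> u) + snd (cap_rescale \<nu> \<zeta> (fst (cap_free_mass \<nu> u)) u)
      + snd (cap_excess \<nu> u') + 1 \<le> k + (20 * dim_vec u + 4)"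
    using snd_cap_free_mass[of \<nu> u] snd_cap_rescale[of \<nu> \<zeta> "fst (cap_free_mass \<nu> u)" u] by linarith
  then show ?thesis
    by (intro that) (auto simp: cap_body_def case_prod_beta Let_def u'_def)
qed

text \<open>Induction on the number of indices that can still become capped. The summand 1 in the
  number of passes stands for the last pass, after which the excess is zero and which need not cap a
  new index.\<close>

lemma cap_while:
  assumes \<nu>: "0 < \<nu>" "1 \<le> \<nu> * real n" and a: "\<And>j. j < n \<Longrightarrow> 0 < a j"
  shows "cap_inv \<nu> n a u \<Longrightarrow>
    \<exists>u' k'. while_option (\<lambda>(u', \<zeta>, k). \<zeta> \<noteq> 0) (cap_body \<nu>) (u, fst (cap_excess \<nu> u), k) = Some (u', 0, k')
      \<and> cap_inv \<nu> n a u' \<and> fst (cap_excess \<nu> u') = 0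
      \<and> k' \<le> k + (nat \<lfloor>1 / \<nu>\<rfloor> + 1 - card (capped_indices \<nu> u)) * (20 * n + 4)"
proof (induction "nat \<lfloor>1 / \<nu>\<rfloor> - card (capped_indices \<nu> u)" arbitrary: u k rule: less_induct)
  case less
  let ?b = "\<lambda>(u', \<zeta>, k). \<zeta> \<noteq> 0" and ?N = "20 * n + 4" and ?M = "nat \<lfloor>1 / \<nu>\<rfloor>"
  have dim: "dim_vec u = n" using less by (simp add: cap_inv_def)
  have card: "card (capped_indices \<nu> u) \<le> ?M" by (rule card_capped_indices_le[OF \<nu>(1) less(2)])
  show ?case
  proof (cases "fst (cap_excess \<nu> u) = 0")
    case True
    then show ?thesis using less(2) by (subst while_option_unfold) auto
  next
    case False
    define v where "v = fst (cap_rescale \<nu> (fst (cap_excess \<nu> u)) (fst (cap_free_mass \<nu> u)) u)"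
    obtain k1 where body: "cap_body \<nu> (u, fst (cap_excess \<nu> u), k) = (v, fst (cap_excess \<nu> v), k1)"
      and k1: "k1 \<le> k + ?N"
      using cap_body_eq[of \<nu> u "fst (cap_excess \<nu> u)" k] unfolding v_def dim by metis
    have inv: "cap_inv \<nu> n a v"
      unfolding v_def by (rule cap_step(1)[OF \<nu> less(2) a False])
    have unf: "while_option ?b (cap_body \<nu>) (u, fst (cap_excess \<nu> u), k)
        = while_option ?b (cap_body \<nu>) (v, fst (cap_excess \<nu> v), k1)"
      using False by (subst while_option_unfold) (simp add: body)
    show ?thesis
    proof (cases "fst (cap_excess \<nu> v) = 0")
      case True
      have "while_option ?b (cap_body \<nu>) (v, fst (cap_excess \<nu> v), k1) = Some (v, 0, k1)"
        using True by (subst while_option_unfold) auto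
      moreover have "k1 \<le> k + (?M + 1 - card (capped_indices \<nu> u)) * ?N"
      proof -
        have "1 * ?N \<le> (?M + 1 - card (capped_indices \<nu> u)) * ?N"
          using card by (intro mult_right_mono) auto
        then show ?thesis using k1 unfolding mult_1 by (meson add_left_mono order_trans)
      qed
      ultimately show ?thesis using unf inv True by auto
    next
      case nz: False
      have lt: "card (capped_indices \<nu> u) < card (capped_indices \<nu> v)"
        using cap_step(2)[OF \<nu> less(2) a False] nz unfolding v_def by simp
      have le: "card (capped_indices \<nu> v) \<le> ?M" by (rule card_capped_indices_le[OF \<nu>(1) inv])
      have "?M - card (capped_indices \<nu> v) < ?M - card (capped_indices \<nu> u)" using lt le by simp
      from less(1)[OF this inv, of k1] obtain u' k' where
        *: "while_option ?b (cap_body \<nu>) (v, fst (cap_excess \<nu> v), k1) = Some (u', 0, k')"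
           "cap_inv \<nu> n a u'" "fst (cap_excess \<nu> u') = 0"
           "k' \<le> k1 + (?M + 1 - card (capped_indices \<nu> v)) * ?N" by blast
      have "(1 + (?M + 1 - card (capped_indices \<nu> v))) * ?N \<le> (?M + 1 - card (capped_indices \<nu> u)) * ?N"
        using lt le by (intro mult_right_mono) auto
      then have "k' \<le> k + (?M + 1 - card (capped_indices \<nu> u)) * ?N"
        using *(4) k1 by (simp add: algebra_simps)
      then show ?thesis using * unf by auto
    qed
  qed
qed

text \<open>Steps of the capping per entry: a pass takes \<open>20 * n + 4\<close>, at most
  \<open>24 * n\<close>, and \<open>8 * n\<close> covers the first computation of the excess. For
  fixed \<open>\<nu>\<close> this is a constant.\<close>

fun cap_cost :: "saddle_problem \<Rightarrow> nat" where
  "cap_cost HM_Saddle = 0"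
| "cap_cost (Nu_Saddle \<nu>) = 24 * (nat \<lfloor>1 / \<nu>\<rfloor> + 1) + 8"

fun cap_ok :: "saddle_problem \<Rightarrow> nat \<Rightarrow> bool" where
  "cap_ok HM_Saddle n \<longleftrightarrow> True"
| "cap_ok (Nu_Saddle \<nu>) n \<longleftrightarrow> 0 < \<nu> \<and> 1 \<le> \<nu> * real n"

lemma cap_impl_correct:
  assumes ok: "cap_ok P n" and n: "1 \<le> n" and u: "u \<in> prob_simplex n" "\<And>j. j < n \<Longrightarrow> 0 < u $ j"
  shows "\<exists>v k. cap_impl P u = Some (v, k) \<and> capped_proportional P n (\<lambda>j. u $ j) v \<and> k \<le> cap_cost P * n"
proof (cases P)
  case HM_Saddle
  then show ?thesis
    using u by (auto simp: val_def capped_proportional_def intro!: exI[of _ "1::real"])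
next
  case (Nu_Saddle \<nu>)
  note U = prob_simplexD[OF u(1)]
  have \<nu>: "0 < \<nu>" "1 \<le> \<nu> * real n" using ok Nu_Saddle by auto
  have "cap_inv \<nu> n (\<lambda>j. u $ j) u"
    using U u(2) by (auto simp: cap_inv_def intro!: exI[of _ "1::real"])
  from cap_while[of \<nu> n "\<lambda>j. u $ j", OF \<nu> u(2) this, of "snd (cap_excess \<nu> u) + 1"]
  obtain v k where w: "while_option (\<lambda>(u', \<zeta>, k). \<zeta> \<noteq> 0) (cap_body \<nu>)
        (u, fst (cap_excess \<nu> u), snd (cap_excess \<nu> u) + 1) = Some (v, 0, k)"
    and v: "cap_inv \<nu> n (\<lambda>j. u $ j) v" "fst (cap_excess \<nu> v) = 0"
    and k: "k \<le> snd (cap_excess \<nu> u) + 1 + (nat \<lfloor>1 / \<nu>\<rfloor> + 1 - card (capped_indices \<nu> u)) * (20 * n + 4)"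
    by blast
  have "cap_impl P u = Some (v, k)"
    using w by (simp add: Nu_Saddle cap_loop_def cap_body_def)
  moreover have "capped_proportional P n (\<lambda>j. u $ j) v"
  proof -
    have V: "dim_vec v = n" "(\<Sum>j<n. v $ j) = 1" "\<forall>j<n. 0 < v $ j" using v(1) by (auto simp: cap_inv_def)
    have "\<forall>j<n. (if \<nu> < v $ j then v $ j - \<nu> else 0) = 0"
      using v(2) unfolding fst_cap_excess V(1) by (subst (asm) sum_nonneg_eq_0_iff) auto
    then have "\<forall>j<n. v $ j \<le> \<nu>" by (metis eq_iff_diff_eq_0 not_less_iff_gr_or_eq linorder_not_less)
    then show ?thesis
      using V v(1) unfolding capped_proportional_def cap_inv_def Nu_Saddle
      by (auto simp: capped_simplex_def prob_simplex_def less_imp_le)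
  qed
  moreover have "k \<le> cap_cost P * n"
  proof -
    have "(nat \<lfloor>1 / \<nu>\<rfloor> + 1 - card (capped_indices \<nu> u)) * (20 * n + 4) \<le> (nat \<lfloor>1 / \<nu>\<rfloor> + 1) * (24 * n)"
      using n by (intro mult_mono) auto
    moreover have "snd (cap_excess \<nu> u) + 1 \<le> 8 * n"
      using snd_cap_excess[of \<nu> u] n U(2) by simp
    ultimately show ?thesis using k by (simp add: Nu_Saddle algebra_simps)
  qed
  ultimately show ?thesis by blast
qed

text \<open>The constant \<open>c\<close> in the optimality conditions absorbs any positive factor,
  so normalising before the capping is harmless. With \<open>r = 1\<close> the lemma exchanges
  weights that agree on the indices below \<open>m\<close>.\<close>

lemma capped_proportional_rescale:
  assumes "capped_proportional P m g u" "\<And>j. j < m \<Longrightarrow> g j = r * h j" "r > 0"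
  shows "capped_proportional P m h u"
proof -
  obtain c where "c > 0"
    and "\<And>j. j < m \<Longrightarrow> u $ j = c * g j \<or> (\<exists>\<nu>. P = Nu_Saddle \<nu> \<and> u $ j = \<nu> \<and> \<nu> \<le> c * g j)"
    using assms(1) unfolding capped_proportional_def by blast
  then show ?thesis
    using assms unfolding capped_proportional_def
    by (intro conjI exI[of _ "c * r"]) (auto simp: mult.assoc)
qed

lemma t_bind_Some: "(Some a \<then> f) = map_option (\<lambda>(y, k'). (y, snd a + k')) (f (fst a))"
  by (cases a) (simp add: t_bind_def)

text \<open>Formulated with the optimality conditions instead of \<open>arg_min_on\<close>, so that
  it also proves that a point satisfying them exists.\<close>

lemma argmin_impl_correct:
  assumes ok: "cap_ok P n" and n: "1 \<le> n" and u: "dim_vec u = n"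
    and g: "\<And>j. j < n \<Longrightarrow> snd (g j) \<le> c"
  shows "\<exists>v k. argmin_impl P \<gamma> \<kappa> g u = Some (v, k)
    \<and> capped_proportional P n (\<lambda>j. exp ((\<kappa> * ln (u $ j) - fst (g j)) / (\<gamma> + \<kappa>))) v
    \<and> k \<le> (c + 20 + cap_cost P) * n"
proof -
  define h where "h = (\<lambda>j. exp ((\<kappa> * ln (u $ j) - fst (g j)) / (\<gamma> + \<kappa>)))"
  define t1 where "t1 = t_vec n (\<lambda>j. t_exp ((val \<kappa> *\<^sub>t t_ln (read_vec u j) -\<^sub>t g j) /\<^sub>t (val \<gamma> +\<^sub>t val \<kappa>)))"
  have t1: "fst t1 = Matrix.vec n h" by (simp add: t1_def timed_defs h_def)
  have st1: "snd t1 \<le> (c + 7 + 2) * n + 1"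
    unfolding t1_def by (rule snd_t_vec_le) (use g in \<open>auto simp: timed_defs\<close>)
  define t2 where "t2 = t_sum n (\<lambda>j. read_vec (fst t1) j)"
  define z where "z = (\<Sum>j<n. h j)"
  have t2: "fst t2 = z" by (simp add: t2_def timed_defs t1 z_def)
  have st2: "snd t2 \<le> (1 + 2) * n + 1"
    unfolding t2_def by (rule snd_t_sum_le) (auto simp: timed_defs)
  define t3 where "t3 = t_vec n (\<lambda>j. read_vec (fst t1) j /\<^sub>t val (fst t2))"
  have t3: "fst t3 = Matrix.vec n (\<lambda>j. h j / z)"
    by (rule eq_vecI) (auto simp: t3_def timed_defs t1 t2)
  have st3: "snd t3 \<le> (2 + 2) * n + 1"
    unfolding t3_def by (rule snd_t_vec_le) (auto simp: timed_defs)
  have z: "z > 0" unfolding z_def using n by (intro sum_pos) (auto simp: h_def lessThan_empty_iff)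
  have "(\<Sum>j<n. h j / z) = 1" using z by (simp add: sum_divide_distrib[symmetric] z_def[symmetric])
  then have "fst t3 \<in> prob_simplex n"
    using z by (auto simp: prob_simplex_def t3 h_def intro!: divide_nonneg_pos)
  moreover have "0 < fst t3 $ j" if "j < n" for j using that z by (simp add: t3 h_def)
  ultimately obtain v k where v: "cap_impl P (fst t3) = Some (v, k)"
      "capped_proportional P n (\<lambda>j. fst t3 $ j) v" "k \<le> cap_cost P * n"
    using cap_impl_correct[OF ok n] by blast
  have "argmin_impl P \<gamma> \<kappa> g u = Some (v, snd t1 + (snd t2 + (snd t3 + k)))"
    unfolding argmin_impl_def Let_def u t1_def[symmetric] t_bind_Some
    unfolding t2_def[symmetric] t_bind_Some
    unfolding t3_def[symmetric] v(1) by simp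
  moreover have "capped_proportional P n h v"
    using z by (intro capped_proportional_rescale[OF v(2), of "1 / z"]) (auto simp: t3)
  moreover have "snd t1 + (snd t2 + (snd t3 + k)) \<le> (c + 20 + cap_cost P) * n"
  proof -
    have "snd t1 + (snd t2 + (snd t3 + k)) \<le> (c + 16 + cap_cost P) * n + 3 * 1"
      using st1 st2 st3 v(3) by (simp add: algebra_simps)
    also have "\<dots> \<le> (c + 16 + cap_cost P) * n + 3 * n" using n by simp
    also have "\<dots> \<le> (c + 20 + cap_cost P) * n" by (simp add: algebra_simps)
    finally show ?thesis .
  qed
  ultimately show ?thesis unfolding h_def by blast
qed

section \<open>Convergence in expectation\<close>

text \<open>The entropy has a finite gradient at these points. Divergences are based at iterates,
  which are all positive; the saddle point, known only to be feasible, occurs only as the second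
  argument.\<close>

definition positive_feasible :: "saddle_problem \<Rightarrow> nat \<Rightarrow> real Matrix.vec \<Rightarrow> bool" where
  "positive_feasible P m u \<longleftrightarrow> u \<in> feasible P m \<and> (\<forall>j<m. 0 < u $ j)"

lemma positive_feasibleD:
  assumes "positive_feasible P m u"
  shows "u \<in> feasible P m" "u \<in> prob_simplex m" "u \<in> carrier_vec m" "dim_vec u = m"
    "\<And>j. j < m \<Longrightarrow> 0 < u $ j" "(\<Sum>j<m. u $ j) = 1"
  using assms feasible_prob_simplex[of u P m] prob_simplexD[of u m]
  by (auto simp: positive_feasible_def)

lemma capped_proportional_positive_feasible:
  "capped_proportional P m g u \<Longrightarrow> positive_feasible P m u"
  by (auto simp: capped_proportional_def positive_feasible_def)

definition iterate_inv ::
  "saddle_problem \<Rightarrow> nat \<Rightarrow> nat \<Rightarrow> nat \<Rightarrow> iterate \<Rightarrow> bool" where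
  "iterate_inv P d n\<^sub>1 n\<^sub>2 st \<longleftrightarrow> it_w st \<in> carrier_vec d \<and>
     positive_feasible P n\<^sub>1 (it_eta st) \<and> positive_feasible P n\<^sub>1 (it_eta_prev st) \<and>
     positive_feasible P n\<^sub>2 (it_xi st) \<and> positive_feasible P n\<^sub>2 (it_xi_prev st)"

section \<open>The exact iteration and its implementation\<close>

definition next_coord ::
  "real Matrix.mat \<Rightarrow> real Matrix.mat \<Rightarrow> real \<Rightarrow> real \<Rightarrow> nat \<Rightarrow> iterate \<Rightarrow> real" where
  "next_coord X Y \<gamma> q i st =
     (it_w st $ i + step_sigma (real (dim_row X)) \<gamma> q *
       (Matrix.row X i \<bullet> (it_eta st + step_theta (real (dim_row X)) \<gamma> q \<cdot>\<^sub>v (it_eta st - it_eta_prev st))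
        - Matrix.row Y i \<bullet> (it_xi st + step_theta (real (dim_row X)) \<gamma> q \<cdot>\<^sub>v (it_xi st - it_xi_prev st))))
     / (step_sigma (real (dim_row X)) \<gamma> q + 1)"

definition overshoot ::
  "real Matrix.mat \<Rightarrow> real Matrix.mat \<Rightarrow> real \<Rightarrow> real \<Rightarrow> nat \<Rightarrow> iterate \<Rightarrow> real Matrix.vec" where
  "overshoot X Y \<gamma> q i st = it_w st
     + real (dim_row X) \<cdot>\<^sub>v (update_vec (it_w st) i (next_coord X Y \<gamma> q i st) - it_w st)"

lemma svc_step_sel:
  "it_w (svc_step P X Y \<gamma> q i st) = update_vec (it_w st) i (next_coord X Y \<gamma> q i st)"
  "it_eta_prev (svc_step P X Y \<gamma> q i st) = it_eta st"
  "it_xi_prev (svc_step P X Y \<gamma> q i st) = it_xi st"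
  "it_eta (svc_step P X Y \<gamma> q i st) = arg_min_on (\<lambda>u. 1 / real (dim_row X) * (overshoot X Y \<gamma> q i st \<bullet> (X *\<^sub>v u))
      + \<gamma> / real (dim_row X) * entropy u
      + 1 / step_tau (real (dim_row X)) \<gamma> q * entropy_bregman (it_eta st) u) (feasible P (dim_col X))"
  "it_xi (svc_step P X Y \<gamma> q i st) = arg_min_on (\<lambda>u. - (1 / real (dim_row X) * (overshoot X Y \<gamma> q i st \<bullet> (Y *\<^sub>v u)))
      + \<gamma> / real (dim_row X) * entropy u
      + 1 / step_tau (real (dim_row X)) \<gamma> q * entropy_bregman (it_xi st) u) (feasible P (dim_col Y))"
  by (simp_all add: svc_step_def Let_def next_coord_def overshoot_def)

lemma scalar_prod_mult_mat_vec_sum: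
  fixes M :: "real Matrix.mat"
  assumes "M \<in> carrier_mat d m" "v \<in> carrier_vec d" "u \<in> carrier_vec m"
  shows "v \<bullet> (M *\<^sub>v u) = (\<Sum>j<m. (transpose_mat M *\<^sub>v v) $ j * u $ j)"
  using transpose_vec_mult_scalar[OF assms(1,3,2)] assms
  by (simp add: scalar_prod_def atLeast0LessThan)

text \<open>Serves both players, with \<open>r = 1\<close> for \<open>\<eta>\<close> and
  \<open>r = -1\<close> for \<open>\<xi>\<close>. Cancelling \<open>d\<close> in the exponent turns
  the weights \<open>\<gamma>\<close> and \<open>d / \<tau>\<close> of the implementation into the
  weights \<open>\<gamma> / d\<close> and \<open>1 / \<tau>\<close> of the objective.\<close>

lemma argmin_step:
  fixes M :: "real Matrix.mat" and d \<gamma> \<tau> r :: real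
  assumes M: "M \<in> carrier_mat d' m" and v: "v \<in> carrier_vec d'" and x: "x \<in> prob_simplex m"
    and pos: "0 < d" "0 < \<gamma>" "0 < \<tau>"
    and u: "capped_proportional P m
      (\<lambda>j. exp ((d / \<tau> * ln (x $ j) - r * (transpose_mat M *\<^sub>v v) $ j) / (\<gamma> + d / \<tau>))) u"
    and f: "f = (\<lambda>u. r * (1 / d * (v \<bullet> (M *\<^sub>v u))) + \<gamma> / d * entropy u + 1 / \<tau> * entropy_bregman x u)"
  shows "arg_min_on f (feasible P m) = u"
    and "w \<in> feasible P m \<Longrightarrow> f u + (\<gamma> / d + 1 / \<tau>) * entropy_bregman u w \<le> f w"
proof -
  define l where "l = (\<lambda>j. r / d * (transpose_mat M *\<^sub>v v) $ j)"
  have e: "(\<lambda>j. exp ((d / \<tau> * ln (x $ j) - r * (transpose_mat M *\<^sub>v v) $ j) / (\<gamma> + d / \<tau>)))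
      = (\<lambda>j. exp ((1 / \<tau> * ln (x $ j) - l j) / (\<gamma> / d + 1 / \<tau>)))"
  proof
    fix j
    have "(d / \<tau> * ln (x $ j) - r * (transpose_mat M *\<^sub>v v) $ j) / (\<gamma> + d / \<tau>)
       = (d * (1 / \<tau> * ln (x $ j) - l j)) / (d * (\<gamma> / d + 1 / \<tau>))"
      using pos by (simp add: l_def algebra_simps)
    then show "exp ((d / \<tau> * ln (x $ j) - r * (transpose_mat M *\<^sub>v v) $ j) / (\<gamma> + d / \<tau>))
        = exp ((1 / \<tau> * ln (x $ j) - l j) / (\<gamma> / d + 1 / \<tau>))"
      using pos by simp
  qed
  have ab: "0 < \<gamma> / d + 1 / \<tau>" using pos by (simp add: add_pos_pos)
  have f': "f w = (\<Sum>j<m. l j * w $ j) + \<gamma> / d * entropy w + 1 / \<tau> * entropy_bregman x w"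
    if "w \<in> feasible P m" for w
    using scalar_prod_mult_mat_vec_sum[OF M v prob_simplexD(1)[OF feasible_prob_simplex[OF that]]]
    by (simp add: f l_def sum_distrib_left sum_divide_distrib mult.assoc)
  show "arg_min_on f (feasible P m) = u"
    by (rule arg_min_on_entropic[OF x ab u[unfolded e]]) (rule f')
  have uf: "u \<in> feasible P m" using u by (simp add: capped_proportional_def)
  show "f u + (\<gamma> / d + 1 / \<tau>) * entropy_bregman u w \<le> f w" if "w \<in> feasible P m"
    using entropic_three_point[OF x ab u[unfolded e] that] by (simp add: f'[OF uf] f'[OF that])
qed

text \<open>No bound on the entries is assumed. The locale is interpreted for the original matrices,
  to reason about \<open>OPT\<close>, and for the rotated ones, on which the algorithm runs.\<close>

locale saddle_svc =
  fixes P :: saddle_problem and X Y :: "real Matrix.mat" and d n\<^sub>1 n\<^sub>2 :: nat and \<gamma> q :: real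
  assumes X: "X \<in> carrier_mat d n\<^sub>1" and Y: "Y \<in> carrier_mat d n\<^sub>2"
    and d: "1 \<le> d" and n: "1 \<le> n\<^sub>1" "1 \<le> n\<^sub>2" and cap: "cap_ok P n\<^sub>1" "cap_ok P n\<^sub>2"
    and \<gamma>: "0 < \<gamma>" and q: "0 < q"
begin

abbreviation "\<tau> \<equiv> step_tau (real d) \<gamma> q"
abbreviation "\<sigma> \<equiv> step_sigma (real d) \<gamma> q"
abbreviation "\<theta> \<equiv> step_theta (real d) \<gamma> q"

lemma dims: "dim_row X = d" "dim_col X = n\<^sub>1" "dim_row Y = d" "dim_col Y = n\<^sub>2"
  using X Y by auto

lemma \<tau>_pos: "0 < \<tau>" and \<sigma>_pos: "0 < \<sigma>"
  using d \<gamma> q by (auto simp: step_tau_def step_sigma_def)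

lemma uniform_positive_feasible:
  assumes "1 \<le> m" "cap_ok P m"
  shows "positive_feasible P m (Matrix.vec m (\<lambda>_. 1 / real m))"
  using assms
  by (cases P) (auto simp: positive_feasible_def capped_simplex_def prob_simplex_def field_simps)

lemma iterate_inv_init: "iterate_inv P d n\<^sub>1 n\<^sub>2 (svc_init X Y)"
  using n cap by (simp add: iterate_inv_def svc_init_def Let_def dims uniform_positive_feasible)

lemma overshoot_carrier: "iterate_inv P d n\<^sub>1 n\<^sub>2 st \<Longrightarrow> overshoot X Y \<gamma> q i st \<in> carrier_vec d"
  by (auto simp: overshoot_def iterate_inv_def update_vec_def)

lemma step_optimality:
  fixes i :: nat
  assumes inv: "iterate_inv P d n\<^sub>1 n\<^sub>2 st"
  defines "v \<equiv> overshoot X Y \<gamma> q i st" and "st' \<equiv> svc_step P X Y \<gamma> q i st"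
  shows "positive_feasible P n\<^sub>1 (it_eta st')"
    and "w \<in> feasible P n\<^sub>1 \<Longrightarrow>
      1 / d * (v \<bullet> (X *\<^sub>v it_eta st')) + \<gamma> / d * entropy (it_eta st')
        + 1 / \<tau> * entropy_bregman (it_eta st) (it_eta st')
        + (\<gamma> / d + 1 / \<tau>) * entropy_bregman (it_eta st') w
      \<le> 1 / d * (v \<bullet> (X *\<^sub>v w)) + \<gamma> / d * entropy w + 1 / \<tau> * entropy_bregman (it_eta st) w"
    and "capped_proportional P n\<^sub>1 (\<lambda>j. exp ((d / \<tau> * ln (it_eta st $ j) - (transpose_mat X *\<^sub>v v) $ j) / (\<gamma> + d / \<tau>))) u
      \<Longrightarrow> u = it_eta st'"
    and "positive_feasible P n\<^sub>2 (it_xi st')"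
    and "w \<in> feasible P n\<^sub>2 \<Longrightarrow>
      - (1 / d * (v \<bullet> (Y *\<^sub>v it_xi st'))) + \<gamma> / d * entropy (it_xi st')
        + 1 / \<tau> * entropy_bregman (it_xi st) (it_xi st')
        + (\<gamma> / d + 1 / \<tau>) * entropy_bregman (it_xi st') w
      \<le> - (1 / d * (v \<bullet> (Y *\<^sub>v w))) + \<gamma> / d * entropy w + 1 / \<tau> * entropy_bregman (it_xi st) w"
    and "capped_proportional P n\<^sub>2 (\<lambda>j. exp ((d / \<tau> * ln (it_xi st $ j) - (- (transpose_mat Y *\<^sub>v v) $ j)) / (\<gamma> + d / \<tau>))) u
      \<Longrightarrow> u = it_xi st'"
proof -
  note I = inv[unfolded iterate_inv_def]
  have v: "v \<in> carrier_vec d" unfolding v_def by (rule overshoot_carrier[OF inv])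
  have \<eta>: "it_eta st \<in> prob_simplex n\<^sub>1" "dim_vec (it_eta st) = n\<^sub>1"
    using I positive_feasibleD by blast+
  have \<xi>: "it_xi st \<in> prob_simplex n\<^sub>2" "dim_vec (it_xi st) = n\<^sub>2"
    using I positive_feasibleD by blast+
  have d0: "0 < real d" using d by simp
  \<comment> \<open>The implementation is run on coefficients of cost 0, merely to obtain a point
    with the optimality conditions.\<close>
  obtain u1 where u1: "capped_proportional P n\<^sub>1
      (\<lambda>j. exp ((d / \<tau> * ln (it_eta st $ j) - 1 * (transpose_mat X *\<^sub>v v) $ j) / (\<gamma> + d / \<tau>))) u1"
    using argmin_impl_correct[OF cap(1) n(1) \<eta>(2), of "\<lambda>j. val ((transpose_mat X *\<^sub>v v) $ j)" 0 \<gamma> "d / \<tau>"]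
    by (auto simp: val_def)
  obtain u2 where u2: "capped_proportional P n\<^sub>2
      (\<lambda>j. exp ((d / \<tau> * ln (it_xi st $ j) - (-1) * (transpose_mat Y *\<^sub>v v) $ j) / (\<gamma> + d / \<tau>))) u2"
    using argmin_impl_correct[OF cap(2) n(2) \<xi>(2), of "\<lambda>j. val (- (transpose_mat Y *\<^sub>v v) $ j)" 0 \<gamma> "d / \<tau>"]
    by (auto simp: val_def)
  note A1 = argmin_step[OF X v \<eta>(1) d0 \<gamma> \<tau>_pos _ refl, of P 1, simplified mult_1]
    and A2 = argmin_step[OF Y v \<xi>(1) d0 \<gamma> \<tau>_pos _ refl, of P "-1", simplified mult_minus1]
  have s1: "it_eta st' = arg_min_on (\<lambda>u. 1 / d * (v \<bullet> (X *\<^sub>v u)) + \<gamma> / d * entropy u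
      + 1 / \<tau> * entropy_bregman (it_eta st) u) (feasible P n\<^sub>1)"
    and s2: "it_xi st' = arg_min_on (\<lambda>u. - (1 / d * (v \<bullet> (Y *\<^sub>v u))) + \<gamma> / d * entropy u
      + 1 / \<tau> * entropy_bregman (it_xi st) u) (feasible P n\<^sub>2)"
    unfolding st'_def v_def by (simp_all add: svc_step_sel dims)
  have e1: "it_eta st' = u1" unfolding s1 by (rule A1(1)[OF u1[unfolded mult_1]])
  have e2: "it_xi st' = u2" unfolding s2 by (rule A2(1)[OF u2[unfolded mult_minus1]])
  show "positive_feasible P n\<^sub>1 (it_eta st')" "positive_feasible P n\<^sub>2 (it_xi st')"
    unfolding e1 e2 using u1 u2 capped_proportional_positive_feasible by blast+
  show "u = it_eta st'" if "capped_proportional P n\<^sub>1 (\<lambda>j. exp ((d / \<tau> * ln (it_eta st $ j) - (transpose_mat X *\<^sub>v v) $ j) / (\<gamma> + d / \<tau>))) u"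
    unfolding s1 by (rule A1(1)[OF that, symmetric])
  show "u = it_xi st'" if "capped_proportional P n\<^sub>2 (\<lambda>j. exp ((d / \<tau> * ln (it_xi st $ j) - (- (transpose_mat Y *\<^sub>v v) $ j)) / (\<gamma> + d / \<tau>))) u"
    unfolding s2 by (rule A2(1)[OF that, symmetric])
  show "1 / d * (v \<bullet> (X *\<^sub>v it_eta st')) + \<gamma> / d * entropy (it_eta st')
        + 1 / \<tau> * entropy_bregman (it_eta st) (it_eta st')
        + (\<gamma> / d + 1 / \<tau>) * entropy_bregman (it_eta st') w
      \<le> 1 / d * (v \<bullet> (X *\<^sub>v w)) + \<gamma> / d * entropy w + 1 / \<tau> * entropy_bregman (it_eta st) w"
    if "w \<in> feasible P n\<^sub>1"
    unfolding e1 by (rule A1(2)[OF u1[unfolded mult_1] that])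
  show "- (1 / d * (v \<bullet> (Y *\<^sub>v it_xi st'))) + \<gamma> / d * entropy (it_xi st')
        + 1 / \<tau> * entropy_bregman (it_xi st) (it_xi st')
        + (\<gamma> / d + 1 / \<tau>) * entropy_bregman (it_xi st') w
      \<le> - (1 / d * (v \<bullet> (Y *\<^sub>v w))) + \<gamma> / d * entropy w + 1 / \<tau> * entropy_bregman (it_xi st) w"
    if "w \<in> feasible P n\<^sub>2"
    unfolding e2 by (rule A2(2)[OF u2[unfolded mult_minus1] that])
qed

lemma iterate_inv_step:
  assumes "iterate_inv P d n\<^sub>1 n\<^sub>2 st"
  shows "iterate_inv P d n\<^sub>1 n\<^sub>2 (svc_step P X Y \<gamma> q i st)"
  unfolding iterate_inv_def svc_step_sel(1-3)
proof (intro conjI)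
  note I = assms[unfolded iterate_inv_def]
  show "update_vec (it_w st) i (next_coord X Y \<gamma> q i st) \<in> carrier_vec d"
    using I by (metis carrier_vecD carrier_vecI dim_update_vec)
  show "positive_feasible P n\<^sub>1 (it_eta (svc_step P X Y \<gamma> q i st))"
    by (rule step_optimality(1)[OF assms])
  show "positive_feasible P n\<^sub>2 (it_xi (svc_step P X Y \<gamma> q i st))"
    by (rule step_optimality(4)[OF assms])
qed (use assms in \<open>auto simp: iterate_inv_def\<close>)

lemma iterate_inv_fold:
  "iterate_inv P d n\<^sub>1 n\<^sub>2 st \<Longrightarrow> iterate_inv P d n\<^sub>1 n\<^sub>2 (fold (svc_step P X Y \<gamma> q) is st)"
  by (induction "is" arbitrary: st) (auto intro: iterate_inv_step)

text \<open>With \<open>r = d\<close> this evaluates the products with the overshoot, with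
  \<open>r = 1\<close> those with the new \<open>w\<close>; so the stored products serve
  both.\<close>

lemma transpose_mult_update_vec:
  fixes M :: "real Matrix.mat"
  assumes M: "M \<in> carrier_mat d m" and w: "w \<in> carrier_vec d" and i: "i < d" and j: "j < m"
  shows "(transpose_mat M *\<^sub>v (w + r \<cdot>\<^sub>v (update_vec w i x - w))) $ j
    = (transpose_mat M *\<^sub>v w) $ j + r * (x - w $ i) * M $$ (i, j)"
proof -
  have wd: "dim_vec w = d" "dim_row M = d" "dim_col M = m" using w M by auto
  have "(transpose_mat M *\<^sub>v (w + r \<cdot>\<^sub>v (update_vec w i x - w))) $ j
    = (\<Sum>l<d. M $$ (l, j) * (w $ l + r * ((if l = i then x else w $ l) - w $ l)))"
    using j by (simp add: scalar_prod_def wd atLeast0LessThan update_vec_def)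
  also have "\<dots> = (\<Sum>l<d. M $$ (l, j) * w $ l + (if l = i then r * (x - w $ i) * M $$ (i, j) else 0))"
    by (intro sum.cong) (auto simp: algebra_simps)
  also have "\<dots> = (transpose_mat M *\<^sub>v w) $ j + r * (x - w $ i) * M $$ (i, j)"
    using i j by (simp add: sum.distrib scalar_prod_def wd atLeast0LessThan)
  finally show ?thesis .
qed

lemma svc_step_impl_correct:
  assumes inv: "iterate_inv P d n\<^sub>1 n\<^sub>2 st" and i: "i < d"
  shows "\<exists>k. svc_step_impl P X Y \<gamma> q i (with_products X Y st)
      = Some (with_products X Y (svc_step P X Y \<gamma> q i st), k) \<and> k \<le> (62 + cap_cost P) * (n\<^sub>1 + n\<^sub>2)"
proof -
  note I = inv[unfolded iterate_inv_def]
  have w: "it_w st \<in> carrier_vec d" using I by simp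
  have \<eta>: "dim_vec (it_eta st) = n\<^sub>1" "dim_vec (it_eta_prev st) = n\<^sub>1"
    and \<xi>: "dim_vec (it_xi st) = n\<^sub>2" "dim_vec (it_xi_prev st) = n\<^sub>2"
    using I positive_feasibleD by blast+
  define st' where "st' = svc_step P X Y \<gamma> q i st"
  define x where "x = next_coord X Y \<gamma> q i st"
  define v where "v = overshoot X Y \<gamma> q i st"
  have w': "it_w st' = update_vec (it_w st) i x"
    by (simp add: st'_def x_def svc_step_sel)
  define p r where "p = transpose_mat X *\<^sub>v it_w st" and "r = transpose_mat Y *\<^sub>v it_w st"
  have w'': "it_w st' = it_w st + 1 \<cdot>\<^sub>v (update_vec (it_w st) i x - it_w st)"
    unfolding w' using w by (intro eq_vecI) (auto simp: update_vec_def)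
  have v': "v = it_w st + real d \<cdot>\<^sub>v (update_vec (it_w st) i x - it_w st)"
    by (simp add: v_def overshoot_def x_def dims)
  define \<Delta> where "\<Delta> = x - it_w st $ i"
  define D1 where "D1 = t_sum n\<^sub>1 (\<lambda>j. read_mat X i j *\<^sub>t
        (read_vec (it_eta st) j +\<^sub>t val \<theta> *\<^sub>t (read_vec (it_eta st) j -\<^sub>t read_vec (it_eta_prev st) j)))"
  define D2 where "D2 = t_sum n\<^sub>2 (\<lambda>j. read_mat Y i j *\<^sub>t
        (read_vec (it_xi st) j +\<^sub>t val \<theta> *\<^sub>t (read_vec (it_xi st) j -\<^sub>t read_vec (it_xi_prev st) j)))"
  have D1: "fst D1 = Matrix.row X i \<bullet> (it_eta st + \<theta> \<cdot>\<^sub>v (it_eta st - it_eta_prev st))"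
    and D2: "fst D2 = Matrix.row Y i \<bullet> (it_xi st + \<theta> \<cdot>\<^sub>v (it_xi st - it_xi_prev st))"
    using i by (simp_all add: D1_def D2_def timed_defs scalar_prod_def atLeast0LessThan dims \<eta> \<xi>)
  have S1: "snd D1 \<le> (8 + 2) * n\<^sub>1 + 1" and S2: "snd D2 \<le> (8 + 2) * n\<^sub>2 + 1"
    unfolding D1_def D2_def by (rule snd_t_sum_le, simp add: timed_defs)+
  define G1 where "G1 = (\<lambda>j. read_vec p j +\<^sub>t val (real d) *\<^sub>t val \<Delta> *\<^sub>t read_mat X i j)"
  define G2 where "G2 = (\<lambda>j. t_neg (read_vec r j +\<^sub>t val (real d) *\<^sub>t val \<Delta> *\<^sub>t read_mat Y i j))"
  have fG1: "fst (G1 j) = (transpose_mat X *\<^sub>v v) $ j" if "j < n\<^sub>1" for j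
    unfolding v' transpose_mult_update_vec[OF X w i that] by (simp add: G1_def timed_defs p_def \<Delta>_def)
  have fG2: "fst (G2 j) = - (transpose_mat Y *\<^sub>v v) $ j" if "j < n\<^sub>2" for j
    unfolding v' transpose_mult_update_vec[OF Y w i that] by (simp add: G2_def timed_defs r_def \<Delta>_def)
  obtain u1 k1 where u1: "argmin_impl P \<gamma> (d / \<tau>) G1 (it_eta st) = Some (u1, k1)"
      "capped_proportional P n\<^sub>1 (\<lambda>j. exp ((d / \<tau> * ln (it_eta st $ j) - fst (G1 j)) / (\<gamma> + d / \<tau>))) u1"
      "k1 \<le> (6 + 20 + cap_cost P) * n\<^sub>1"
    using argmin_impl_correct[OF cap(1) n(1) \<eta>(1), of G1 6 \<gamma> "d / \<tau>"]
    by (auto simp: G1_def timed_defs)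
  obtain u2 k2 where u2: "argmin_impl P \<gamma> (d / \<tau>) G2 (it_xi st) = Some (u2, k2)"
      "capped_proportional P n\<^sub>2 (\<lambda>j. exp ((d / \<tau> * ln (it_xi st $ j) - fst (G2 j)) / (\<gamma> + d / \<tau>))) u2"
      "k2 \<le> (6 + 20 + cap_cost P) * n\<^sub>2"
    using argmin_impl_correct[OF cap(2) n(2) \<xi>(1), of G2 6 \<gamma> "d / \<tau>"]
    by (auto simp: G2_def timed_defs)
  have e1: "u1 = it_eta st'"
    unfolding st'_def
    by (rule step_optimality(3)[OF inv], rule capped_proportional_rescale[OF u1(2), of 1])
       (simp_all add: fG1 v_def[symmetric])
  have e2: "u2 = it_xi st'"
    unfolding st'_def
    by (rule step_optimality(6)[OF inv], rule capped_proportional_rescale[OF u2(2), of 1])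
       (simp_all add: fG2 v_def[symmetric])
  define Q1 where "Q1 = t_vec n\<^sub>1 (\<lambda>j. read_vec p j +\<^sub>t val \<Delta> *\<^sub>t read_mat X i j)"
  define Q2 where "Q2 = t_vec n\<^sub>2 (\<lambda>j. read_vec r j +\<^sub>t val \<Delta> *\<^sub>t read_mat Y i j)"
  have Q1: "fst Q1 = transpose_mat X *\<^sub>v it_w st'"
  proof (rule eq_vecI)
    fix j assume "j < dim_vec (transpose_mat X *\<^sub>v it_w st')"
    then have j: "j < n\<^sub>1" by (simp add: dims)
    show "fst Q1 $ j = (transpose_mat X *\<^sub>v it_w st') $ j"
      unfolding w'' transpose_mult_update_vec[OF X w i j] using j
      by (simp add: Q1_def timed_defs p_def \<Delta>_def)
  qed (simp add: Q1_def timed_defs dims)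
  have Q2: "fst Q2 = transpose_mat Y *\<^sub>v it_w st'"
  proof (rule eq_vecI)
    fix j assume "j < dim_vec (transpose_mat Y *\<^sub>v it_w st')"
    then have j: "j < n\<^sub>2" by (simp add: dims)
    show "fst Q2 $ j = (transpose_mat Y *\<^sub>v it_w st') $ j"
      unfolding w'' transpose_mult_update_vec[OF Y w i j] using j
      by (simp add: Q2_def timed_defs r_def \<Delta>_def)
  qed (simp add: Q2_def timed_defs dims)
  have R1: "snd Q1 \<le> (4 + 2) * n\<^sub>1 + 1" and R2: "snd Q2 \<le> (4 + 2) * n\<^sub>2 + 1"
    unfolding Q1_def Q2_def by (rule snd_t_vec_le, simp add: timed_defs)+
  define E where "E = (read_vec (it_w st) i +\<^sub>t val \<sigma> *\<^sub>t (val (fst D1) -\<^sub>t val (fst D2))) /\<^sub>t (val \<sigma> +\<^sub>t val 1)"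
  have E: "fst E = x" "snd E = 6"
    by (simp_all add: E_def x_def next_coord_def D1 D2 dims timed_defs)
  define F where "F = val x -\<^sub>t read_vec (it_w st) i"
  have F: "fst F = \<Delta>" "snd F = 2"
    by (simp_all add: F_def \<Delta>_def timed_defs)
  define k where "k = snd D1 + (snd D2 + (snd E + (snd F + (1 + (k1 + (k2 + (snd Q1 + (snd Q2 + 0))))))))"
  have st'_eq: "\<lparr>it_w = it_w st', it_eta = it_eta st', it_eta_prev = it_eta st, it_xi = it_xi st',
      it_xi_prev = it_xi st\<rparr> = st'"
    by (simp add: st'_def svc_step_sel)
  have "svc_step_impl P X Y \<gamma> q i (with_products X Y st) = Some (with_products X Y st', k)"
    unfolding with_products_def svc_step_impl.simps Let_def dims
      p_def[symmetric] r_def[symmetric] D1_def[symmetric] D2_def[symmetric]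
    unfolding t_bind_Some E_def[symmetric] E(1) F_def[symmetric] F(1) write_vec_def fst_conv snd_conv w'[symmetric]
      G1_def[symmetric] G2_def[symmetric] u1(1) u2(1)
    unfolding t_bind_Some fst_conv snd_conv Q1_def[symmetric] Q2_def[symmetric] Q1 Q2 e1 e2 st'_eq
    by (simp add: k_def val_def)
  moreover have "k \<le> (62 + cap_cost P) * (n\<^sub>1 + n\<^sub>2)"
  proof -
    \<comment> \<open>Per entry: 10 steps for the inner product, 26 and the capping for the argmin
      step, 6 for updating the stored product. The other 13 steps do not depend on the dimensions
      and are absorbed because both classes are nonempty.\<close>
    have "k \<le> (42 + cap_cost P) * n\<^sub>1 + (42 + cap_cost P) * n\<^sub>2 + 13"
      using S1 S2 R1 R2 u1(3) u2(3) unfolding k_def E F by (simp add: algebra_simps)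
    also have "\<dots> \<le> (42 + cap_cost P) * n\<^sub>1 + (42 + cap_cost P) * n\<^sub>2 + (20 * n\<^sub>1 + 20 * n\<^sub>2)"
      using n by simp
    finally show ?thesis by (simp add: algebra_simps)
  qed
  ultimately show ?thesis unfolding st'_def by blast
qed

lemma iterations_within: 
  assumes "real (63 + cap_cost P) * real (n\<^sub>1 + n\<^sub>2) \<le> K"
  shows "iterations_within d P X Y \<gamma> q K"
  unfolding iterations_within_def Let_def
proof (intro allI impI)
  fix "is" i assume i: "i < d"
  from svc_step_impl_correct[OF iterate_inv_fold[OF iterate_inv_init, of "is"] i]
  obtain k where k: "svc_step_impl P X Y \<gamma> q i (with_products X Y (fold (svc_step P X Y \<gamma> q) is (svc_init X Y)))
      = Some (with_products X Y (svc_step P X Y \<gamma> q i (fold (svc_step P X Y \<gamma> q) is (svc_init X Y))), k)"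
    "k \<le> (62 + cap_cost P) * (n\<^sub>1 + n\<^sub>2)" by blast
  have "k + 1 \<le> (63 + cap_cost P) * (n\<^sub>1 + n\<^sub>2)"
    using k(2) n by (simp add: algebra_simps)
  then have "real (k + 1) \<le> real ((63 + cap_cost P) * (n\<^sub>1 + n\<^sub>2))" by (rule of_nat_mono)
  then have "real (k + 1) \<le> K" using assms by simp
  then show "\<exists>k. svc_step_impl P X Y \<gamma> q i (with_products X Y (fold (svc_step P X Y \<gamma> q) is (svc_init X Y)))
      = Some (with_products X Y (svc_step P X Y \<gamma> q i (fold (svc_step P X Y \<gamma> q) is (svc_init X Y))), k)
      \<and> real (k + 1) \<le> K"
    using k(1) by blast
qed

end

section \<open>Contraction of the potential\<close>

context saddle_svc
begin

text \<open>Coordinate \<open>j\<close> of \<open>K x\<close>, the gradient in \<open>w\<close> of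
  the bilinear part of the payoff.\<close>

definition game :: "real Matrix.vec \<Rightarrow> real Matrix.vec \<Rightarrow> nat \<Rightarrow> real" where
  "game \<eta> \<xi> j = Matrix.row X j \<bullet> \<eta> - Matrix.row Y j \<bullet> \<xi>"

definition divergence ::
  "real Matrix.vec \<Rightarrow> real Matrix.vec \<Rightarrow> real Matrix.vec \<Rightarrow> real Matrix.vec \<Rightarrow> real" where
  "divergence \<eta> \<xi> \<eta>' \<xi>' = entropy_bregman \<eta> \<eta>' + entropy_bregman \<xi> \<xi>'"

lemma payoff_game:
  assumes "v \<in> carrier_vec d"
  shows "v \<bullet> (X *\<^sub>v \<eta>) - v \<bullet> (Y *\<^sub>v \<xi>) = (\<Sum>j<d. v $ j * game \<eta> \<xi> j)"
  using assms
  by (simp add: scalar_prod_def[of v] dims game_def sum_subtractf[symmetric] right_diff_distrib atLeast0LessThan)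

lemma row_scalar_prod_diff_le:
  assumes M: "M \<in> carrier_mat d m" "entries_bounded R M" and "j < d"
    and u: "dim_vec u = m" "dim_vec v = m"
  shows "\<bar>Matrix.row M j \<bullet> u - Matrix.row M j \<bullet> v\<bar> \<le> R * l1_dist u v"
proof -
  have "Matrix.row M j \<bullet> u - Matrix.row M j \<bullet> v = (\<Sum>l<m. M $$ (j, l) * (u $ l - v $ l))"
    using assms by (simp add: scalar_prod_def atLeast0LessThan sum_subtractf[symmetric] right_diff_distrib)
  also have "\<bar>\<dots>\<bar> \<le> (\<Sum>l<m. \<bar>M $$ (j, l)\<bar> * \<bar>u $ l - v $ l\<bar>)"
    by (rule order.trans[OF sum_abs]) (simp add: abs_mult)
  also have "\<dots> \<le> (\<Sum>l<m. R * \<bar>u $ l - v $ l\<bar>)"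
    using assms by (intro sum_mono mult_right_mono) (auto simp: entries_bounded_def)
  finally show ?thesis using u by (simp add: l1_dist_def sum_distrib_left)
qed

lemma row_scalar_prod_le:
  assumes M: "M \<in> carrier_mat d m" "entries_bounded R M" and "j < d" and u: "u \<in> prob_simplex m"
  shows "\<bar>Matrix.row M j \<bullet> u\<bar> \<le> R"
proof -
  note U = prob_simplexD[OF u]
  have "\<bar>Matrix.row M j \<bullet> u\<bar> = \<bar>\<Sum>l<m. M $$ (j, l) * u $ l\<bar>"
    using assms U by (simp add: scalar_prod_def atLeast0LessThan)
  also have "\<dots> \<le> (\<Sum>l<m. \<bar>M $$ (j, l)\<bar> * u $ l)"
    by (rule order.trans[OF sum_abs]) (simp add: abs_mult U)
  also have "\<dots> \<le> (\<Sum>l<m. R * u $ l)"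
    using assms U by (intro sum_mono mult_right_mono) (auto simp: entries_bounded_def)
  finally show ?thesis using U by (simp add: sum_distrib_left[symmetric])
qed

end

text \<open>Here \<open>y\<close> is the \<open>w\<close> part of the saddle point. The convergence
  proof uses only stationarity in \<open>w\<close> and minimality in \<open>x\<close>;
  \<open>optimal_solution_stationary\<close> later provides the former. The factor
  \<open>8 * R\<^sup>2\<close> is the Lipschitz constant in \<open>game_diff_le\<close>.\<close>

locale saddle_svc_optimum = saddle_svc +
  fixes R :: real and y \<eta>s \<xi>s :: "real Matrix.vec"
  assumes R: "0 < R" "entries_bounded R X" "entries_bounded R Y"
    and steps: "\<sigma> * (8 * R\<^sup>2) * \<tau> \<le> 1 / 16"
    and y: "y \<in> carrier_vec d" "\<And>j. j < d \<Longrightarrow> y $ j = game \<eta>s \<xi>s j"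
    and feas: "\<eta>s \<in> feasible P n\<^sub>1" "\<xi>s \<in> feasible P n\<^sub>2"
    and min: "\<And>\<eta> \<xi>. \<eta> \<in> feasible P n\<^sub>1 \<Longrightarrow> \<xi> \<in> feasible P n\<^sub>2 \<Longrightarrow>
      reg_payoff X Y \<gamma> y \<eta>s \<xi>s \<le> reg_payoff X Y \<gamma> y \<eta> \<xi>"
begin

definition potential :: "iterate \<Rightarrow> real" where
  "potential st = (1 / (2 * \<sigma>) + 1) * (\<Sum>j<d. (it_w st $ j - y $ j)\<^sup>2)
     + (1 / \<tau> + \<gamma> / d) * divergence (it_eta st) (it_xi st) \<eta>s \<xi>s
     + 15 / (16 * \<tau>) * divergence (it_eta_prev st) (it_xi_prev st) (it_eta st) (it_xi st)
     + 1 / d * (\<Sum>j<d. (it_w st $ j - y $ j)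
         * (game (it_eta st) (it_xi st) j - game (it_eta_prev st) (it_xi_prev st) j))"

definition condition_number :: real where
  "condition_number = d + q * sqrt d / sqrt \<gamma>"

lemma condition_number_ge: "real d \<le> condition_number"  "1 \<le> condition_number" "0 < condition_number"
proof -
  have "0 \<le> q * sqrt d / sqrt \<gamma>" using q \<gamma> by simp
  then show "real d \<le> condition_number" by (simp add: condition_number_def)
  then show "1 \<le> condition_number" "0 < condition_number" using d by auto
qed

text \<open>The squares of \<open>w\<close> contract by \<open>\<theta>\<close>, which is 1 minus
  the reciprocal of the condition number. The divergences contract only by 1 minus the reciprocal of
  \<open>1 + 2 * q * sqrt (d / \<gamma>)\<close>, and this number is at most twice the condition
  number.\<close>

definition \<rho> :: real where "\<rho> = 1 - 1 / (2 * condition_number)"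

lemma \<theta>_bounds: "0 \<le> \<theta>" "\<theta> \<le> \<rho>" "\<theta> \<le> 1"
  using condition_number_ge
  by (auto simp: step_theta_def \<rho>_def condition_number_def[symmetric] field_simps)

lemma \<rho>_bounds: "0 \<le> \<rho>" "\<rho> \<le> 1"
  using condition_number_ge by (auto simp: \<rho>_def field_simps)

lemma condition_number_eq: "condition_number = d * (1 / (2 * \<sigma>) + 1)"
proof -
  have "d / (2 * \<sigma>) = q * sqrt d / sqrt \<gamma>"
    using q \<gamma> d by (simp add: step_sigma_def real_sqrt_mult field_simps)
  then show ?thesis by (simp add: condition_number_def algebra_simps)
qed

lemma \<theta>_contraction: "1 / (2 * \<sigma>) + 1 - 1 / d \<le> \<theta> * (1 / (2 * \<sigma>) + 1)"
proof -
  have "\<theta> = 1 - 1 / (d * (1 / (2 * \<sigma>) + 1))"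
    by (simp add: step_theta_def condition_number_def[symmetric] condition_number_eq)
  moreover have "1 / (2 * \<sigma>) + 1 \<noteq> 0"
    using condition_number_ge(3) unfolding condition_number_eq by auto
  ultimately show ?thesis using d by (simp add: left_diff_distrib)
qed

lemma \<rho>_contraction: "1 / \<tau> \<le> \<rho> * (1 / \<tau> + \<gamma> / d)"
proof -
  define G where "G = condition_number"
  define s where "s = sqrt d / sqrt \<gamma>"
  have d0: "real d > 0" using d by simp
  have s: "s > 0" using d0 \<gamma> by (simp add: s_def)
  have sq: "s * s = d / \<gamma>" using d0 \<gamma> by (simp add: s_def power2_eq_square[symmetric] power_divide)
  have t: "1 / \<tau> = 2 * q * s * (\<gamma> / d)"
  proof -
    have "\<tau> = s / (2 * q)" by (simp add: step_tau_def s_def real_sqrt_divide)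
    then have "1 / \<tau> = 2 * q / s" by simp
    also have "\<dots> = 2 * q * s / (s * s)" using s by simp
    finally show ?thesis unfolding sq using d0 \<gamma> by simp
  qed
  have G: "1 + 2 * q * s \<le> 2 * G" "G > 0"
    using d condition_number_ge by (auto simp: G_def condition_number_def s_def)
  have "(1 + 2 * q * s) / (2 * G) \<le> 1" using G by simp
  then have "(2 * q * s) \<le> \<rho> * (2 * q * s + 1)"
    by (simp add: \<rho>_def G_def[symmetric] algebra_simps add_divide_distrib)
  then have "(2 * q * s) * (\<gamma> / d) \<le> (\<rho> * (2 * q * s + 1)) * (\<gamma> / d)"
    using d0 \<gamma> by (intro mult_right_mono) auto
  then show ?thesis unfolding t by (simp add: algebra_simps)
qed

text \<open>The entry bound \<open>R\<close> is paired with the l1 distance. The constant is 8 = 2 *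
  4: 2 from squaring the sum over the two players, 4 from
  \<open>l1_dist_le_entropy_bregman\<close>.\<close>

lemma game_diff_le:
  assumes "positive_feasible P n\<^sub>1 \<eta>" "positive_feasible P n\<^sub>1 \<eta>'"
    "positive_feasible P n\<^sub>2 \<xi>" "positive_feasible P n\<^sub>2 \<xi>'" and j: "j < d"
  shows "(game \<eta>' \<xi>' j - game \<eta> \<xi> j)\<^sup>2 \<le> 8 * R\<^sup>2 * divergence \<eta> \<xi> \<eta>' \<xi>'"
proof -
  define a b where "a = l1_dist \<eta>' \<eta>" and "b = l1_dist \<xi>' \<xi>"
  have ab: "0 \<le> a" "0 \<le> b" by (auto simp: a_def b_def l1_dist_nonneg)
  have "\<bar>game \<eta>' \<xi>' j - game \<eta> \<xi> j\<bar>
      \<le> \<bar>Matrix.row X j \<bullet> \<eta>' - Matrix.row X j \<bullet> \<eta>\<bar> + \<bar>Matrix.row Y j \<bullet> \<xi>' - Matrix.row Y j \<bullet> \<xi>\<bar>"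
    by (simp add: game_def)
  also have "\<dots> \<le> R * a + R * b"
    unfolding a_def b_def using assms positive_feasibleD(4)
    by (intro add_mono row_scalar_prod_diff_le[OF X R(2) j] row_scalar_prod_diff_le[OF Y R(3) j]) auto
  finally have "(game \<eta>' \<xi>' j - game \<eta> \<xi> j)\<^sup>2 \<le> (R * a + R * b)\<^sup>2"
    using abs_le_square_iff[of "game \<eta>' \<xi>' j - game \<eta> \<xi> j" "R * a + R * b"] by linarith
  also have "\<dots> \<le> R\<^sup>2 * (2 * a\<^sup>2 + 2 * b\<^sup>2)"
  proof -
    have "(R * a + R * b)\<^sup>2 = R\<^sup>2 * (a + b)\<^sup>2" by (simp add: power_mult_distrib[symmetric] distrib_left)
    moreover have "(a + b)\<^sup>2 \<le> 2 * a\<^sup>2 + 2 * b\<^sup>2"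
      using zero_le_power2[of "a - b"] by (simp add: power2_eq_square algebra_simps)
    ultimately show ?thesis by (simp add: mult_left_mono)
  qed
  also have "\<dots> \<le> R\<^sup>2 * (2 * (4 * entropy_bregman \<eta> \<eta>') + 2 * (4 * entropy_bregman \<xi> \<xi>'))"
    unfolding a_def b_def
    using assms positive_feasibleD(2)
    by (intro mult_left_mono add_mono l1_dist_le_entropy_bregman)
       (auto dest: positive_feasibleD(5)[rotated])
  finally show ?thesis by (simp add: divergence_def algebra_simps)
qed

lemma divergence_nonneg:
  assumes "positive_feasible P n\<^sub>1 \<eta>" "\<eta>' \<in> feasible P n\<^sub>1"
    "positive_feasible P n\<^sub>2 \<xi>" "\<xi>' \<in> feasible P n\<^sub>2"
  shows "0 \<le> divergence \<eta> \<xi> \<eta>' \<xi>'"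
  unfolding divergence_def
  using assms positive_feasibleD(2) feasible_prob_simplex
  by (intro add_nonneg_nonneg entropy_bregman_nonneg[of _ n\<^sub>1] entropy_bregman_nonneg[of _ n\<^sub>2])
     (auto dest: positive_feasibleD(5)[rotated])

text \<open>Adds two inequalities: the argmin step compared with the saddle point, and optimality of
  the saddle point compared with the new iterate, divided by \<open>d\<close>. The entropies cancel,
  and \<open>y = K x\<^sup>*\<close> makes the bilinear terms a product of errors.\<close>

lemma three_point:
  assumes inv: "iterate_inv P d n\<^sub>1 n\<^sub>2 st" and i: "i < d"
  defines "st' \<equiv> svc_step P X Y \<gamma> q i st"
  shows "(1 / \<tau> + \<gamma> / d) * divergence (it_eta st') (it_xi st') \<eta>s \<xi>s
      + 1 / \<tau> * divergence (it_eta st) (it_xi st) (it_eta st') (it_xi st')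
      + 1 / d * (\<Sum>j<d. (it_w st $ j + (if j = i then d * (next_coord X Y \<gamma> q i st - it_w st $ i) else 0) - y $ j)
          * (game (it_eta st') (it_xi st') j - y $ j))
    \<le> 1 / \<tau> * divergence (it_eta st) (it_xi st) \<eta>s \<xi>s"
proof -
  define v where "v = overshoot X Y \<gamma> q i st"
  have v: "v \<in> carrier_vec d" unfolding v_def by (rule overshoot_carrier[OF inv])
  define \<eta> \<xi> where "\<eta> = it_eta st'" and "\<xi> = it_xi st'"
  have f: "\<eta> \<in> feasible P n\<^sub>1" "\<xi> \<in> feasible P n\<^sub>2"
    using step_optimality(1,4)[OF inv, of i] positive_feasibleD(1) unfolding \<eta>_def \<xi>_def st'_def by blast+
  have vj: "v $ j = it_w st $ j + (if j = i then d * (next_coord X Y \<gamma> q i st - it_w st $ i) else 0)"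
    if "j < d" for j
    using that inv i by (auto simp: v_def overshoot_def update_vec_def dims iterate_inv_def)
  have d0: "real d > 0" using d by simp
  have m: "1 / d * (y \<bullet> (X *\<^sub>v \<eta>s) - y \<bullet> (Y *\<^sub>v \<xi>s)) + \<gamma> / d * (entropy \<eta>s + entropy \<xi>s)
      \<le> 1 / d * (y \<bullet> (X *\<^sub>v \<eta>) - y \<bullet> (Y *\<^sub>v \<xi>)) + \<gamma> / d * (entropy \<eta> + entropy \<xi>)"
  proof -
    have "(y \<bullet> (X *\<^sub>v \<eta>s) - y \<bullet> (Y *\<^sub>v \<xi>s)) + \<gamma> * (entropy \<eta>s + entropy \<xi>s)
      \<le> (y \<bullet> (X *\<^sub>v \<eta>) - y \<bullet> (Y *\<^sub>v \<xi>)) + \<gamma> * (entropy \<eta> + entropy \<xi>)"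
      using min[OF f] by (simp add: reg_payoff_def algebra_simps)
    then have "((y \<bullet> (X *\<^sub>v \<eta>s) - y \<bullet> (Y *\<^sub>v \<xi>s)) + \<gamma> * (entropy \<eta>s + entropy \<xi>s)) / d
      \<le> ((y \<bullet> (X *\<^sub>v \<eta>) - y \<bullet> (Y *\<^sub>v \<xi>)) + \<gamma> * (entropy \<eta> + entropy \<xi>)) / d"
      using d0 by (intro divide_right_mono) auto
    then show ?thesis by (simp add: add_divide_distrib)
  qed
  note m' = m[unfolded payoff_game[OF y(1)]]
  note o1 = step_optimality(2)[OF inv feas(1), of i, folded v_def st'_def \<eta>_def]
  note o2 = step_optimality(5)[OF inv feas(2), of i, folded v_def st'_def \<xi>_def]
  have o: "1 / d * (\<Sum>j<d. v $ j * game \<eta> \<xi> j) + \<gamma> / d * (entropy \<eta> + entropy \<xi>)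
      + 1 / \<tau> * divergence (it_eta st) (it_xi st) \<eta> \<xi> + (\<gamma> / d + 1 / \<tau>) * divergence \<eta> \<xi> \<eta>s \<xi>s
    \<le> 1 / d * (\<Sum>j<d. v $ j * game \<eta>s \<xi>s j) + \<gamma> / d * (entropy \<eta>s + entropy \<xi>s)
      + 1 / \<tau> * divergence (it_eta st) (it_xi st) \<eta>s \<xi>s"
    using add_mono[OF o1 o2]
    unfolding payoff_game[OF v, symmetric] divergence_def right_diff_distrib distrib_left by linarith
  have "(\<Sum>j<d. (it_w st $ j + (if j = i then d * (next_coord X Y \<gamma> q i st - it_w st $ i) else 0) - y $ j)
          * (game \<eta> \<xi> j - y $ j)) = (\<Sum>j<d. (v $ j - y $ j) * (game \<eta> \<xi> j - game \<eta>s \<xi>s j))"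
    by (intro sum.cong refl) (simp add: vj y(2))
  also have "\<dots> = (\<Sum>j<d. v $ j * game \<eta> \<xi> j) - (\<Sum>j<d. v $ j * game \<eta>s \<xi>s j)
      - ((\<Sum>j<d. y $ j * game \<eta> \<xi> j) - (\<Sum>j<d. y $ j * game \<eta>s \<xi>s j))"
    unfolding sum_subtractf[symmetric] by (intro sum.cong refl) (simp add: algebra_simps)
  finally have sum: "(\<Sum>j<d. (it_w st $ j + (if j = i then d * (next_coord X Y \<gamma> q i st - it_w st $ i) else 0) - y $ j)
          * (game \<eta> \<xi> j - y $ j)) = \<dots>" .
  show ?thesis
    unfolding \<eta>_def[symmetric] \<xi>_def[symmetric] sum
    unfolding right_diff_distrib
    using o m' by (simp only: add.commute[of "\<gamma> / d"])
qed

lemma next_coord_game: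
  assumes inv: "iterate_inv P d n\<^sub>1 n\<^sub>2 st" and i: "i < d"
  shows "next_coord X Y \<gamma> q i st = (it_w st $ i + \<sigma> * (game (it_eta st) (it_xi st) i
    + \<theta> * (game (it_eta st) (it_xi st) i - game (it_eta_prev st) (it_xi_prev st) i))) / (\<sigma> + 1)"
proof -
  note I = inv[unfolded iterate_inv_def]
  have c: "it_eta st \<in> carrier_vec n\<^sub>1" "it_eta_prev st \<in> carrier_vec n\<^sub>1"
    "it_xi st \<in> carrier_vec n\<^sub>2" "it_xi_prev st \<in> carrier_vec n\<^sub>2"
    using I positive_feasibleD(3) by blast+
  have r: "Matrix.row X i \<in> carrier_vec n\<^sub>1" "Matrix.row Y i \<in> carrier_vec n\<^sub>2"
    using dims by (auto intro: carrier_vecI)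
  have e1: "Matrix.row X i \<bullet> (it_eta st + \<theta> \<cdot>\<^sub>v (it_eta st - it_eta_prev st))
      = Matrix.row X i \<bullet> it_eta st + \<theta> * (Matrix.row X i \<bullet> it_eta st - Matrix.row X i \<bullet> it_eta_prev st)"
    using c r by (simp add: scalar_prod_add_distrib[of _ n\<^sub>1] scalar_prod_minus_distrib[of _ n\<^sub>1])
  have e2: "Matrix.row Y i \<bullet> (it_xi st + \<theta> \<cdot>\<^sub>v (it_xi st - it_xi_prev st))
      = Matrix.row Y i \<bullet> it_xi st + \<theta> * (Matrix.row Y i \<bullet> it_xi st - Matrix.row Y i \<bullet> it_xi_prev st)"
    using c r by (simp add: scalar_prod_add_distrib[of _ n\<^sub>2] scalar_prod_minus_distrib[of _ n\<^sub>2])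
  show ?thesis
    unfolding next_coord_def dims e1 e2 game_def by (simp add: algebra_simps)
qed

lemma potential_step:
  assumes inv: "iterate_inv P d n\<^sub>1 n\<^sub>2 st"
  shows "(\<Sum>i<d. potential (svc_step P X Y \<gamma> q i st)) / d \<le> \<rho> * potential st"
    and "(\<Sum>j<d. (it_w st $ j - y $ j)\<^sup>2) / 2 \<le> potential st"
proof -
  note I = inv[unfolded iterate_inv_def]
  define S where "S i = svc_step P X Y \<gamma> q i st" for i
  have inv': "iterate_inv P d n\<^sub>1 n\<^sub>2 (S i)" for i
    unfolding S_def by (rule iterate_inv_step[OF inv])
  note I' = inv'[unfolded iterate_inv_def]
  have S: "it_eta_prev (S i) = it_eta st" "it_xi_prev (S i) = it_xi st" for i
    by (auto simp: S_def svc_step_sel)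
  have pS: "potential (S i) = (1 / (2 * \<sigma>) + 1)
        * (\<Sum>j<d. ((if j = i then next_coord X Y \<gamma> q i st else it_w st $ j) - y $ j)\<^sup>2)
      + (1 / \<tau> + \<gamma> / d) * divergence (it_eta (S i)) (it_xi (S i)) \<eta>s \<xi>s
      + 15 / (16 * \<tau>) * divergence (it_eta st) (it_xi st) (it_eta (S i)) (it_xi (S i))
      + 1 / d * (\<Sum>j<d. ((if j = i then next_coord X Y \<gamma> q i st else it_w st $ j) - y $ j)
         * (game (it_eta (S i)) (it_xi (S i)) j - game (it_eta st) (it_xi st) j))" for i
  proof -
    have "it_w (S i) $ j = (if j = i then next_coord X Y \<gamma> q i st else it_w st $ j)" if "j < d" for j
      using that I by (auto simp: S_def svc_step_sel update_vec_def)
    then show ?thesis unfolding potential_def S by simp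
  qed
  have B: "0 < 8 * R\<^sup>2" using R by simp
  have l: "0 < \<gamma> / d" using \<gamma> d by simp
  note step = expected_potential_step[where y = "\<lambda>j. it_w st $ j" and ys = "\<lambda>j. y $ j" and
      k = "game (it_eta st) (it_xi st)" and kp = "game (it_eta_prev st) (it_xi_prev st)" and
      kn = "\<lambda>i. game (it_eta (S i)) (it_xi (S i))" and yn = "\<lambda>i. next_coord X Y \<gamma> q i st" and
      Dc = "divergence (it_eta st) (it_xi st) \<eta>s \<xi>s" and
      Dp = "divergence (it_eta_prev st) (it_xi_prev st) (it_eta st) (it_xi st)" and
      Dn = "\<lambda>i. divergence (it_eta st) (it_xi st) (it_eta (S i)) (it_xi (S i))" and
      Ds = "\<lambda>i. divergence (it_eta (S i)) (it_xi (S i)) \<eta>s \<xi>s",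
      OF d \<tau>_pos \<sigma>_pos \<theta>_bounds(1,2) l \<theta>_contraction \<rho>_contraction \<theta>_bounds(3)
        next_coord_game[OF inv] three_point[OF inv, folded S_def] _ _ B steps]
  have "(\<Sum>i<d. potential (S i)) / d \<le> \<rho> * potential st"
    unfolding pS unfolding potential_def
    by (rule step(1)) (use I I' feas in \<open>auto intro!: game_diff_le divergence_nonneg dest: positive_feasibleD(1)\<close>)
  then show "(\<Sum>i<d. potential (svc_step P X Y \<gamma> q i st)) / d \<le> \<rho> * potential st"
    by (simp add: S_def)
  show "(\<Sum>j<d. (it_w st $ j - y $ j)\<^sup>2) / 2 \<le> potential st"
    unfolding potential_def
    by (rule step(2)) (use I I' feas in \<open>auto intro!: game_diff_le divergence_nonneg dest: positive_feasibleD(1)\<close>)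
qed

end

section \<open>From the potential to the expected loss\<close>

lemma finite_set_svc_run: "0 < dim_row X \<Longrightarrow> finite (set_pmf (svc_run P X Y \<gamma> q T))"
  by (induction T) (auto simp: lessThan_empty_iff)

lemma expectation_svc_run_Suc:
  fixes f :: "iterate \<Rightarrow> real"
  assumes "0 < dim_row X"
  shows "measure_pmf.expectation (svc_run P X Y \<gamma> q (Suc T)) f
    = measure_pmf.expectation (svc_run P X Y \<gamma> q T)
        (\<lambda>st. (\<Sum>i<dim_row X. f (svc_step P X Y \<gamma> q i st)) / dim_row X)"
proof -
  note fin = finite_set_svc_run[OF assms, of P Y \<gamma> q T]
  have ne: "{..<dim_row X} \<noteq> {}" using assms by (auto simp: lessThan_empty_iff)
  show ?thesis
    unfolding svc_run.simps
    by (subst pmf_expectation_bind[OF fin])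
       (use ne in \<open>simp_all add: integral_pmf_of_set integral_measure_pmf[OF fin] sum_divide_distrib[of _ "set_pmf _"]\<close>)
qed

lemma expectation_mono_finite:
  fixes f g :: "'a \<Rightarrow> real"
  assumes "finite (set_pmf p)" "\<And>x. x \<in> set_pmf p \<Longrightarrow> f x \<le> g x"
  shows "measure_pmf.expectation p f \<le> measure_pmf.expectation p g"
  using assms by (intro integral_mono_AE) (auto simp: AE_measure_pmf_iff integrable_measure_pmf_finite)

lemma entropy_nonpos: "u \<in> prob_simplex m \<Longrightarrow> entropy u \<le> 0"
proof -
  assume u: "u \<in> prob_simplex m"
  note U = prob_simplexD[OF u]
  show ?thesis
    unfolding entropy_def U(2)
  proof (intro sum_nonpos)
    fix i assume i: "i \<in> {..<m}"
    have "u $ i \<le> (\<Sum>i<m. u $ i)" using U i by (intro member_le_sum) auto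
    then show "u $ i * ln (u $ i) \<le> 0"
      using U i by (cases "u $ i = 0") (auto intro!: mult_nonneg_nonpos simp: less_le)
  qed
qed

lemma entropy_bregman_uniform:
  assumes u: "u \<in> prob_simplex m" and m: "1 \<le> m"
  shows "entropy_bregman (Matrix.vec m (\<lambda>_. 1 / real m)) u \<le> ln (real m)"
proof -
  note U = prob_simplexD[OF u]
  have "entropy_bregman (Matrix.vec m (\<lambda>_. 1 / real m)) u = entropy u + ln (real m)"
    using m U(4) by (subst entropy_bregman_eq[of _ m]) 
      (simp_all add: U(2) entropy_def sum.distrib sum_subtractf ln_div sum_negf sum_distrib_right[symmetric])
  then show ?thesis using entropy_nonpos[OF u] by simp
qed

context saddle_svc
begin

text \<open>A crude bound for qualitative use: it makes infima bounded below and perturbations of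
  \<open>w\<close> controllable. No rate depends on it.\<close>

lemma exists_entries_bounded: "\<exists>R\<ge>0. entries_bounded R X \<and> entries_bounded R Y"
proof -
  let ?I = "{..<d} \<times> {..<n\<^sub>1}" and ?J = "{..<d} \<times> {..<n\<^sub>2}"
  define R where "R = (\<Sum>x\<in>?I. \<bar>X $$ x\<bar>) + (\<Sum>x\<in>?J. \<bar>Y $$ x\<bar>)"
  have nn: "0 \<le> (\<Sum>x\<in>?I. \<bar>X $$ x\<bar>)" "0 \<le> (\<Sum>x\<in>?J. \<bar>Y $$ x\<bar>)"
    by (auto intro!: sum_nonneg)
  have "\<bar>X $$ (i, j)\<bar> \<le> R" if "i < d" "j < n\<^sub>1" for i j
  proof -
    have "\<bar>X $$ (i, j)\<bar> \<le> (\<Sum>x\<in>?I. \<bar>X $$ x\<bar>)" using that by (intro member_le_sum) auto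
    then show ?thesis using nn by (simp only: R_def)
  qed
  moreover have "\<bar>Y $$ (i, j)\<bar> \<le> R" if "i < d" "j < n\<^sub>2" for i j
  proof -
    have "\<bar>Y $$ (i, j)\<bar> \<le> (\<Sum>x\<in>?J. \<bar>Y $$ x\<bar>)" using that by (intro member_le_sum) auto
    then show ?thesis using nn by (simp only: R_def)
  qed
  moreover have "0 \<le> R" using nn by (simp add: R_def)
  ultimately show ?thesis by (auto simp: entries_bounded_def dims)
qed

lemma game_le:
  assumes "entries_bounded R X" "entries_bounded R Y"
    and "\<eta> \<in> feasible P n\<^sub>1" "\<xi> \<in> feasible P n\<^sub>2" "j < d"
  shows "\<bar>game \<eta> \<xi> j\<bar> \<le> 2 * R"
  using row_scalar_prod_le[OF X assms(1,5) feasible_prob_simplex[OF assms(3)]]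
    row_scalar_prod_le[OF Y assms(2,5) feasible_prob_simplex[OF assms(4)]]
  by (simp add: game_def)

lemma payoff_eq:
  assumes "w \<in> carrier_vec d"
  shows "payoff X Y w \<eta> \<xi> = (\<Sum>j<d. w $ j * game \<eta> \<xi> j - (w $ j)\<^sup>2 / 2)"
  unfolding payoff_def payoff_game[OF assms]
  using assms by (simp add: scalar_prod_def sum_subtractf sum_divide_distrib power2_eq_square atLeast0LessThan)

lemma payoff_bdd_below:
  assumes w: "w \<in> carrier_vec d"
  shows "bdd_below ((\<lambda>(\<eta>, \<xi>). payoff X Y w \<eta> \<xi>) ` (feasible P n\<^sub>1 \<times> feasible P n\<^sub>2))"
proof -
  obtain R where R: "entries_bounded R X" "entries_bounded R Y"
    using exists_entries_bounded by blast
  have "(\<Sum>j<d. - (\<bar>w $ j\<bar> * (2 * R)) - (w $ j)\<^sup>2 / 2) \<le> payoff X Y w \<eta> \<xi>"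
    if f: "\<eta> \<in> feasible P n\<^sub>1" "\<xi> \<in> feasible P n\<^sub>2" for \<eta> \<xi>
    unfolding payoff_eq[OF w]
  proof (intro sum_mono)
    fix j assume "j \<in> {..<d}"
    then have "\<bar>w $ j * game \<eta> \<xi> j\<bar> \<le> \<bar>w $ j\<bar> * (2 * R)"
      unfolding abs_mult using game_le[OF R f] by (intro mult_left_mono) auto
    then show "- (\<bar>w $ j\<bar> * (2 * R)) - (w $ j)\<^sup>2 / 2 \<le> w $ j * game \<eta> \<xi> j - (w $ j)\<^sup>2 / 2"
      by linarith
  qed
  then show ?thesis by (intro bdd_belowI) auto
qed

lemma saddle_value_le_payoff:
  assumes w: "w \<in> carrier_vec d" and f: "\<eta> \<in> feasible P n\<^sub>1" "\<xi> \<in> feasible P n\<^sub>2"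
  shows "saddle_value P X Y w \<le> payoff X Y w \<eta> \<xi>"
  unfolding saddle_value_def dims
  by (rule cINF_lower2[OF payoff_bdd_below[OF w], of "(\<eta>, \<xi>)"]) (use f in auto)

lemma feasible_nonempty: "feasible P n\<^sub>1 \<noteq> {}" "feasible P n\<^sub>2 \<noteq> {}"
  using uniform_positive_feasible[OF n(1) cap(1)] uniform_positive_feasible[OF n(2) cap(2)]
    positive_feasibleD(1) by blast+

lemma saddle_value_zero: "saddle_value P X Y (0\<^sub>v d) = 0"
proof -
  have z: "payoff X Y (0\<^sub>v d) \<eta> \<xi> = 0" for \<eta> \<xi>
    by (subst payoff_eq) auto
  have ne: "feasible P n\<^sub>1 \<times> feasible P n\<^sub>2 \<noteq> {}" using feasible_nonempty by auto
  show ?thesis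
    unfolding saddle_value_def dims z using ne by (simp add: case_prod_beta)
qed

text \<open>The supremum in \<open>OPT\<close> must be shown to be bounded. One fixed pair of
  strategies suffices, since completing the square bounds its payoff uniformly in
  \<open>v\<close>.\<close>

lemma saddle_value_le_OPT:
  assumes w: "w \<in> carrier_vec d"
  shows "saddle_value P X Y w \<le> OPT P X Y"
proof -
  obtain \<eta> \<xi> where f: "\<eta> \<in> feasible P n\<^sub>1" "\<xi> \<in> feasible P n\<^sub>2"
    using feasible_nonempty by blast
  have "saddle_value P X Y v \<le> (\<Sum>j<d. (game \<eta> \<xi> j)\<^sup>2 / 2)" if v: "v \<in> carrier_vec d" for v
  proof (rule order.trans[OF saddle_value_le_payoff[OF v f]], unfold payoff_eq[OF v], intro sum_mono)
    fix j
    have "0 \<le> (v $ j - game \<eta> \<xi> j)\<^sup>2" by simp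
    then show "v $ j * game \<eta> \<xi> j - (v $ j)\<^sup>2 / 2 \<le> (game \<eta> \<xi> j)\<^sup>2 / 2"
      by (simp add: power2_eq_square algebra_simps)
  qed
  then have "bdd_above (saddle_value P X Y ` carrier_vec d)" by (intro bdd_aboveI) auto
  then show ?thesis unfolding OPT_def dims by (rule cSUP_upper[OF w])
qed

lemma OPT_nonneg: "0 \<le> OPT P X Y"
  using saddle_value_le_OPT[of "0\<^sub>v d"] by (simp add: saddle_value_zero)

end

context saddle_svc_optimum
begin

lemma iterate_inv_run:
  "st \<in> set_pmf (svc_run P X Y \<gamma> q T) \<Longrightarrow> iterate_inv P d n\<^sub>1 n\<^sub>2 st"
  by (induction T arbitrary: st) (auto intro: iterate_inv_init iterate_inv_step)

lemma finite_run: "finite (set_pmf (svc_run P X Y \<gamma> q T))"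
  using d by (intro finite_set_svc_run) (simp add: dims)

lemma expectation_potential:
  "measure_pmf.expectation (svc_run P X Y \<gamma> q T) potential \<le> \<rho> ^ T * potential (svc_init X Y)"
proof (induction T)
  case (Suc T)
  have "measure_pmf.expectation (svc_run P X Y \<gamma> q (Suc T)) potential
      \<le> measure_pmf.expectation (svc_run P X Y \<gamma> q T) (\<lambda>st. \<rho> * potential st)"
  proof -
    have X0: "0 < dim_row X" using d by (simp add: dims)
    show ?thesis
      unfolding expectation_svc_run_Suc[OF X0] dims
      by (intro expectation_mono_finite finite_run potential_step(1) iterate_inv_run)
  qed
  also have "\<dots> \<le> \<rho> * (\<rho> ^ T * potential (svc_init X Y))"
    using Suc \<rho>_bounds by (simp add: mult_left_mono)
  finally show ?case by simp
qed (simp add: integral_return)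

definition initial_bound :: real where
  "initial_bound = (1 / (2 * \<sigma>) + 1) * (4 * real d * R\<^sup>2) + (1 / \<tau> + \<gamma> / d) * (ln n\<^sub>1 + ln n\<^sub>2)"

text \<open>At the start the previous and the current point coincide, which removes the cross term
  and the divergence between them. The rest is bounded by \<open>y = K x\<^sup>*\<close>, whose
  entries are at most \<open>2 * R\<close>, and by the divergence from the uniform
  distribution.\<close>

lemma potential_init: "potential (svc_init X Y) \<le> initial_bound"
proof -
  have w: "it_w (svc_init X Y) $ j = 0" if "j < d" for j
    using that by (simp add: svc_init_def Let_def dims)
  have "(\<Sum>j<d. (it_w (svc_init X Y) $ j - y $ j)\<^sup>2) \<le> (\<Sum>j<d. (2 * R)\<^sup>2)"
  proof (intro sum_mono)
    fix j assume "j \<in> {..<d}"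
    then show "(it_w (svc_init X Y) $ j - y $ j)\<^sup>2 \<le> (2 * R)\<^sup>2"
      using power_mono[OF game_le[OF R(2,3) feas, of j], of 2] by (simp add: w y(2))
  qed
  then have "(\<Sum>j<d. (it_w (svc_init X Y) $ j - y $ j)\<^sup>2) \<le> 4 * real d * R\<^sup>2"
    by (simp add: power_mult_distrib)
  moreover have "divergence (it_eta (svc_init X Y)) (it_xi (svc_init X Y)) \<eta>s \<xi>s \<le> ln n\<^sub>1 + ln n\<^sub>2"
    using feas n unfolding divergence_def svc_init_def Let_def
    by (simp add: dims add_mono entropy_bregman_uniform feasible_prob_simplex)
  moreover have "divergence (it_eta_prev (svc_init X Y)) (it_xi_prev (svc_init X Y))
      (it_eta (svc_init X Y)) (it_xi (svc_init X Y)) = 0"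
    by (simp add: divergence_def svc_init_def Let_def entropy_bregman_def)
  moreover have "game (it_eta (svc_init X Y)) (it_xi (svc_init X Y)) j
      = game (it_eta_prev (svc_init X Y)) (it_xi_prev (svc_init X Y)) j" for j
    by (simp add: svc_init_def Let_def)
  ultimately show ?thesis
    unfolding potential_def initial_bound_def using \<tau>_pos \<sigma>_pos \<gamma> d
    by (simp only: diff_self mult_zero_right sum.neutral_const add_0_right)
       (intro add_mono mult_left_mono, auto)
qed

text \<open>The value is an infimum over strategies and need not be differentiable at
  \<open>y\<close>, so the loss is of first order in \<open>w - y\<close>, whereas the potential
  controls squares. Young's inequality with the free parameter \<open>\<kappa>\<close> bridges the
  gap.\<close>

lemma saddle_value_diff_le:
  assumes w: "w \<in> carrier_vec d" and \<kappa>: "0 < \<kappa>"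
  shows "saddle_value P X Y y - saddle_value P X Y w
    \<le> \<kappa> + (4 * real d * R\<^sup>2 / \<kappa> + 1 / 2) * (\<Sum>j<d. (w $ j - y $ j)\<^sup>2)"
proof -
  let ?b = "\<kappa> + (4 * real d * R\<^sup>2 / \<kappa> + 1 / 2) * (\<Sum>j<d. (w $ j - y $ j)\<^sup>2)"
  have d0: "real d > 0" using d by simp
  have "saddle_value P X Y y - ?b \<le> payoff X Y w \<eta> \<xi>"
    if f: "\<eta> \<in> feasible P n\<^sub>1" "\<xi> \<in> feasible P n\<^sub>2" for \<eta> \<xi>
  proof -
    have "saddle_value P X Y y \<le> payoff X Y y \<eta> \<xi>"
      by (rule saddle_value_le_payoff[OF y(1) f])
    moreover have "payoff X Y y \<eta> \<xi> - payoff X Y w \<eta> \<xi> \<le> ?b"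
    proof -
      have "payoff X Y y \<eta> \<xi> - payoff X Y w \<eta> \<xi>
          = (\<Sum>j<d. (w $ j - y $ j) * (y $ j - game \<eta> \<xi> j) + (w $ j - y $ j)\<^sup>2 / 2)"
        unfolding payoff_eq[OF w] payoff_eq[OF y(1)] sum_subtractf[symmetric]
        by (intro sum.cong refl) (simp add: power2_eq_square field_simps)
      also have "\<dots> \<le> (\<Sum>j<d. \<kappa> / d + (4 * real d * R\<^sup>2 / \<kappa> + 1 / 2) * (w $ j - y $ j)\<^sup>2)"
      proof (intro sum_mono)
        fix j assume "j \<in> {..<d}"
        then have j: "j < d" by simp
        have "\<bar>y $ j - game \<eta> \<xi> j\<bar> \<le> 4 * R"
          using game_le[OF R(2,3) feas j] game_le[OF R(2,3) f j] by (simp add: y(2)[OF j])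
        then have sq: "(y $ j - game \<eta> \<xi> j)\<^sup>2 \<le> (4 * R)\<^sup>2"
          using power_mono[of "\<bar>y $ j - game \<eta> \<xi> j\<bar>" "4 * R" 2] by simp
        \<comment> \<open>With the bound \<open>4 * R\<close> just shown, this weight makes the
          error \<open>\<kappa> / d\<close> per coordinate, hence \<open>\<kappa>\<close> in
          total.\<close>
        have s: "0 < \<kappa> / (16 * real d * R\<^sup>2)" using \<kappa> d0 R by simp
        have "(w $ j - y $ j) * (y $ j - game \<eta> \<xi> j)
            \<le> (w $ j - y $ j)\<^sup>2 / (4 * (\<kappa> / (16 * real d * R\<^sup>2))) + \<kappa> / d"
          by (rule mult_le_weighted_squares[OF s sq]) (use R d0 in \<open>simp add: power2_eq_square\<close>)
        also have "(w $ j - y $ j)\<^sup>2 / (4 * (\<kappa> / (16 * real d * R\<^sup>2))) = 4 * real d * R\<^sup>2 / \<kappa> * (w $ j - y $ j)\<^sup>2"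
          by simp
        finally show "(w $ j - y $ j) * (y $ j - game \<eta> \<xi> j) + (w $ j - y $ j)\<^sup>2 / 2
            \<le> \<kappa> / d + (4 * real d * R\<^sup>2 / \<kappa> + 1 / 2) * (w $ j - y $ j)\<^sup>2"
          by (simp add: distrib_right)
      qed
      also have "\<dots> = ?b"
        using d0 by (simp add: sum.distrib sum_distrib_left)
      finally show ?thesis .
    qed
    ultimately show ?thesis by linarith
  qed
  then have "saddle_value P X Y y - ?b \<le> saddle_value P X Y w"
    unfolding saddle_value_def[of P X Y w] dims
    by (intro cINF_greatest) (use feas in auto)
  then show ?thesis by linarith
qed

text \<open>\<open>\<kappa>\<close> will be half the permitted loss. The smaller
  \<open>\<kappa>\<^sub>1\<close>, capped at 1, makes \<open>1 / \<kappa>\<^sub>1\<close> a common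
  bound for \<open>1 / \<kappa>\<close> and the constant \<open>1 / 2\<close>, so that a large
  \<open>OPT\<close> needs no separate case.\<close>

lemma expected_loss_le:
  assumes \<kappa>: "0 < \<kappa>\<^sub>1" "\<kappa>\<^sub>1 \<le> \<kappa>" "\<kappa>\<^sub>1 \<le> 1"
    and small: "2 * (4 * real d * R\<^sup>2 + 1) * initial_bound * \<rho> ^ T \<le> \<kappa>\<^sub>1\<^sup>2"
  shows "measure_pmf.expectation (svc_run P X Y \<gamma> q T)
    (\<lambda>st. saddle_value P X Y y - saddle_value P X Y (it_w st)) \<le> 2 * \<kappa>"
proof -
  define K where "K = 2 * (4 * real d * R\<^sup>2 / \<kappa> + 1 / 2)"
  have K: "0 < K" "K \<le> 2 * (4 * real d * R\<^sup>2 + 1) / \<kappa>\<^sub>1"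
  proof -
    show "0 < K" using \<kappa> by (simp add: K_def add_nonneg_pos)
    have "4 * real d * R\<^sup>2 / \<kappa> \<le> 4 * real d * R\<^sup>2 / \<kappa>\<^sub>1" using \<kappa> by (intro divide_left_mono) auto
    moreover have "1 / 2 \<le> 1 / \<kappa>\<^sub>1" using \<kappa> by (simp add: field_simps)
    ultimately have "K \<le> 2 * (4 * real d * R\<^sup>2 / \<kappa>\<^sub>1 + 1 / \<kappa>\<^sub>1)"
      unfolding K_def by (intro mult_left_mono add_mono) auto
    then show "K \<le> 2 * (4 * real d * R\<^sup>2 + 1) / \<kappa>\<^sub>1"
      by (simp only: add_divide_distrib[symmetric] times_divide_eq_right)
  qed
  have "measure_pmf.expectation (svc_run P X Y \<gamma> q T)
      (\<lambda>st. saddle_value P X Y y - saddle_value P X Y (it_w st))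
    \<le> measure_pmf.expectation (svc_run P X Y \<gamma> q T) (\<lambda>st. \<kappa> + K * potential st)"
  proof (intro expectation_mono_finite finite_run)
    fix st assume "st \<in> set_pmf (svc_run P X Y \<gamma> q T)"
    then have inv: "iterate_inv P d n\<^sub>1 n\<^sub>2 st" by (rule iterate_inv_run)
    then have "saddle_value P X Y y - saddle_value P X Y (it_w st)
        \<le> \<kappa> + K / 2 * (\<Sum>j<d. (it_w st $ j - y $ j)\<^sup>2)"
    proof -
      have "0 < \<kappa>" using \<kappa> by simp
      moreover have "K / 2 = 4 * real d * R\<^sup>2 / \<kappa> + 1 / 2" by (simp add: K_def)
      ultimately show ?thesis using saddle_value_diff_le[of "it_w st" \<kappa>] inv by (simp only: iterate_inv_def)
    qed
    also have "K / 2 * (\<Sum>j<d. (it_w st $ j - y $ j)\<^sup>2) \<le> K * potential st"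
      using potential_step(2)[OF inv] K by simp
    finally show "saddle_value P X Y y - saddle_value P X Y (it_w st) \<le> \<kappa> + K * potential st" by simp
  qed
  also have "\<dots> = \<kappa> + K * measure_pmf.expectation (svc_run P X Y \<gamma> q T) potential"
    by (simp add: integrable_measure_pmf_finite finite_run)
  also have "\<dots> \<le> \<kappa> + K * (\<rho> ^ T * initial_bound)"
  proof -
    have "measure_pmf.expectation (svc_run P X Y \<gamma> q T) potential \<le> \<rho> ^ T * initial_bound"
      using \<rho>_bounds potential_init
      by (intro order.trans[OF expectation_potential] mult_left_mono) auto
    then show ?thesis using K by simp
  qed
  also have "\<dots> \<le> \<kappa> + 2 * (4 * real d * R\<^sup>2 + 1) / \<kappa>\<^sub>1 * (\<rho> ^ T * initial_bound)"
  proof -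
    have "0 \<le> initial_bound"
      using n \<tau>_pos \<sigma>_pos \<gamma> by (auto simp: initial_bound_def intro!: add_nonneg_nonneg mult_nonneg_nonneg)
    then show ?thesis using K \<rho>_bounds by (intro add_left_mono mult_right_mono) auto
  qed
  also have "\<dots> = \<kappa> + (2 * (4 * real d * R\<^sup>2 + 1) * initial_bound * \<rho> ^ T) / \<kappa>\<^sub>1" by simp
  also have "\<dots> \<le> \<kappa> + \<kappa>\<^sub>1\<^sup>2 / \<kappa>\<^sub>1" using small \<kappa> by (intro add_left_mono divide_right_mono) auto
  also have "\<dots> \<le> 2 * \<kappa>" using \<kappa> by (simp add: power2_eq_square)
  finally show ?thesis .
qed

end

section \<open>The saddle point\<close>

definition midpoint_vec :: "real Matrix.vec \<Rightarrow> real Matrix.vec \<Rightarrow> real Matrix.vec" where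
  "midpoint_vec u v = Matrix.vec (dim_vec u) (\<lambda>i. (u $ i + v $ i) / 2)"

lemma midpoint_feasible:
  assumes "u \<in> feasible P m" "v \<in> feasible P m"
  shows "midpoint_vec u v \<in> feasible P m"
proof -
  note U = prob_simplexD[OF feasible_prob_simplex[OF assms(1)]]
    and V = prob_simplexD[OF feasible_prob_simplex[OF assms(2)]]
  have "midpoint_vec u v \<in> prob_simplex m"
    using U V by (simp add: prob_simplex_def midpoint_vec_def sum_divide_distrib[symmetric] sum.distrib)
  moreover have "midpoint_vec u v $ i \<le> \<nu>" if "P = Nu_Saddle \<nu>" "i < m" for i \<nu>
    using that U(2) feasible_le_cap[of u \<nu> m i] feasible_le_cap[of v \<nu> m i] assms
    by (simp add: midpoint_vec_def)
  ultimately show ?thesis by (cases P) (auto simp: capped_simplex_def)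
qed

text \<open>Strong convexity from the two divergences based at the midpoint, whose linear terms
  cancel. The midpoint has a zero entry only where both points have one, so boundary points are
  covered.\<close>

lemma entropy_midpoint:
  assumes u: "u \<in> prob_simplex m" and v: "v \<in> prob_simplex m"
  shows "2 * entropy (midpoint_vec u v) + (l1_dist u v)\<^sup>2 / 8 \<le> entropy u + entropy v"
proof -
  note U = prob_simplexD[OF u] and V = prob_simplexD[OF v]
  define c where "c = midpoint_vec u v"
  have ci: "c $ i = (u $ i + v $ i) / 2" if "i < m" for i
    using that by (simp add: c_def midpoint_vec_def U)
  have c: "c \<in> prob_simplex m" "dim_vec c = m"
    using U V by (auto simp: c_def prob_simplex_def midpoint_vec_def sum_divide_distrib[symmetric] sum.distrib)
  have z: "u $ i = 0" "v $ i = 0" if "i < m" "c $ i = 0" for i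
    using that U(3)[of i] V(3)[of i] by (auto simp: ci)
  have half: "l1_dist u c = l1_dist u v / 2" "l1_dist v c = l1_dist u v / 2"
    unfolding l1_dist_def U(2) V(2) sum_divide_distrib
    by (intro sum.cong refl; simp add: ci abs_if field_simps)+
  have "(l1_dist u v / 2)\<^sup>2 \<le> 4 * entropy_bregman c u"
    unfolding half(1)[symmetric] by (rule l1_dist_le_entropy_bregman[OF u c(1) z(1)])
  moreover have "(l1_dist u v / 2)\<^sup>2 \<le> 4 * entropy_bregman c v"
    unfolding half(2)[symmetric] by (rule l1_dist_le_entropy_bregman[OF v c(1) z(2)])
  ultimately have "(l1_dist u v)\<^sup>2 / 8 \<le> entropy_bregman c u + entropy_bregman c v"
    by (simp add: power_divide)
  also have "\<dots> = entropy u + entropy v - 2 * entropy c"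
    unfolding entropy_bregman_eq[OF c(2) U(2)] entropy_bregman_eq[OF c(2) V(2)] entropy_def U(2) V(2) c(2)
      sum.distrib[symmetric] sum_distrib_left sum_subtractf[symmetric]
    by (intro sum.cong refl) (simp add: ci field_simps)
  finally show ?thesis by (simp add: c_def)
qed

context saddle_svc
begin

lemma reg_payoff_eq:
  assumes "w \<in> carrier_vec d"
  shows "reg_payoff X Y \<gamma> w \<eta> \<xi>
    = (\<Sum>j<d. w $ j * game \<eta> \<xi> j - (w $ j)\<^sup>2 / 2) + \<gamma> * entropy \<eta> + \<gamma> * entropy \<xi>"
proof -
  have "reg_payoff X Y \<gamma> w \<eta> \<xi> = (w \<bullet> (X *\<^sub>v \<eta>) - w \<bullet> (Y *\<^sub>v \<xi>)) - (w \<bullet> w) / 2 + \<gamma> * entropy \<eta> + \<gamma> * entropy \<xi>"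
    by (simp add: reg_payoff_def)
  then show ?thesis
    unfolding payoff_game[OF assms]
    using assms by (simp add: scalar_prod_def sum_subtractf sum_divide_distrib power2_eq_square atLeast0LessThan)
qed

text \<open>Minimality is tested at the midpoint of the optimum and the competitor: the bilinear
  part is affine, so the gain is the strong convexity of the entropy.\<close>

lemma optimal_solution_quadratic_growth:
  assumes opt: "optimal_solution P X Y \<gamma> w \<eta> \<xi>"
    and f: "\<eta>' \<in> feasible P n\<^sub>1" "\<xi>' \<in> feasible P n\<^sub>2"
  shows "reg_payoff X Y \<gamma> w \<eta> \<xi> + \<gamma> / 8 * ((l1_dist \<eta>' \<eta>)\<^sup>2 + (l1_dist \<xi>' \<xi>)\<^sup>2) \<le> reg_payoff X Y \<gamma> w \<eta>' \<xi>'"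
proof -
  have w: "w \<in> carrier_vec d" and f0: "\<eta> \<in> feasible P n\<^sub>1" "\<xi> \<in> feasible P n\<^sub>2"
    and min: "\<And>\<eta>' \<xi>'. \<eta>' \<in> feasible P n\<^sub>1 \<Longrightarrow> \<xi>' \<in> feasible P n\<^sub>2 \<Longrightarrow>
        reg_payoff X Y \<gamma> w \<eta> \<xi> \<le> reg_payoff X Y \<gamma> w \<eta>' \<xi>'"
    using opt unfolding optimal_solution_def dims by auto
  define \<eta>m \<xi>m where "\<eta>m = midpoint_vec \<eta>' \<eta>" and "\<xi>m = midpoint_vec \<xi>' \<xi>"
  have "reg_payoff X Y \<gamma> w \<eta> \<xi> \<le> reg_payoff X Y \<gamma> w \<eta>m \<xi>m"
    unfolding \<eta>m_def \<xi>m_def by (intro min midpoint_feasible f f0)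
  moreover have mid: "game \<eta>m \<xi>m j = (game \<eta>' \<xi>' j + game \<eta> \<xi> j) / 2" for j
  proof -
    note D = prob_simplexD(2)[OF feasible_prob_simplex]
    have "Matrix.row M j \<bullet> midpoint_vec u v = (Matrix.row M j \<bullet> u + Matrix.row M j \<bullet> v) / 2"
      if "dim_vec u = m" "dim_vec v = m" for u v :: "real Matrix.vec" and M :: "real Matrix.mat" and m
      using that unfolding scalar_prod_def midpoint_vec_def
      by (simp add: sum.distrib[symmetric] sum_divide_distrib) (intro sum.cong refl, simp add: algebra_simps add_divide_distrib)
    then show ?thesis
      using D[OF f(1)] D[OF f(2)] D[OF f0(1)] D[OF f0(2)]
      unfolding game_def \<eta>m_def \<xi>m_def by (simp add: field_simps)
  qed
  have lin: "2 * (\<Sum>j<d. w $ j * game \<eta>m \<xi>m j - (w $ j)\<^sup>2 / 2)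
      = (\<Sum>j<d. w $ j * game \<eta>' \<xi>' j - (w $ j)\<^sup>2 / 2) + (\<Sum>j<d. w $ j * game \<eta> \<xi> j - (w $ j)\<^sup>2 / 2)"
    unfolding sum_distrib_left sum.distrib[symmetric] mid by (intro sum.cong refl) (simp add: algebra_simps)
  have e: "2 * entropy \<eta>m + (l1_dist \<eta>' \<eta>)\<^sup>2 / 8 \<le> entropy \<eta>' + entropy \<eta>"
    "2 * entropy \<xi>m + (l1_dist \<xi>' \<xi>)\<^sup>2 / 8 \<le> entropy \<xi>' + entropy \<xi>"
    unfolding \<eta>m_def \<xi>m_def using f f0 by (auto intro!: entropy_midpoint feasible_prob_simplex)
  have "\<gamma> * (2 * entropy \<eta>m + (l1_dist \<eta>' \<eta>)\<^sup>2 / 8) + \<gamma> * (2 * entropy \<xi>m + (l1_dist \<xi>' \<xi>)\<^sup>2 / 8)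
      \<le> \<gamma> * (entropy \<eta>' + entropy \<eta>) + \<gamma> * (entropy \<xi>' + entropy \<xi>)"
    using e[THEN mult_left_mono, of \<gamma>] \<gamma> by (intro add_mono) auto
  ultimately show ?thesis
    using lin unfolding reg_payoff_eq[OF w] by (simp add: algebra_simps)
qed

text \<open>Moving \<open>w\<close> by \<open>t h\<close> changes the inner minimum by \<open>t \<langle>h, K x - w\<rangle> - O(t\<^sup>2)\<close>, since by
  quadratic growth the minimiser moves by \<open>O(t)\<close> only.\<close>

lemma optimal_solution_stationary:
  assumes opt: "optimal_solution P X Y \<gamma> w \<eta> \<xi>" and "j < d"
  shows "w $ j = game \<eta> \<xi> j"
proof -
  have w: "w \<in> carrier_vec d" and f0: "\<eta> \<in> feasible P n\<^sub>1" "\<xi> \<in> feasible P n\<^sub>2"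
    and max: "\<And>w'. w' \<in> carrier_vec d \<Longrightarrow> (INF (\<eta>', \<xi>') \<in> feasible P n\<^sub>1 \<times> feasible P n\<^sub>2. reg_payoff X Y \<gamma> w' \<eta>' \<xi>')
          \<le> reg_payoff X Y \<gamma> w \<eta> \<xi>"
    using opt unfolding optimal_solution_def dims by auto
  obtain R where R: "0 \<le> R" "entries_bounded R X" "entries_bounded R Y"
    using exists_entries_bounded by blast
  \<comment> \<open>\<open>h\<close> is the expected gradient of the inner minimum and
    \<open>S\<close> its squared norm, the slope along \<open>h\<close>. The constant
    \<open>C\<close> collects one Young error per player and the curvature of the quadratic
    term.\<close>
  define h where "h = (\<lambda>j. game \<eta> \<xi> j - w $ j)"
  define S where "S = (\<Sum>j<d. (h j)\<^sup>2)"
  define M where "M = (\<Sum>j<d. \<bar>h j\<bar> * R)"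
  define C where "C = 4 * M\<^sup>2 / \<gamma> + S / 2"
  have S0: "0 \<le> S" by (simp add: S_def sum_nonneg)
  have M0: "0 \<le> M" using R by (simp add: M_def sum_nonneg)
  have C0: "0 \<le> C" using \<gamma> S0 by (simp add: C_def)
  have tS: "t * S \<le> t\<^sup>2 * C" if t: "0 < t" for t
  proof -
    define w' where "w' = Matrix.vec d (\<lambda>j. w $ j + t * h j)"
    have w': "w' \<in> carrier_vec d" by (simp add: w'_def)
    have "reg_payoff X Y \<gamma> w \<eta> \<xi> + t * S - t\<^sup>2 * C \<le> reg_payoff X Y \<gamma> w' \<eta>' \<xi>'"
      if f: "\<eta>' \<in> feasible P n\<^sub>1" "\<xi>' \<in> feasible P n\<^sub>2" for \<eta>' \<xi>'
    proof -
      define a b where "a = l1_dist \<eta>' \<eta>" and "b = l1_dist \<xi>' \<xi>"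
      define E where "E = (\<Sum>j<d. h j * (game \<eta>' \<xi>' j - game \<eta> \<xi> j))"
      have "reg_payoff X Y \<gamma> w' \<eta>' \<xi>' - reg_payoff X Y \<gamma> w \<eta>' \<xi>'
          = (\<Sum>j<d. t * (h j)\<^sup>2 + t * (h j * (game \<eta>' \<xi>' j - game \<eta> \<xi> j)) - t\<^sup>2 * ((h j)\<^sup>2 / 2))"
      proof -
        have "w' $ j * game \<eta>' \<xi>' j - (w' $ j)\<^sup>2 / 2 - (w $ j * game \<eta>' \<xi>' j - (w $ j)\<^sup>2 / 2)
            = t * (h j)\<^sup>2 + t * (h j * (game \<eta>' \<xi>' j - game \<eta> \<xi> j)) - t\<^sup>2 * ((h j)\<^sup>2 / 2)" if "j < d" for j
        proof -
          have "game \<eta> \<xi> j = h j + w $ j" by (simp add: h_def)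
          then show ?thesis using that by (simp add: w'_def power2_eq_square field_simps)
        qed
        then show ?thesis
          unfolding reg_payoff_eq[OF w] reg_payoff_eq[OF w'] by (simp add: sum_subtractf[symmetric])
      qed
      also have "\<dots> = t * S + t * E - t\<^sup>2 * (S / 2)"
        by (simp add: sum_subtractf sum.distrib sum_distrib_left S_def E_def sum_divide_distrib)
      finally have diff: "reg_payoff X Y \<gamma> w' \<eta>' \<xi>' = reg_payoff X Y \<gamma> w \<eta>' \<xi>' + t * S + t * E - t\<^sup>2 * (S / 2)"
        by simp
      have "- E \<le> M * (a + b)"
      proof -
        have "- E = (\<Sum>j<d. - h j * (game \<eta>' \<xi>' j - game \<eta> \<xi> j))" by (simp add: E_def sum_negf)
        also have "\<dots> \<le> (\<Sum>j<d. \<bar>h j\<bar> * (R * a + R * b))"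
        proof (intro sum_mono)
          fix j assume "j \<in> {..<d}"
          then have j: "j < d" by simp
          note D = prob_simplexD(2)[OF feasible_prob_simplex]
          have "\<bar>game \<eta>' \<xi>' j - game \<eta> \<xi> j\<bar> \<le> R * a + R * b"
            using row_scalar_prod_diff_le[OF X R(2) j D[OF f(1)] D[OF f0(1)]]
              row_scalar_prod_diff_le[OF Y R(3) j D[OF f(2)] D[OF f0(2)]]
            by (simp add: game_def a_def b_def)
          then have "\<bar>h j\<bar> * \<bar>game \<eta>' \<xi>' j - game \<eta> \<xi> j\<bar> \<le> \<bar>h j\<bar> * (R * a + R * b)"
            by (intro mult_left_mono) auto
          then show "- h j * (game \<eta>' \<xi>' j - game \<eta> \<xi> j) \<le> \<bar>h j\<bar> * (R * a + R * b)"
            unfolding abs_mult[symmetric] by linarith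
        qed
        also have "\<dots> = M * (a + b)"
          by (simp add: M_def sum_distrib_right distrib_left sum.distrib mult.assoc)
        finally show ?thesis .
      qed
      then have "t * (- E) \<le> t * (M * (a + b))" using t by (intro mult_left_mono) auto
      then have tE: "- (t * E) \<le> a * (t * M) + b * (t * M)" by (simp add: algebra_simps)
      \<comment> \<open>The weight \<open>2 / \<gamma>\<close> makes the square on the right exactly
        the quadratic growth \<open>\<gamma> / 8\<close> available to each player.\<close>
      have yng: "z * (t * M) \<le> \<gamma> / 8 * z\<^sup>2 + t\<^sup>2 * (2 * M\<^sup>2 / \<gamma>)" for z
        using mult_le_weighted_squares[of "2 / \<gamma>" "t * M" "(t * M)\<^sup>2" "t\<^sup>2 * (2 * M\<^sup>2 / \<gamma>)" z] \<gamma>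
        by (simp add: power_mult_distrib mult_ac)
      have "reg_payoff X Y \<gamma> w \<eta> \<xi> + \<gamma> / 8 * (a\<^sup>2 + b\<^sup>2) \<le> reg_payoff X Y \<gamma> w \<eta>' \<xi>'"
        unfolding a_def b_def by (rule optimal_solution_quadratic_growth[OF opt f])
      moreover have "\<gamma> / 8 * (a\<^sup>2 + b\<^sup>2) = \<gamma> / 8 * a\<^sup>2 + \<gamma> / 8 * b\<^sup>2" by (simp add: distrib_left)
      moreover have "t\<^sup>2 * C = t\<^sup>2 * (2 * M\<^sup>2 / \<gamma>) + t\<^sup>2 * (2 * M\<^sup>2 / \<gamma>) + t\<^sup>2 * (S / 2)"
        by (simp add: C_def algebra_simps)
      ultimately show ?thesis using diff tE yng[of a] yng[of b] by linarith
    qed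
    then have "reg_payoff X Y \<gamma> w \<eta> \<xi> + t * S - t\<^sup>2 * C
        \<le> (INF (\<eta>', \<xi>') \<in> feasible P n\<^sub>1 \<times> feasible P n\<^sub>2. reg_payoff X Y \<gamma> w' \<eta>' \<xi>')"
      by (intro cINF_greatest) (use f0 in auto)
    then show ?thesis using max[OF w'] by linarith
  qed
  have "S = 0"
  proof (rule ccontr)
    assume "S \<noteq> 0"
    then have S: "0 < S" using S0 by simp
    \<comment> \<open>Any positive \<open>t\<close> with \<open>t * C < S\<close> refutes
      \<open>tS\<close>; adding 1 to \<open>C\<close> avoids a division by zero.\<close>
    define t where "t = S / 2 / (C + 1)"
    have t: "0 < t" using S C0 by (simp add: t_def)
    have "t * S \<le> t * (t * C)" using tS[OF t] by (simp add: power2_eq_square mult.assoc)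
    then have "S \<le> t * C" using t by simp
    also have "\<dots> \<le> t * (C + 1)" using t by simp
    also have "\<dots> = S / 2"
      using C0 by (simp add: t_def nonzero_eq_divide_eq[symmetric] del: divide_divide_eq_left)
    finally show False using S by simp
  qed
  then have "\<forall>j<d. (h j)\<^sup>2 = 0" unfolding S_def by (subst (asm) sum_nonneg_eq_0_iff) auto
  then show ?thesis using \<open>j < d\<close> by (simp add: h_def)
qed

end

section \<open>The random rotation\<close>

lemma walsh_hadamard_carrier [simp]: "walsh_hadamard m \<in> carrier_mat (2 ^ m) (2 ^ m)"
  by (induction m) (auto simp: mult_2)

lemma walsh_hadamard_symmetric: "transpose_mat (walsh_hadamard m) = walsh_hadamard m"
proof (induction m)
  case (Suc m)
  define W where "W = walsh_hadamard m"
  have W: "W \<in> carrier_mat (2 ^ m) (2 ^ m)" by (simp add: W_def)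
  have "transpose_mat (four_block_mat W W W (- W)) = four_block_mat W W W (- W)"
    using W Suc by (subst transpose_four_block_mat[of _ "2^m" "2^m" _ "2^m" _ "2^m"]) (auto simp: W_def transpose_uminus)
  moreover have "transpose_mat (r \<cdot>\<^sub>m M) = r \<cdot>\<^sub>m transpose_mat M" for r :: real and M
    by (rule eq_matI) auto
  ultimately show ?case by (simp add: W_def)
qed simp

lemma walsh_hadamard_involution: "walsh_hadamard m * walsh_hadamard m = 1\<^sub>m (2 ^ m)"
proof (induction m)
  case (Suc m)
  define W where "W = walsh_hadamard m"
  have W: "W \<in> carrier_mat (2 ^ m) (2 ^ m)" by (simp add: W_def)
  have WW: "W * W = 1\<^sub>m (2 ^ m)" using Suc by (simp add: W_def)
  define F where "F = four_block_mat W W W (- W)"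
  have F: "F \<in> carrier_mat (2 ^ Suc m) (2 ^ Suc m)" using W by (auto simp: F_def mult_2)
  have n: "W * - W = - 1\<^sub>m (2 ^ m)" "- W * W = - 1\<^sub>m (2 ^ m)" "- W * - W = 1\<^sub>m (2 ^ m)"
    using W WW by auto
  have "F * F = four_block_mat (1\<^sub>m (2 ^ m) + 1\<^sub>m (2 ^ m)) (1\<^sub>m (2 ^ m) + - 1\<^sub>m (2 ^ m))
      (1\<^sub>m (2 ^ m) + - 1\<^sub>m (2 ^ m)) (1\<^sub>m (2 ^ m) + 1\<^sub>m (2 ^ m))"
    unfolding F_def using W
    by (subst mult_four_block_mat[of _ "2^m" "2^m" _ "2^m" _ "2^m" _ _ "2^m" _ "2^m"]) (auto simp: WW n)
  also have "\<dots> = 2 \<cdot>\<^sub>m 1\<^sub>m (2 ^ Suc m)"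
    by (rule eq_matI) (auto simp: four_block_mat_def Let_def)
  finally have FF: "F * F = 2 \<cdot>\<^sub>m 1\<^sub>m (2 ^ Suc m)" .
  have "walsh_hadamard (Suc m) * walsh_hadamard (Suc m) = (1 / sqrt 2) \<cdot>\<^sub>m ((1 / sqrt 2) \<cdot>\<^sub>m (F * F))"
    using F by (simp add: F_def[symmetric] W_def[symmetric] mult_smult_assoc_mat[of _ "2 ^ Suc m" "2 ^ Suc m"]
        mult_smult_distrib[of _ "2 ^ Suc m" "2 ^ Suc m"])
  also have "\<dots> = 1\<^sub>m (2 ^ Suc m)"
    unfolding FF by (rule eq_matI) auto
  finally show ?case .
qed simp

lemma walsh_hadamard_entry: "i < 2 ^ m \<Longrightarrow> j < 2 ^ m \<Longrightarrow> (walsh_hadamard m $$ (i, j))\<^sup>2 = 1 / 2 ^ m"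
proof (induction m arbitrary: i j)
  case (Suc m)
  have d: "dim_row (walsh_hadamard m) = 2 ^ m" "dim_col (walsh_hadamard m) = 2 ^ m"
    using walsh_hadamard_carrier[of m] by blast+
  show ?case
    using Suc by (auto simp: d four_block_mat_def Let_def power_divide)
qed simp

lemma rotation_carrier [simp]: "rotation m s \<in> carrier_mat (2 ^ m) (2 ^ m)"
  unfolding rotation_def by (rule mult_carrier_mat[of _ _ "2 ^ m"]) simp_all

lemma random_signs_range: "s \<in> set_pmf (random_signs d) \<Longrightarrow> i < d \<Longrightarrow> s i = 1 \<or> s i = - 1"
  by (auto simp: random_signs_def set_Pi_pmf PiE_dflt_def)

text \<open>Both factors are symmetric involutions, the diagonal one because its entries are signs;
  so the transpose is the product in reverse order.\<close>

lemma rotation_orthogonal: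
  assumes "s \<in> set_pmf (random_signs (2 ^ m))"
  shows "rotation m s * transpose_mat (rotation m s) = 1\<^sub>m (2 ^ m)"
    and "transpose_mat (rotation m s) * rotation m s = 1\<^sub>m (2 ^ m)"
proof -
  define W where "W = walsh_hadamard m"
  define S where "S = mat_diag (2 ^ m) s"
  have W: "W \<in> carrier_mat (2 ^ m) (2 ^ m)" by (simp add: W_def)
  have S: "S \<in> carrier_mat (2 ^ m) (2 ^ m)" by (simp add: S_def)
  have SS: "S * S = 1\<^sub>m (2 ^ m)"
    unfolding S_def mat_diag_diag using random_signs_range[OF assms]
    by (intro eq_matI) (force simp: mat_diag_def)+
  have St: "transpose_mat S = S" by (intro eq_matI) (auto simp: S_def mat_diag_def)
  have Q: "rotation m s = W * S" "transpose_mat (rotation m s) = S * W"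
    using W S by (simp_all add: rotation_def W_def[symmetric] S_def[symmetric] transpose_mult[of _ "2^m" "2^m"] St
        walsh_hadamard_symmetric[of m, folded W_def])
  have WW: "W * W = 1\<^sub>m (2 ^ m)" by (simp add: W_def walsh_hadamard_involution)
  have "W * S * (S * W) = W * (S * S) * W"
    using W S by (simp add: assoc_mult_mat[of _ "2^m" "2^m" _ "2^m" _ "2^m"])
  also have "\<dots> = 1\<^sub>m (2 ^ m)" using W by (simp add: SS WW)
  finally show "rotation m s * transpose_mat (rotation m s) = 1\<^sub>m (2 ^ m)" unfolding Q(2) unfolding Q(1) .
  have "S * W * (W * S) = S * (W * W) * S"
    using W S by (simp add: assoc_mult_mat[of _ "2^m" "2^m" _ "2^m" _ "2^m"])
  also have "\<dots> = 1\<^sub>m (2 ^ m)" using S by (simp add: SS WW)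
  finally show "transpose_mat (rotation m s) * rotation m s = 1\<^sub>m (2 ^ m)" unfolding Q(2) unfolding Q(1) .
qed

section \<open>Invariance of the problem under orthogonal matrices\<close>

lemma scalar_prod_rotated:
  fixes Q M :: "real Matrix.mat"
  assumes "Q \<in> carrier_mat d d" "M \<in> carrier_mat d m" "w \<in> carrier_vec d" "u \<in> carrier_vec m"
  shows "w \<bullet> (Q * M *\<^sub>v u) = (transpose_mat Q *\<^sub>v w) \<bullet> (M *\<^sub>v u)"
  using assms by (simp add: assoc_mult_mat_vec[of _ d d _ m] transpose_vec_mult_scalar[of _ d d])

locale rotated_svm =
  fixes Q A B :: "real Matrix.mat" and d n\<^sub>1 n\<^sub>2 :: nat
  assumes Q: "Q \<in> carrier_mat d d" and orth: "Q * transpose_mat Q = 1\<^sub>m d" "transpose_mat Q * Q = 1\<^sub>m d"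
    and A: "A \<in> carrier_mat d n\<^sub>1" and B: "B \<in> carrier_mat d n\<^sub>2"
begin

lemma transpose_carrier: "w \<in> carrier_vec d \<Longrightarrow> transpose_mat Q *\<^sub>v w \<in> carrier_vec d"
  using Q by simp

lemma transpose_mult_cancel: "w \<in> carrier_vec d \<Longrightarrow> transpose_mat Q *\<^sub>v (Q *\<^sub>v w) = w"
  using Q by (simp add: assoc_mult_mat_vec[of _ d d _ d, symmetric] orth)

lemma scalar_prod_self_rotated:
  assumes "w \<in> carrier_vec d"
  shows "(transpose_mat Q *\<^sub>v w) \<bullet> (transpose_mat Q *\<^sub>v w) = w \<bullet> w"
proof -
  have "(transpose_mat Q *\<^sub>v w) \<bullet> (transpose_mat Q *\<^sub>v w) = w \<bullet> (Q *\<^sub>v (transpose_mat Q *\<^sub>v w))"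
    by (rule transpose_vec_mult_scalar[OF Q transpose_carrier[OF assms] assms])
  then show ?thesis
    using Q assms by (simp add: assoc_mult_mat_vec[of _ d d _ d, symmetric] orth)
qed

lemma payoff_rotated:
  assumes w: "w \<in> carrier_vec d" and f: "\<eta> \<in> feasible P n\<^sub>1" "\<xi> \<in> feasible P n\<^sub>2"
  shows "payoff (Q * A) (Q * B) w \<eta> \<xi> = payoff A B (transpose_mat Q *\<^sub>v w) \<eta> \<xi>"
    and "reg_payoff (Q * A) (Q * B) \<gamma> w \<eta> \<xi> = reg_payoff A B \<gamma> (transpose_mat Q *\<^sub>v w) \<eta> \<xi>"
  using scalar_prod_rotated[OF Q A w] scalar_prod_rotated[OF Q B w] scalar_prod_self_rotated[OF w]
    prob_simplexD(1)[OF feasible_prob_simplex[OF f(1)]] prob_simplexD(1)[OF feasible_prob_simplex[OF f(2)]]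
  by (simp_all add: payoff_def reg_payoff_def)

lemma dims_rotated: "dim_row (Q * A) = d" "dim_col (Q * A) = n\<^sub>1" "dim_col (Q * B) = n\<^sub>2"
  "dim_row A = d" "dim_col A = n\<^sub>1" "dim_col B = n\<^sub>2"
  using Q A B by auto

lemma saddle_value_rotated:
  assumes w: "w \<in> carrier_vec d"
  shows "saddle_value P (Q * A) (Q * B) w = saddle_value P A B (transpose_mat Q *\<^sub>v w)"
  unfolding saddle_value_def dims_rotated
  by (intro INF_cong refl) (auto simp: payoff_rotated[OF w])

lemma optimal_solution_rotated:
  assumes "optimal_solution P A B \<gamma> w \<eta> \<xi>"
  shows "optimal_solution P (Q * A) (Q * B) \<gamma> (Q *\<^sub>v w) \<eta> \<xi>"
proof -
  have w: "w \<in> carrier_vec d" and f: "\<eta> \<in> feasible P n\<^sub>1" "\<xi> \<in> feasible P n\<^sub>2"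
    and min: "\<And>\<eta>' \<xi>'. \<eta>' \<in> feasible P n\<^sub>1 \<Longrightarrow> \<xi>' \<in> feasible P n\<^sub>2 \<Longrightarrow>
        reg_payoff A B \<gamma> w \<eta> \<xi> \<le> reg_payoff A B \<gamma> w \<eta>' \<xi>'"
    and max: "\<And>w'. w' \<in> carrier_vec d \<Longrightarrow> (INF (\<eta>', \<xi>') \<in> feasible P n\<^sub>1 \<times> feasible P n\<^sub>2. reg_payoff A B \<gamma> w' \<eta>' \<xi>')
          \<le> reg_payoff A B \<gamma> w \<eta> \<xi>"
    using assms unfolding optimal_solution_def dims_rotated by auto
  have Qw: "Q *\<^sub>v w \<in> carrier_vec d" using Q w by simp
  have R: "reg_payoff (Q * A) (Q * B) \<gamma> (Q *\<^sub>v w) \<eta>' \<xi>' = reg_payoff A B \<gamma> w \<eta>' \<xi>'"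
    if "\<eta>' \<in> feasible P n\<^sub>1" "\<xi>' \<in> feasible P n\<^sub>2" for \<eta>' \<xi>'
    using payoff_rotated(2)[OF Qw that] by (simp add: transpose_mult_cancel[OF w])
  show ?thesis
    unfolding optimal_solution_def dims_rotated
  proof (intro conjI ballI Qw f)
    fix \<eta>' \<xi>' assume "\<eta>' \<in> feasible P n\<^sub>1" "\<xi>' \<in> feasible P n\<^sub>2"
    then show "reg_payoff (Q * A) (Q * B) \<gamma> (Q *\<^sub>v w) \<eta> \<xi> \<le> reg_payoff (Q * A) (Q * B) \<gamma> (Q *\<^sub>v w) \<eta>' \<xi>'"
      using min by (simp add: R f)
  next
    fix w' :: "real Matrix.vec" assume w': "w' \<in> carrier_vec d"
    have "(INF (\<eta>', \<xi>') \<in> feasible P n\<^sub>1 \<times> feasible P n\<^sub>2. reg_payoff (Q * A) (Q * B) \<gamma> w' \<eta>' \<xi>')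
      = (INF (\<eta>', \<xi>') \<in> feasible P n\<^sub>1 \<times> feasible P n\<^sub>2. reg_payoff A B \<gamma> (transpose_mat Q *\<^sub>v w') \<eta>' \<xi>')"
      by (intro INF_cong refl) (auto simp: payoff_rotated(2)[OF w'])
    also have "\<dots> \<le> reg_payoff A B \<gamma> w \<eta> \<xi>" by (rule max[OF transpose_carrier[OF w']])
    finally show "(INF (\<eta>', \<xi>') \<in> feasible P n\<^sub>1 \<times> feasible P n\<^sub>2. reg_payoff (Q * A) (Q * B) \<gamma> w' \<eta>' \<xi>')
        \<le> reg_payoff (Q * A) (Q * B) \<gamma> (Q *\<^sub>v w) \<eta> \<xi>"
      by (simp add: R f)
  qed
qed

end

section \<open>Concentration of the rotated entries\<close>

lemma random_signs_sum_tail: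
  fixes a :: "nat \<Rightarrow> real"
  assumes t: "0 \<le> t" and V: "0 < V" "(\<Sum>l<d. (a l)\<^sup>2) \<le> V"
  shows "measure_pmf.prob (random_signs d) {s. t < \<bar>\<Sum>l<d. a l * s l\<bar>} \<le> 2 * exp (- (t\<^sup>2 / (2 * V)))"
proof (cases "(\<Sum>l<d. (a l)\<^sup>2) = 0")
  \<comment> \<open>Hoeffding's inequality needs a positive sum of squared ranges; here the random
    sum vanishes identically.\<close>
  case True
  then have "\<forall>l<d. a l = 0" by (subst (asm) sum_nonneg_eq_0_iff) auto
  then have "{s. t < \<bar>\<Sum>l<d. a l * s l\<bar>} = {}" using t by auto
  then show ?thesis by simp
next
  case False
  define S where "S = (\<Sum>l<d. (a l)\<^sup>2)"
  have "0 \<le> S" by (simp add: S_def sum_nonneg)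
  then have S: "0 < S" using False by (simp add: S_def)
  have mean: "measure_pmf.expectation (random_signs d) (\<lambda>s. a l * s l) = 0" if "l < d" for l
  proof -
    have "measure_pmf.expectation (random_signs d) (\<lambda>s. a l * s l)
        = measure_pmf.expectation (map_pmf (\<lambda>s. s l) (random_signs d)) (\<lambda>x. a l * x)"
      by simp
    also have "map_pmf (\<lambda>s. s l) (random_signs d) = pmf_of_set {1, -1}"
      using that by (simp add: random_signs_def Pi_pmf_component)
    also have "measure_pmf.expectation \<dots> (\<lambda>x. a l * x) = 0"
      by (subst integral_pmf_of_set) auto
    finally show ?thesis .
  qed
  interpret Hoeffding_ineq "measure_pmf (random_signs d)" "{..<d}" "\<lambda>l s. a l * s l"
    "\<lambda>l. - \<bar>a l\<bar>" "\<lambda>l. \<bar>a l\<bar>" 0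
  proof unfold_locales
    show "prob_space.indep_vars (measure_pmf (random_signs d)) (\<lambda>_. borel) (\<lambda>l s. a l * s l) {..<d}"
      unfolding random_signs_def
      by (intro prob_space.indep_vars_compose2[OF _ indep_vars_Pi_pmf, of _ _ _ "\<lambda>l x. a l * x"])
         (auto simp: measure_pmf.prob_space_axioms)
    show "AE s in measure_pmf (random_signs d). a l * s l \<in> {- \<bar>a l\<bar>..\<bar>a l\<bar>}" if "l \<in> {..<d}" for l
    proof (rule AE_pmfI)
      fix s assume "s \<in> set_pmf (random_signs d)"
      then have "s l = 1 \<or> s l = -1" using that random_signs_range by simp
      then show "a l * s l \<in> {- \<bar>a l\<bar>..\<bar>a l\<bar>}" by auto
    qed
    have "(\<Sum>l<d. measure_pmf.expectation (random_signs d) (\<lambda>s. a l * s l)) = 0"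
      by (rule sum.neutral) (use mean in blast)
    then show "0 \<equiv> \<Sum>l<d. measure_pmf.expectation (random_signs d) (\<lambda>s. a l * s l)"
      by (rule eq_reflection[OF sym])
  qed auto
  have ba: "(\<Sum>l<d. (\<bar>a l\<bar> - - \<bar>a l\<bar>)\<^sup>2) = 4 * S"
    by (simp add: S_def sum_distrib_left power_mult_distrib flip: mult_2)
  have "measure_pmf.prob (random_signs d) {s. t < \<bar>\<Sum>l<d. a l * s l\<bar>}
      \<le> measure_pmf.prob (random_signs d) {s \<in> space (measure_pmf (random_signs d)). t \<le> \<bar>(\<Sum>l<d. a l * s l) - 0\<bar>}"
    by (intro measure_pmf.finite_measure_mono) auto
  also have "\<dots> \<le> 2 * exp (- 2 * t\<^sup>2 / (4 * S))"
    using Hoeffding_ineq_abs_ge[OF t] S unfolding ba by simp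
  also have "\<dots> \<le> 2 * exp (- (t\<^sup>2 / (2 * V)))"
  proof -
    have "t\<^sup>2 / (2 * V) \<le> t\<^sup>2 / (2 * S)"
      using S V by (intro divide_left_mono) (auto simp: S_def)
    then show ?thesis by simp
  qed
  finally show ?thesis .
qed

lemma rotation_entry:
  assumes M: "M \<in> carrier_mat (2 ^ m) n" and ij: "i < 2 ^ m" "j < n"
  shows "(rotation m s * M) $$ (i, j) = (\<Sum>l<2 ^ m. (walsh_hadamard m $$ (i, l) * M $$ (l, j)) * s l)"
proof -
  have W: "dim_row (walsh_hadamard m) = 2 ^ m" "dim_col (walsh_hadamard m) = 2 ^ m"
    using walsh_hadamard_carrier[of m] by blast+
  have "rotation m s $$ (i, l) = walsh_hadamard m $$ (i, l) * s l" if "l < 2 ^ m" for l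
    unfolding rotation_def using that ij by (simp add: mat_diag_mult_right[of _ "2 ^ m"])
  moreover have "dim_row (rotation m s) = 2 ^ m" "dim_col (rotation m s) = 2 ^ m"
    using rotation_carrier[of m s] by blast+
  ultimately show ?thesis
    using M ij by (simp add: scalar_prod_def atLeast0LessThan mult_ac)
qed

text \<open>All entries of the Walsh-Hadamard matrix have the same square, so the coefficients of
  the signs have square sum at most \<open>1 / 2 ^ m\<close>, however the mass of the column is
  distributed. A union bound over the entries follows.\<close>

lemma entries_tail:
  assumes M: "M \<in> carrier_mat (2 ^ m) n" and cols: "\<And>x. x \<in> set (cols M) \<Longrightarrow> x \<bullet> x \<le> 1"
    and t: "0 \<le> t"
  shows "measure_pmf.prob (random_signs (2 ^ m)) {s. \<not> entries_bounded t (rotation m s * M)}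
    \<le> 2 ^ m * real n * (2 * exp (- (t\<^sup>2 * 2 ^ m / 2)))"
proof -
  let ?p = "random_signs (2 ^ m)"
  let ?I = "{..<(2::nat) ^ m} \<times> {..<n}"
  let ?E = "\<lambda>(i, j). {s. t < \<bar>\<Sum>l<2 ^ m. (walsh_hadamard m $$ (i, l) * M $$ (l, j)) * s l\<bar>}"
  have "{s. \<not> entries_bounded t (rotation m s * M)} \<subseteq> (\<Union>x\<in>?I. ?E x)"
  proof
    fix s assume "s \<in> {s. \<not> entries_bounded t (rotation m s * M)}"
    then obtain i j where ij: "i < 2 ^ m" "j < n" "t < \<bar>(rotation m s * M) $$ (i, j)\<bar>"
      using M rotation_carrier[of m s] by (auto simp: entries_bounded_def not_le)
    then show "s \<in> (\<Union>x\<in>?I. ?E x)"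
      using rotation_entry[OF M ij(1,2), of s] by auto
  qed
  then have "measure_pmf.prob ?p {s. \<not> entries_bounded t (rotation m s * M)}
      \<le> measure_pmf.prob ?p (\<Union>x\<in>?I. ?E x)"
    by (intro measure_pmf.finite_measure_mono) auto
  also have "\<dots> \<le> (\<Sum>x\<in>?I. measure_pmf.prob ?p (?E x))"
    by (intro measure_pmf.finite_measure_subadditive_finite) auto
  also have "\<dots> \<le> (\<Sum>x\<in>?I. 2 * exp (- (t\<^sup>2 * 2 ^ m / 2)))"
  proof (intro sum_mono)
    fix x assume "x \<in> ?I"
    then obtain i j where x: "x = (i, j)" and i: "i < 2 ^ m" and j: "j < n" by auto
    have "(\<Sum>l<2 ^ m. (walsh_hadamard m $$ (i, l) * M $$ (l, j))\<^sup>2) = (\<Sum>l<2 ^ m. (M $$ (l, j))\<^sup>2) / 2 ^ m"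
      unfolding sum_divide_distrib using i
      by (intro sum.cong refl) (simp add: power_mult_distrib walsh_hadamard_entry)
    also have "(\<Sum>l<2 ^ m. (M $$ (l, j))\<^sup>2) = Matrix.col M j \<bullet> Matrix.col M j"
      using M j by (simp add: scalar_prod_def atLeast0LessThan power2_eq_square)
    also have "\<dots> \<le> 1"
      using M j by (intro cols) (auto simp: cols_def)
    finally have V: "(\<Sum>l<2 ^ m. (walsh_hadamard m $$ (i, l) * M $$ (l, j))\<^sup>2) \<le> 1 / 2 ^ m"
      by (simp add: divide_right_mono)
    show "measure_pmf.prob ?p (?E x) \<le> 2 * exp (- (t\<^sup>2 * 2 ^ m / 2))"
      using random_signs_sum_tail[OF t _ V] by (simp add: x)
  qed
  also have "\<dots> = 2 ^ m * real n * (2 * exp (- (t\<^sup>2 * 2 ^ m / 2)))"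
    by (simp add: card_cartesian_product)
  finally show ?thesis .
qed

text \<open>\<open>ce\<close> is chosen so that the exponent in the tail is
  \<open>(c + 2) * ln N\<close>. One power of \<open>N\<close> pays for the number of points, the
  other, being at least 2, for the two-sided tail.\<close>

lemma prob_entries_bounded:
  fixes c :: nat and ce :: real
  assumes A: "A \<in> carrier_mat (2 ^ m) n\<^sub>1" and B: "B \<in> carrier_mat (2 ^ m) n\<^sub>2" and n: "1 \<le> n\<^sub>1" "1 \<le> n\<^sub>2"
    and pts: "\<And>x. x \<in> points A B \<Longrightarrow> x \<bullet> x \<le> 1"
    and ce: "ce = sqrt (2 * (real c + 2))"
  defines "r \<equiv> ce * sqrt (ln (real (n\<^sub>1 + n\<^sub>2)) / real (2 ^ m))"
  shows "1 - real (2 ^ m) / real (n\<^sub>1 + n\<^sub>2) ^ c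
    \<le> measure_pmf.prob (random_signs (2 ^ m))
        {s. entries_bounded r (rotation m s * A) \<and> entries_bounded r (rotation m s * B)}"
proof -
  let ?p = "random_signs (2 ^ m)"
  define N where "N = real (n\<^sub>1 + n\<^sub>2)"
  have N: "2 \<le> N" using n by (simp add: N_def)
  have r0: "0 \<le> r" using N by (simp add: r_def ce N_def)
  have "r\<^sup>2 = 2 * (real c + 2) * (ln N / 2 ^ m)"
    unfolding r_def ce N_def[symmetric] using N by (simp add: power_mult_distrib)
  then have "r\<^sup>2 * 2 ^ m / 2 = (real c + 2) * ln N" by simp
  then have "exp (- (r\<^sup>2 * 2 ^ m / 2)) = inverse (exp (real (c + 2) * ln N))"
    by (simp add: exp_minus)
  also have "exp (real (c + 2) * ln N) = N ^ (c + 2)"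
    using N by (simp only: exp_of_nat_mult) simp
  finally have e: "exp (- (r\<^sup>2 * 2 ^ m / 2)) = inverse (N ^ (c + 2))" .
  have tA: "measure_pmf.prob ?p {s. \<not> entries_bounded r (rotation m s * A)}
      \<le> 2 ^ m * real n\<^sub>1 * (2 * inverse (N ^ (c + 2)))"
    using entries_tail[OF A _ r0] pts unfolding e by (auto simp: points_def)
  have tB: "measure_pmf.prob ?p {s. \<not> entries_bounded r (rotation m s * B)}
      \<le> 2 ^ m * real n\<^sub>2 * (2 * inverse (N ^ (c + 2)))"
    using entries_tail[OF B _ r0] pts unfolding e by (auto simp: points_def)
  have "measure_pmf.prob ?p (- {s. entries_bounded r (rotation m s * A) \<and> entries_bounded r (rotation m s * B)})
      \<le> measure_pmf.prob ?p ({s. \<not> entries_bounded r (rotation m s * A)} \<union> {s. \<not> entries_bounded r (rotation m s * B)})"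
    by (intro measure_pmf.finite_measure_mono) auto
  also have "\<dots> \<le> measure_pmf.prob ?p {s. \<not> entries_bounded r (rotation m s * A)}
      + measure_pmf.prob ?p {s. \<not> entries_bounded r (rotation m s * B)}"
    by (rule measure_Un_le) auto
  also have "\<dots> \<le> 2 ^ m * N * (2 * inverse (N ^ (c + 2)))"
    using add_mono[OF tA tB] by (simp add: N_def algebra_simps)
  also have "\<dots> = 2 / N * (2 ^ m / N ^ c)"
    using N by (simp add: field_simps)
  also have "\<dots> \<le> 1 * (2 ^ m / N ^ c)"
    using N by (intro mult_right_mono) auto
  finally show ?thesis
    using measure_pmf.prob_compl[of "{s. entries_bounded r (rotation m s * A) \<and> entries_bounded r (rotation m s * B)}" ?p]
    by (simp add: N_def Compl_eq_Diff_UNIV)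
qed

section \<open>The number of iterations\<close>

lemma ln_nat_bounds:
  assumes "2 \<le> n"
  shows "1 / 2 \<le> ln (real n)" "ln (real n) \<le> real n"
proof -
  have "(2 / 3 :: real) \<le> ln 2" by (rule ln2_ge_two_thirds)
  also have "ln 2 \<le> ln (real n)" using assms by simp
  finally show "1 / 2 \<le> ln (real n)" by simp
  show "ln (real n) \<le> real n" using ln_le_minus_one[of "real n"] assms by simp
qed

lemma log_factor_ge:
  assumes "1 \<le> d" "1 \<le> n" "0 < \<epsilon>" "\<epsilon> \<le> 1" "0 < \<beta>" "\<beta> \<le> 1" "0 \<le> opt"
  shows "1 + ln (real n) \<le> log_factor d n \<epsilon> \<beta> opt"
proof -
  have "0 \<le> ln (real d)" "0 \<le> ln (1 / \<epsilon>)" "0 \<le> ln (1 / \<beta>)" "0 \<le> ln (1 + 1 / opt)"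
    using assms by (auto intro!: ln_ge_zero)
  then show ?thesis by (simp add: log_factor_def)
qed

locale rate_parameters =
  fixes d n :: nat and \<epsilon> \<beta> opt cq ce \<gamma> q :: real
  assumes d: "1 \<le> d" and n: "2 \<le> n" and \<epsilon>: "0 < \<epsilon>" "\<epsilon> < 1" and \<beta>: "0 < \<beta>" "\<beta> \<le> 1" and opt: "0 < opt"
    and cq: "0 < cq" and ce: "0 < ce"
    and \<gamma>_eq: "\<gamma> = \<epsilon> * \<beta> / (2 * ln (real n))" and q_eq: "q = cq * sqrt (ln (real n))"
begin

abbreviation "N \<equiv> real n"
definition "G = d + q * sqrt d / sqrt \<gamma>"
definition "x = d / (\<epsilon> * \<beta>)"
definition "L = log_factor d n \<epsilon> \<beta> opt"
definition "K1 = 2 * (4 * ce\<^sup>2 + 1) * (4 * ce\<^sup>2 + 6)"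
text \<open>In the logarithm, 4 stems from \<open>1 / \<kappa>\<^sup>2\<close> and
  \<open>1 + 2 * cq\<close> from \<open>G_le_x\<close>; the summand 3 is the largest coefficient of
  a logarithm in \<open>ln_ratio_le\<close>.\<close>

definition "K2 = ln (4 * K1 * (1 + 2 * cq)) + 3"
text \<open>A smooth substitute for the minimum of \<open>\<epsilon> * opt / 2\<close> and
  \<open>\<epsilon> / 2\<close>; its reciprocal contains the factor \<open>1 + 1 / opt\<close> whose
  logarithm is in \<open>log_factor\<close>.\<close>

definition "\<kappa> = \<epsilon> / 2 * (opt / (1 + opt))"

lemma lnN: "1 / 2 \<le> ln N" "ln N \<le> N"
  using ln_nat_bounds n by auto

lemma pos: "0 < \<gamma>" "0 < q" "0 < ln N"
proof -
  show ln: "0 < ln N" using lnN by linarith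
  show "0 < \<gamma>" "0 < q" using ln \<epsilon> \<beta> cq unfolding \<gamma>_eq q_eq by simp_all
qed

lemma \<epsilon>\<beta>: "0 < \<epsilon> * \<beta>" "\<epsilon> * \<beta> \<le> 1"
  using \<epsilon> \<beta> by (auto intro: mult_le_one)

lemma \<gamma>_le: "\<gamma> \<le> 1"
proof -
  have "\<epsilon> * \<beta> \<le> 2 * ln N" using \<epsilon>\<beta> lnN by linarith
  then show ?thesis using pos by (simp add: \<gamma>_eq)
qed

lemma x_ge: "1 \<le> x" "d \<le> x" "sqrt x \<le> x"
proof -
  have "real d * (\<epsilon> * \<beta>) \<le> real d * 1" using \<epsilon>\<beta> by (intro mult_left_mono) auto
  then show "d \<le> x" using \<epsilon>\<beta> by (simp add: x_def field_simps)
  then show "1 \<le> x" using d by simp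
  then have "sqrt x * 1 \<le> sqrt x * sqrt x" by (intro mult_left_mono) auto
  then show "sqrt x \<le> x" using \<open>1 \<le> x\<close> by simp
qed

text \<open>The square roots of \<open>ln N\<close> in \<open>q\<close> and in
  \<open>1 / sqrt \<gamma>\<close> multiply to a full logarithm.\<close>

lemma G_le: "G \<le> d + 2 * cq * ln N * sqrt x"
proof -
  have "q * sqrt d / sqrt \<gamma> = cq * (sqrt (ln N) * sqrt (2 * ln N) * sqrt x)"
    using \<epsilon> \<beta> pos by (simp add: q_eq \<gamma>_eq x_def real_sqrt_divide real_sqrt_mult)
  also have "sqrt (ln N) * sqrt (2 * ln N) = sqrt 2 * ln N"
    using pos by (simp add: real_sqrt_mult)
  also have "cq * (sqrt 2 * ln N * sqrt x) \<le> cq * (2 * ln N * sqrt x)"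
    using cq pos x_ge sqrt2_less_2 by (intro mult_left_mono mult_right_mono) auto
  finally show ?thesis by (simp add: G_def mult_ac)
qed

lemma G_ge: "d \<le> G" "1 \<le> G" "0 < G"
proof -
  have "0 \<le> q * sqrt d / sqrt \<gamma>" using pos by simp
  then show "d \<le> G" by (simp add: G_def)
  then show "1 \<le> G" "0 < G" using d by auto
qed

lemma L_ge: "1 \<le> L" "ln N \<le> L"
  using log_factor_ge[of d n \<epsilon> \<beta> opt] d n \<epsilon> \<beta> opt pos unfolding L_def by linarith+

lemma G_le_x: "G \<le> (1 + 2 * cq) * N * x"
proof -
  have "2 * cq * ln N * sqrt x \<le> 2 * cq * N * x"
    using cq lnN pos x_ge by (intro mult_mono) auto
  moreover have "1 * x \<le> N * x" using x_ge n by (intro mult_right_mono) auto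
  then have "d \<le> N * x" using x_ge(2) by linarith
  moreover have "(1 + 2 * cq) * N * x = N * x + 2 * cq * N * x" by (simp add: algebra_simps)
  ultimately show ?thesis using G_le by linarith
qed

lemma G_le_L: "G \<le> (1 + 2 * cq) * (d + sqrt x) * L"
proof -
  have "2 * cq * ln N * sqrt x \<le> 2 * cq * L * sqrt x"
    using cq L_ge x_ge pos by (intro mult_mono) auto
  moreover have "real d * 1 \<le> real d * L" using L_ge by (intro mult_left_mono) auto
  moreover have "0 \<le> 2 * cq * d * L" "0 \<le> sqrt x * L" using cq L_ge x_ge by auto
  ultimately show ?thesis using G_le by (simp add: algebra_simps)
qed

lemma K1_pos: "12 \<le> K1"
proof -
  have "2 * 1 * 6 \<le> 2 * (4 * ce\<^sup>2 + 1) * (4 * ce\<^sup>2 + 6)" by (intro mult_mono) auto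
  then show ?thesis by (simp add: K1_def)
qed

lemma K2_ge: "3 \<le> K2"
proof -
  have "1 * 1 \<le> (4 * K1) * (1 + 2 * cq)" using K1_pos cq by (intro mult_mono) auto
  then show ?thesis by (simp add: K2_def)
qed

text \<open>Dimension, \<open>\<gamma>\<close> and \<open>ln N\<close> all cancel, so the step size
  condition concerns only the ratio of \<open>ce\<close> and \<open>cq\<close>; for
  \<open>cq = 8 * ce\<close> the value is 1/32.\<close>

lemma step_sizes: "step_sigma d \<gamma> q * (8 * (ce * sqrt (ln N / d))\<^sup>2) * step_tau d \<gamma> q = 2 * ce\<^sup>2 / cq\<^sup>2"
proof -
  have "step_sigma d \<gamma> q * step_tau d \<gamma> q = 1 / (4 * q\<^sup>2) * (sqrt (d * \<gamma>) * sqrt (d / \<gamma>))"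
    by (simp add: step_sigma_def step_tau_def power2_eq_square)
  also have "sqrt (d * \<gamma>) * sqrt (d / \<gamma>) = d"
    using pos by (simp add: real_sqrt_mult real_sqrt_divide)
  finally have "step_sigma d \<gamma> q * step_tau d \<gamma> q = d / (4 * cq\<^sup>2 * ln N)"
    using pos by (simp add: q_eq power_mult_distrib)
  moreover have "(ce * sqrt (ln N / d))\<^sup>2 = ce\<^sup>2 * (ln N / d)"
    using pos by (simp add: power_mult_distrib)
  moreover have "step_sigma d \<gamma> q * (8 * (ce * sqrt (ln N / d))\<^sup>2) * step_tau d \<gamma> q
      = (step_sigma d \<gamma> q * step_tau d \<gamma> q) * (8 * (ce * sqrt (ln N / d))\<^sup>2)" by simp
  ultimately show ?thesis using pos d cq by simp
qed

lemma initial_bound_le: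
  fixes n\<^sub>1 n\<^sub>2 :: nat and R :: real
  assumes "1 \<le> n\<^sub>1" "1 \<le> n\<^sub>2" "n = n\<^sub>1 + n\<^sub>2"
  defines "R \<equiv> ce * sqrt (ln N / d)"
  shows "2 * (4 * real d * R\<^sup>2 + 1) * ((1 / (2 * step_sigma d \<gamma> q) + 1) * (4 * real d * R\<^sup>2)
      + (1 / step_tau d \<gamma> q + \<gamma> / d) * (ln n\<^sub>1 + ln n\<^sub>2)) \<le> K1 * N\<^sup>2 * G"
proof -
  define s where "s = sqrt d / sqrt \<gamma>"
  have d0: "0 < real d" using d by simp
  have R: "4 * real d * R\<^sup>2 = 4 * ce\<^sup>2 * ln N"
    using d0 pos by (simp add: R_def power_mult_distrib)
  have s: "1 \<le> s"
  proof -
    have "sqrt \<gamma> \<le> sqrt d" using \<gamma>_le d by simp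
    then show ?thesis using pos by (simp add: s_def)
  qed
  have G: "G = d + q * s" by (simp add: G_def s_def)
  have sig: "1 / (2 * step_sigma d \<gamma> q) + 1 \<le> G"
  proof -
    have "1 / (2 * step_sigma d \<gamma> q) = q * s / d"
      using pos d0 by (simp add: step_sigma_def s_def real_sqrt_mult field_simps)
    also have "\<dots> \<le> q * s" using pos s d divide_left_mono[of 1 d "q * s"] by simp
    finally show ?thesis using d by (simp add: G)
  qed
  have tau: "1 / step_tau d \<gamma> q + \<gamma> / d \<le> 3 * G"
  proof -
    have "1 / step_tau d \<gamma> q = 2 * q / s"
      by (simp add: step_tau_def s_def real_sqrt_divide)
    also have "\<dots> \<le> 2 * q" using pos s by (simp add: divide_le_eq)
    also have "\<dots> \<le> 2 * q * s" using pos s by simp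
    also have "\<dots> \<le> 2 * G" by (simp add: G)
    finally have "1 / step_tau d \<gamma> q \<le> 2 * G" .
    moreover have "\<gamma> / d \<le> 1" using \<gamma>_le d pos by (simp add: divide_le_eq)
    ultimately show ?thesis using G_ge by simp
  qed
  have ln12: "0 \<le> ln n\<^sub>1" "0 \<le> ln n\<^sub>2" "ln n\<^sub>1 + ln n\<^sub>2 \<le> 2 * ln N"
  proof -
    have "ln n\<^sub>1 \<le> ln N" "ln n\<^sub>2 \<le> ln N"
      using assms(1-3) by simp_all
    then show "ln n\<^sub>1 + ln n\<^sub>2 \<le> 2 * ln N" by simp
  qed (use assms(1,2) in simp_all)
  have "(1 / (2 * step_sigma d \<gamma> q) + 1) * (4 * real d * R\<^sup>2)
      + (1 / step_tau d \<gamma> q + \<gamma> / d) * (ln n\<^sub>1 + ln n\<^sub>2)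
    \<le> G * (4 * ce\<^sup>2 * ln N) + 3 * G * (2 * ln N)"
    unfolding R using sig tau ln12 pos G_ge by (intro add_mono mult_mono) auto
  also have "\<dots> = (4 * ce\<^sup>2 + 6) * G * ln N" by (simp add: algebra_simps)
  also have "\<dots> \<le> (4 * ce\<^sup>2 + 6) * G * N"
    using lnN G_ge by (intro mult_left_mono) auto
  finally have I: "(1 / (2 * step_sigma d \<gamma> q) + 1) * (4 * real d * R\<^sup>2)
      + (1 / step_tau d \<gamma> q + \<gamma> / d) * (ln n\<^sub>1 + ln n\<^sub>2) \<le> (4 * ce\<^sup>2 + 6) * G * N" .
  have "4 * ce\<^sup>2 * ln N \<le> 4 * ce\<^sup>2 * N" using lnN by (intro mult_left_mono) auto
  then have J: "2 * (4 * real d * R\<^sup>2 + 1) \<le> 2 * (4 * ce\<^sup>2 + 1) * N"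
    unfolding R using n by (simp add: algebra_simps)
  have "2 * (4 * real d * R\<^sup>2 + 1) * ((1 / (2 * step_sigma d \<gamma> q) + 1) * (4 * real d * R\<^sup>2)
      + (1 / step_tau d \<gamma> q + \<gamma> / d) * (ln n\<^sub>1 + ln n\<^sub>2))
    \<le> 2 * (4 * real d * R\<^sup>2 + 1) * ((4 * ce\<^sup>2 + 6) * G * N)"
    using I by (intro mult_left_mono) auto
  also have "\<dots> \<le> (2 * (4 * ce\<^sup>2 + 1) * N) * ((4 * ce\<^sup>2 + 6) * G * N)"
    using J G_ge by (intro mult_right_mono) auto
  also have "\<dots> = K1 * N\<^sup>2 * G" by (simp add: K1_def power2_eq_square mult_ac)
  finally show ?thesis .
qed

lemma \<kappa>_bounds: "0 < \<kappa>" "\<kappa> \<le> \<epsilon> * opt / 2" "\<kappa> \<le> 1"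
proof -
  show "0 < \<kappa>" using \<epsilon> opt by (simp add: \<kappa>_def)
  have "opt / (1 + opt) \<le> opt" "opt / (1 + opt) \<le> 1" using opt by (auto simp: divide_le_eq)
  then have "\<kappa> \<le> \<epsilon> / 2 * opt" "\<kappa> \<le> \<epsilon> / 2 * 1" using \<epsilon> unfolding \<kappa>_def by (intro mult_left_mono; simp)+
  then show "\<kappa> \<le> \<epsilon> * opt / 2" "\<kappa> \<le> 1" using \<epsilon> by auto
qed

lemma ln_ratio_le: "ln (K1 * N\<^sup>2 * G / \<kappa>\<^sup>2) \<le> K2 * L"
proof -
  define K where "K = 4 * K1 * (1 + 2 * cq)"
  have K: "1 \<le> K" using K1_pos cq mult_mono[of 1 "4 * K1" 1 "1 + 2 * cq"] by (simp add: K_def)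
  have inv: "1 / \<kappa> = 2 * (1 / \<epsilon>) * (1 + 1 / opt)"
    using \<epsilon> opt by (simp add: \<kappa>_def field_simps)
  have o: "0 < 1 + 1 / opt" using opt by (simp add: add_pos_pos)
  have "K1 * N\<^sup>2 * G / \<kappa>\<^sup>2 = K1 * N\<^sup>2 * G * (1 / \<kappa>)\<^sup>2" by (simp add: power_divide)
  also have "\<dots> \<le> K1 * N\<^sup>2 * ((1 + 2 * cq) * N * x) * (1 / \<kappa>)\<^sup>2"
    using G_le_x K1_pos by (intro mult_right_mono mult_left_mono) auto
  also have "\<dots> = K * N ^ 3 * x * (1 / \<epsilon>)\<^sup>2 * (1 + 1 / opt)\<^sup>2"
  proof -
    have "K1 * N\<^sup>2 * ((1 + 2 * cq) * N * x) * (2 * a * b)\<^sup>2 = K * N ^ 3 * x * a\<^sup>2 * b\<^sup>2" for a b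
      by (simp add: K_def power_mult_distrib power2_eq_square power3_eq_cube mult_ac)
    then show ?thesis unfolding inv .
  qed
  also have "x = d * (1 / \<epsilon>) * (1 / \<beta>)" by (simp add: x_def)
  finally have le: "K1 * N\<^sup>2 * G / \<kappa>\<^sup>2 \<le> K * N ^ 3 * (d * (1 / \<epsilon>) * (1 / \<beta>)) * (1 / \<epsilon>)\<^sup>2 * (1 + 1 / opt)\<^sup>2" .
  have "0 < K1 * N\<^sup>2 * G / \<kappa>\<^sup>2" using K1_pos n G_ge \<kappa>_bounds by simp
  then have "ln (K1 * N\<^sup>2 * G / \<kappa>\<^sup>2) \<le> ln (K * N ^ 3 * (d * (1 / \<epsilon>) * (1 / \<beta>)) * (1 / \<epsilon>)\<^sup>2 * (1 + 1 / opt)\<^sup>2)"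
    using le by simp
  also have "\<dots> = ln K + 3 * ln N + (ln d + ln (1 / \<epsilon>) + ln (1 / \<beta>)) + 2 * ln (1 / \<epsilon>) + 2 * ln (1 + 1 / opt)"
  proof -
    have p: "0 < K" "0 < N" "0 < real d" "0 < 1 / \<epsilon>" "0 < 1 / \<beta>" using K n d \<epsilon> \<beta> by auto
    show ?thesis
      using p o by (simp only: ln_mult ln_realpow zero_less_mult_iff zero_less_power simp_thms) simp
  qed
  also have "\<dots> \<le> K2 * L"
  proof -
    have nn: "0 \<le> ln N" "0 \<le> ln d" "0 \<le> ln (1 / \<epsilon>)" "0 \<le> ln (1 / \<beta>)" "0 \<le> ln (1 + 1 / opt)"
      using n d \<epsilon> \<beta> opt by (auto simp: ln_div)
    have "ln K * 1 \<le> ln K * L" using K L_ge by (intro mult_left_mono) auto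
    moreover have "L = 1 + ln (real d) + ln (real n) + ln (1 / \<epsilon>) + ln (1 / \<beta>) + ln (1 + 1 / opt)"
      by (simp add: L_def log_factor_def)
    ultimately show ?thesis using nn by (simp add: K2_def K_def[symmetric] distrib_right)
  qed
  finally show ?thesis .
qed

definition "iterations = nat \<lceil>2 * G * (K2 * L)\<rceil>"

lemma potential_decay:
  assumes "iterations \<le> T"
  shows "K1 * N\<^sup>2 * G * (1 - 1 / (2 * G)) ^ T \<le> \<kappa>\<^sup>2"
proof -
  define Z where "Z = K1 * N\<^sup>2 * G"
  have Z: "0 < Z" using K1_pos n G_ge by (simp add: Z_def)
  have "2 * G * (K2 * L) \<le> real iterations" unfolding iterations_def by linarith
  then have "2 * G * (K2 * L) \<le> real T" using assms by linarith
  then have "ln (Z / \<kappa>\<^sup>2) \<le> T / (2 * G)"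
    using ln_ratio_le G_ge by (simp add: Z_def pos_le_divide_eq mult.commute order.trans)
  then have e: "exp (- (T / (2 * G))) \<le> \<kappa>\<^sup>2 / Z"
  proof -
    assume "ln (Z / \<kappa>\<^sup>2) \<le> T / (2 * G)"
    then have "exp (- (T / (2 * G))) \<le> exp (- ln (Z / \<kappa>\<^sup>2))" by simp
    also have "\<dots> = \<kappa>\<^sup>2 / Z" using Z \<kappa>_bounds by (simp add: exp_minus)
    finally show ?thesis .
  qed
  have "1 - 1 / (2 * G) \<le> exp (- (1 / (2 * G)))"
    using exp_ge_add_one_self[of "- (1 / (2 * G))"] by simp
  then have "(1 - 1 / (2 * G)) ^ T \<le> exp (- (1 / (2 * G))) ^ T"
    using G_ge by (intro power_mono) auto
  also have "\<dots> = exp (- (T / (2 * G)))" by (simp add: exp_of_nat_mult[symmetric])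
  finally have "Z * (1 - 1 / (2 * G)) ^ T \<le> Z * (\<kappa>\<^sup>2 / Z)" using e Z by (intro mult_left_mono) auto
  then show ?thesis using Z unfolding Z_def[symmetric] by simp
qed

text \<open>Of the two factors \<open>L\<close>, one bounds the \<open>ln N\<close> inside
  \<open>G\<close>, the other the logarithm of the accuracy to be reached.\<close>

lemma iterations_le:
  "real iterations \<le> 3 * K2 * (1 + 2 * cq) * (d + sqrt (d / (\<epsilon> * \<beta>))) * L\<^sup>2"
proof -
  have p: "0 \<le> 2 * G * (K2 * L)" using G_ge K2_ge L_ge by simp
  then have "real iterations \<le> 2 * G * (K2 * L) + 1" unfolding iterations_def by linarith
  also have "1 \<le> G * (K2 * L)"
  proof -
    have "1 * (1 * 1) \<le> G * (K2 * L)" using G_ge K2_ge L_ge by (intro mult_mono) auto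
    then show ?thesis by simp
  qed
  finally have "real iterations \<le> 3 * K2 * L * G" by (simp add: mult_ac)
  also have "\<dots> \<le> 3 * K2 * L * ((1 + 2 * cq) * (d + sqrt x) * L)"
    using G_le_L K2_ge L_ge by (intro mult_left_mono) auto
  also have "\<dots> = 3 * K2 * (1 + 2 * cq) * (d + sqrt (d / (\<epsilon> * \<beta>))) * L\<^sup>2"
    by (simp add: x_def power2_eq_square algebra_simps)
  finally show ?thesis .
qed

end

section \<open>Assembling the theorem\<close>

lemma distance_ratio_bounds:
  assumes A: "A \<in> carrier_mat d n\<^sub>1" and B: "B \<in> carrier_mat d n\<^sub>2"
    and ne: "\<exists>x \<in> points A B. \<exists>y \<in> points A B. x \<noteq> y"
  shows "0 < distance_ratio A B" "distance_ratio A B \<le> 1"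
proof -
  let ?S = "pairwise_distances A B"
  have "finite (points A B)" by (simp add: points_def)
  then have "finite ((\<lambda>(x, y). sqrt ((x - y) \<bullet> (x - y))) ` (points A B \<times> points A B))" by simp
  then have fin: "finite ?S" by (rule rev_finite_subset) (auto simp: pairwise_distances_def)
  have nonempty: "?S \<noteq> {}" using ne by (auto simp: pairwise_distances_def)
  have "0 < r" if r: "r \<in> ?S" for r
  proof -
    obtain x y where xy: "x \<in> points A B" "y \<in> points A B" "x \<noteq> y" "r = sqrt ((x - y) \<bullet> (x - y))"
      using r by (auto simp: pairwise_distances_def)
    have dim: "dim_vec x = d" "dim_vec y = d"
      using xy A B cols_dim[of A] cols_dim[of B] by (auto simp: points_def)
    have "(x - y) \<bullet> (x - y) = (\<Sum>i<d. (x $ i - y $ i)\<^sup>2)"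
      using dim by (simp add: scalar_prod_def atLeast0LessThan power2_eq_square)
    moreover have "0 < (\<Sum>i<d. (x $ i - y $ i)\<^sup>2)"
    proof -
      obtain i where "i < d" "x $ i \<noteq> y $ i" using xy(3) dim by (metis eq_vecI)
      then show ?thesis by (intro sum_pos2[of _ i]) auto
    qed
    ultimately show ?thesis using xy(4) by simp
  qed
  then have "0 < Min ?S" "0 < Max ?S" using fin nonempty by (simp_all add: Max_gr_iff) blast
  moreover have "Min ?S \<le> Max ?S" using fin nonempty by simp
  ultimately show "0 < distance_ratio A B" "distance_ratio A B \<le> 1"
    by (simp_all add: distance_ratio_def)
qed

lemma rotated_convergence:
  assumes A: "A \<in> carrier_mat (2 ^ m) n\<^sub>1" and B: "B \<in> carrier_mat (2 ^ m) n\<^sub>2"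
    and svc: "saddle_svc P A B (2 ^ m) n\<^sub>1 n\<^sub>2 \<gamma> q"
    and sol: "optimal_solution P A B \<gamma> w\<^sub>0 \<eta>\<^sub>0 \<xi>\<^sub>0"
    and rate: "rate_parameters (2 ^ m) (n\<^sub>1 + n\<^sub>2) \<epsilon> \<beta> (OPT P A B) cq ce \<gamma> q"
    and cqe: "cq = 8 * ce"
    and s: "s \<in> set_pmf (random_signs (2 ^ m))"
    and bounded: "entries_bounded (ce * sqrt (ln (real (n\<^sub>1 + n\<^sub>2)) / real (2 ^ m))) (rotation m s * A)"
      "entries_bounded (ce * sqrt (ln (real (n\<^sub>1 + n\<^sub>2)) / real (2 ^ m))) (rotation m s * B)"
    and T: "rate_parameters.iterations (2 ^ m) (n\<^sub>1 + n\<^sub>2) \<epsilon> \<beta> (OPT P A B) cq ce \<gamma> q \<le> T"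
  shows "expected_loss P m A B \<gamma> q w\<^sub>0 s T \<le> \<epsilon> * OPT P A B"
proof -
  interpret rate_parameters "2 ^ m" "n\<^sub>1 + n\<^sub>2" \<epsilon> \<beta> "OPT P A B" cq ce \<gamma> q by (rule rate)
  interpret AB: saddle_svc P A B "2 ^ m" n\<^sub>1 n\<^sub>2 \<gamma> q by (rule svc)
  define Q where "Q = rotation m s"
  interpret rotated_svm Q A B "2 ^ m" n\<^sub>1 n\<^sub>2
    by unfold_locales (use A B rotation_orthogonal[OF s] in \<open>auto simp: Q_def\<close>)
  define R where "R = ce * sqrt (ln (real (n\<^sub>1 + n\<^sub>2)) / real (2 ^ m))"
  have w0: "w\<^sub>0 \<in> carrier_vec (2 ^ m)" and feas: "\<eta>\<^sub>0 \<in> feasible P n\<^sub>1" "\<xi>\<^sub>0 \<in> feasible P n\<^sub>2"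
    using sol unfolding optimal_solution_def dims_rotated by auto
  have sol': "optimal_solution P (Q * A) (Q * B) \<gamma> (Q *\<^sub>v w\<^sub>0) \<eta>\<^sub>0 \<xi>\<^sub>0"
    by (rule optimal_solution_rotated[OF sol])
  interpret rot: saddle_svc P "Q * A" "Q * B" "2 ^ m" n\<^sub>1 n\<^sub>2 \<gamma> q
    by unfold_locales (use Q A B AB.d AB.n AB.cap AB.\<gamma> AB.q in auto)
  have R0: "0 < R" using ce pos by (simp add: R_def)
  interpret saddle_svc_optimum P "Q * A" "Q * B" "2 ^ m" n\<^sub>1 n\<^sub>2 \<gamma> q R "Q *\<^sub>v w\<^sub>0" \<eta>\<^sub>0 \<xi>\<^sub>0
  proof unfold_locales
    show "0 < R" by (rule R0)
    show "entries_bounded R (Q * A)" "entries_bounded R (Q * B)" using bounded by (auto simp: R_def Q_def)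
    show "step_sigma (real (2 ^ m)) \<gamma> q * (8 * R\<^sup>2) * step_tau (real (2 ^ m)) \<gamma> q \<le> 1 / 16"
      unfolding R_def step_sizes using ce by (simp add: cqe power2_eq_square)
    show "Q *\<^sub>v w\<^sub>0 \<in> carrier_vec (2 ^ m)" using Q w0 by simp
    show "(Q *\<^sub>v w\<^sub>0) $ j = rot.game \<eta>\<^sub>0 \<xi>\<^sub>0 j" if "j < 2 ^ m" for j
      by (rule rot.optimal_solution_stationary[OF sol' that])
    show "\<eta>\<^sub>0 \<in> feasible P n\<^sub>1" "\<xi>\<^sub>0 \<in> feasible P n\<^sub>2" by (rule feas)+
    show "reg_payoff (Q * A) (Q * B) \<gamma> (Q *\<^sub>v w\<^sub>0) \<eta>\<^sub>0 \<xi>\<^sub>0 \<le> reg_payoff (Q * A) (Q * B) \<gamma> (Q *\<^sub>v w\<^sub>0) \<eta> \<xi>"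
      if "\<eta> \<in> feasible P n\<^sub>1" "\<xi> \<in> feasible P n\<^sub>2" for \<eta> \<xi>
      using sol' that unfolding optimal_solution_def dims_rotated by blast
  qed
  have G: "condition_number = G" by (simp add: condition_number_def G_def)
  have "2 * (4 * real (2 ^ m) * R\<^sup>2 + 1) * initial_bound * \<rho> ^ T \<le> K1 * (real (n\<^sub>1 + n\<^sub>2))\<^sup>2 * G * \<rho> ^ T"
    unfolding initial_bound_def unfolding R_def using \<rho>_bounds
    by (intro mult_right_mono initial_bound_le AB.n refl) auto
  also have "\<dots> \<le> \<kappa>\<^sup>2" unfolding \<rho>_def G by (rule potential_decay[OF T])
  finally have small: "2 * (4 * real (2 ^ m) * R\<^sup>2 + 1) * initial_bound * \<rho> ^ T \<le> \<kappa>\<^sup>2" .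
  have "expected_loss P m A B \<gamma> q w\<^sub>0 s T
    \<le> measure_pmf.expectation (svc_run P (Q * A) (Q * B) \<gamma> q T)
      (\<lambda>st. saddle_value P (Q * A) (Q * B) (Q *\<^sub>v w\<^sub>0) - saddle_value P (Q * A) (Q * B) (it_w st))"
    unfolding expected_loss_def Q_def[symmetric]
  proof (intro expectation_mono_finite finite_run)
    fix st assume "st \<in> set_pmf (svc_run P (Q * A) (Q * B) \<gamma> q T)"
    then have "it_w st \<in> carrier_vec (2 ^ m)" using iterate_inv_run by (auto simp: iterate_inv_def)
    then show "saddle_value P A B w\<^sub>0 - saddle_value P A B (transpose_mat Q *\<^sub>v it_w st)
      \<le> saddle_value P (Q * A) (Q * B) (Q *\<^sub>v w\<^sub>0) - saddle_value P (Q * A) (Q * B) (it_w st)"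
      using y(1) w0 by (simp add: saddle_value_rotated transpose_mult_cancel)
  qed
  also have "\<dots> \<le> 2 * (\<epsilon> * OPT P A B / 2)"
    by (rule expected_loss_le[OF \<kappa>_bounds small])
  finally show ?thesis by simp
qed

theorem theorem6:
  fixes P :: saddle_problem and c :: nat
  assumes "\<And>\<nu>. P = Nu_Saddle \<nu> \<Longrightarrow> 0 < \<nu> \<and> \<nu> \<le> 1"
  shows "\<exists>c\<^sub>q > 0. \<exists>c\<^sub>e > 0. \<exists>C > 0. \<exists>k :: nat.
    \<forall>m n\<^sub>1 n\<^sub>2 A B \<epsilon> \<beta> \<gamma> q d n w\<^sub>0 \<eta>\<^sub>0 \<xi>\<^sub>0.
      d = 2 ^ m \<longrightarrow> n = n\<^sub>1 + n\<^sub>2 \<longrightarrow> svm_instance P d n\<^sub>1 n\<^sub>2 A B \<longrightarrow>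
      0 < \<epsilon> \<longrightarrow> \<epsilon> < 1 \<longrightarrow> \<beta> = distance_ratio A B \<longrightarrow>
      \<gamma> = \<epsilon> * \<beta> / (2 * ln (real n)) \<longrightarrow> q = c\<^sub>q * sqrt (ln (real n)) \<longrightarrow>
      optimal_solution P A B \<gamma> w\<^sub>0 \<eta>\<^sub>0 \<xi>\<^sub>0 \<longrightarrow>
      (let bounded = (\<lambda>s. entries_bounded (c\<^sub>e * sqrt (ln (real n) / real d)) (rotation m s * A) \<and>
                          entries_bounded (c\<^sub>e * sqrt (ln (real n) / real d)) (rotation m s * B));
           approx = (\<lambda>s T. expected_loss P m A B \<gamma> q w\<^sub>0 s T \<le> \<epsilon> * OPT P A B)
       in measure_pmf.prob (random_signs d) {s. bounded s} \<ge> 1 - real d / real n ^ c \<and>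
          (\<exists>T. real T \<le> C * (real d + sqrt (real d / (\<epsilon> * \<beta>))) * log_factor d n \<epsilon> \<beta> (OPT P A B) ^ k \<and>
               (\<forall>s \<in> set_pmf (random_signs d). bounded s \<longrightarrow>
                  approx s T \<and> (OPT P A B > 0 \<longrightarrow> (\<forall>T' \<ge> T. approx s T')))) \<and>
          (\<forall>s \<in> set_pmf (random_signs d).
             iterations_within d P (rotation m s * A) (rotation m s * B) \<gamma> q (C * real n)))"
proof -
  define ce where "ce = sqrt (2 * (real c + 2))"
  define cq where "cq = 8 * ce"
  define K1 where "K1 = 2 * (4 * ce\<^sup>2 + 1) * (4 * ce\<^sup>2 + 6)"
  define K2 where "K2 = ln (4 * K1 * (1 + 2 * cq)) + 3"
  \<comment> \<open>One constant for the number of iterations and for the steps of each; it depends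
    only on \<open>c\<close> and \<open>P\<close>.\<close>
  define C where "C = max (3 * K2 * (1 + 2 * cq)) (real (63 + cap_cost P))"
  have ce: "0 < ce" by (simp add: ce_def)
  have cq: "0 < cq" using ce by (simp add: cq_def)
  have C: "0 < C" "3 * K2 * (1 + 2 * cq) \<le> C" "real (63 + cap_cost P) \<le> C"
    by (auto simp: C_def)
  show ?thesis
  proof (rule exI[of _ cq], intro conjI cq, rule exI[of _ ce], intro conjI ce,
      rule exI[of _ C], intro conjI C(1), rule exI[of _ 2], intro allI impI)
    fix m n\<^sub>1 n\<^sub>2 :: nat and A B :: "real Matrix.mat" and \<epsilon> \<beta> \<gamma> q :: real and d n :: nat
      and w\<^sub>0 \<eta>\<^sub>0 \<xi>\<^sub>0 :: "real Matrix.vec"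
    assume d: "d = 2 ^ m" and n: "n = n\<^sub>1 + n\<^sub>2" and inst: "svm_instance P d n\<^sub>1 n\<^sub>2 A B"
      and \<epsilon>: "0 < \<epsilon>" "\<epsilon> < 1" and \<beta>: "\<beta> = distance_ratio A B"
      and \<gamma>: "\<gamma> = \<epsilon> * \<beta> / (2 * ln (real n))" and q: "q = cq * sqrt (ln (real n))"
      and opt: "optimal_solution P A B \<gamma> w\<^sub>0 \<eta>\<^sub>0 \<xi>\<^sub>0"
    have A: "A \<in> carrier_mat d n\<^sub>1" and B: "B \<in> carrier_mat d n\<^sub>2" and n12: "1 \<le> n\<^sub>1" "1 \<le> n\<^sub>2"
      and pts: "\<And>x. x \<in> points A B \<Longrightarrow> x \<bullet> x \<le> 1" and ne: "\<exists>x \<in> points A B. \<exists>y \<in> points A B. x \<noteq> y"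
      and adm: "admissible P A B"
      using inst by (auto simp: svm_instance_def)
    have dims: "dim_col A = n\<^sub>1" "dim_col B = n\<^sub>2" using A B by auto
    have cap: "cap_ok P n\<^sub>1" "cap_ok P n\<^sub>2"
      using adm assms by (cases P; simp add: dims)+
    have d1: "1 \<le> d" by (simp add: d)
    have n2: "2 \<le> n" using n12 n by simp
    have \<beta>01: "0 < \<beta>" "\<beta> \<le> 1" unfolding \<beta> by (rule distance_ratio_bounds[OF A B ne])+
    have lnn: "0 < ln (real n)" using n2 by simp
    have pos: "0 < \<gamma>" "0 < q" using \<epsilon> \<beta>01 lnn cq by (auto simp: \<gamma> q)
    interpret AB: saddle_svc P A B d n\<^sub>1 n\<^sub>2 \<gamma> q
      by unfold_locales (use A B d1 n12 cap pos in auto)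
    have w0: "w\<^sub>0 \<in> carrier_vec d" using opt A by (simp add: optimal_solution_def)
    define bounded where "bounded = (\<lambda>s. entries_bounded (ce * sqrt (ln (real n) / real d)) (rotation m s * A) \<and>
                          entries_bounded (ce * sqrt (ln (real n) / real d)) (rotation m s * B))"
    define approx where "approx = (\<lambda>s T. expected_loss P m A B \<gamma> q w\<^sub>0 s T \<le> \<epsilon> * OPT P A B)"
    let ?L = "log_factor d n \<epsilon> \<beta> (OPT P A B)"
    have 1: "measure_pmf.prob (random_signs d) {s. bounded s} \<ge> 1 - real d / real n ^ c"
      using prob_entries_bounded[OF A[unfolded d] B[unfolded d] n12 pts ce_def] unfolding bounded_def d n .
    have 2: "\<exists>T. real T \<le> C * (real d + sqrt (real d / (\<epsilon> * \<beta>))) * ?L ^ 2 \<and>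
               (\<forall>s \<in> set_pmf (random_signs d). bounded s \<longrightarrow>
                  approx s T \<and> (OPT P A B > 0 \<longrightarrow> (\<forall>T' \<ge> T. approx s T')))"
    proof (cases "OPT P A B > 0")
      case True
      have rate: "rate_parameters d n \<epsilon> \<beta> (OPT P A B) cq ce \<gamma> q"
        by unfold_locales (use d1 n2 \<epsilon> \<beta>01 True cq ce \<gamma> q in auto)
      interpret rate: rate_parameters d n \<epsilon> \<beta> "OPT P A B" cq ce \<gamma> q by (rule rate)
      have "real rate.iterations \<le> 3 * rate.K2 * (1 + 2 * cq) * (d + sqrt (d / (\<epsilon> * \<beta>))) * rate.L\<^sup>2"
        by (rule rate.iterations_le)
      also have "rate.K2 = K2" by (simp add: rate.K2_def rate.K1_def K2_def K1_def)
      also have "rate.L = ?L" by (simp add: rate.L_def)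
      also have "3 * K2 * (1 + 2 * cq) * (d + sqrt (d / (\<epsilon> * \<beta>))) * ?L\<^sup>2 \<le> C * (d + sqrt (d / (\<epsilon> * \<beta>))) * ?L\<^sup>2"
        using C(2) \<epsilon> \<beta>01 by (intro mult_right_mono) auto
      finally have "real rate.iterations \<le> C * (real d + sqrt (real d / (\<epsilon> * \<beta>))) * ?L ^ 2" .
      moreover have "approx s T" if "s \<in> set_pmf (random_signs d)" "bounded s" "rate.iterations \<le> T" for s T
        unfolding approx_def
        using rotated_convergence[OF A[unfolded d] B[unfolded d] AB.saddle_svc_axioms[unfolded d] opt
            rate[unfolded d n] cq_def that(1)[unfolded d]] that(2,3)
        unfolding bounded_def d n by blast
      ultimately show ?thesis by blast
    next
      case False
      then have OPT0: "OPT P A B = 0" using AB.OPT_nonneg by simp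
      \<comment> \<open>The permitted loss is 0 here, and only the start is claimed to meet it. In
        \<open>log_factor\<close> the term \<open>1 / OPT\<close> is 0, by the convention for
        division by zero.\<close>
      have "approx s 0" for s
      proof -
        have rd: "dim_row (rotation m s) = d" "dim_col (rotation m s) = d"
          using rotation_carrier[of m s] unfolding d by blast+
        have "transpose_mat (rotation m s) *\<^sub>v 0\<^sub>v d = 0\<^sub>v d"
          using rd by (intro eq_vecI) auto
        moreover have "saddle_value P A B w\<^sub>0 \<le> 0"
          using AB.saddle_value_le_OPT[OF w0] by (simp add: OPT0)
        ultimately show ?thesis
          by (simp add: approx_def expected_loss_def OPT0 svc_init_def Let_def rd AB.saddle_value_zero)
      qed
      moreover have "0 \<le> C * (real d + sqrt (real d / (\<epsilon> * \<beta>))) * ?L ^ 2"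
        using C \<epsilon> \<beta>01 by (intro mult_nonneg_nonneg add_nonneg_nonneg) auto
      ultimately show ?thesis using False by (intro exI[of _ 0]) auto
    qed
    have 3: "iterations_within d P (rotation m s * A) (rotation m s * B) \<gamma> q (C * real n)" for s
    proof -
      interpret rot: saddle_svc P "rotation m s * A" "rotation m s * B" d n\<^sub>1 n\<^sub>2 \<gamma> q
        by unfold_locales
          (use A B d1 n12 cap pos rotation_carrier[of m s, folded d] in \<open>auto intro: mult_carrier_mat\<close>)
      have "real (63 + cap_cost P) * real (n\<^sub>1 + n\<^sub>2) \<le> C * real n"
        unfolding n using C(3) by (intro mult_right_mono) auto
      then show ?thesis by (rule rot.iterations_within)
    qed
    show "let bounded = (\<lambda>s. entries_bounded (ce * sqrt (ln (real n) / real d)) (rotation m s * A) \<and>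
                          entries_bounded (ce * sqrt (ln (real n) / real d)) (rotation m s * B));
           approx = (\<lambda>s T. expected_loss P m A B \<gamma> q w\<^sub>0 s T \<le> \<epsilon> * OPT P A B)
       in measure_pmf.prob (random_signs d) {s. bounded s} \<ge> 1 - real d / real n ^ c \<and>
          (\<exists>T. real T \<le> C * (real d + sqrt (real d / (\<epsilon> * \<beta>))) * log_factor d n \<epsilon> \<beta> (OPT P A B) ^ 2 \<and>
               (\<forall>s \<in> set_pmf (random_signs d). bounded s \<longrightarrow>
                  approx s T \<and> (OPT P A B > 0 \<longrightarrow> (\<forall>T' \<ge> T. approx s T')))) \<and>
          (\<forall>s \<in> set_pmf (random_signs d).
             iterations_within d P (rotation m s * A) (rotation m s * B) \<gamma> q (C * real n))"
      unfolding Let_def bounded_def[symmetric] approx_def[symmetric]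
      using 1 2 3 unfolding bounded_def approx_def by blast
  qed
qed

end
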